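(* Let $d\ge 3$, $n\ge 2(d+1)$ (with $dn$ an integer), and $f\in C(\mathbb{S}^d)$. Let $r>0$ and suppose there is $\delta>0$ (independent of $\mathbf{x}$) such that $$\|f\|_{W_{d;r}}:=\sup_{\mathbf{x}\in\mathbb{S}^d}\left(\|f\|_\infty+\min_{P\in\Pi_r^d}\max_{\mathbf{y}\in\mathbb{B}(\mathbf{x},\delta)}\frac{|f(\mathbf{y})-P(\mathbf{y})|}{|\mathbf{x}-\mathbf{y}|_{d+1}^r}\right)<\infty.$$ If $dn\ge(d+r+1)^2$ and $\sqrt{16r\log n/n}\le\delta$, then $$E_{d;2(d+2)n}(f)\lesssim\frac{d^{1/6}}{\mathsf{dim}(\Pi_{2(d+2)n}^d)^{r/d}}\|f\|_{W_{d;r}}.$$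
   Context: $\mathbb{S}^d$ is the unit sphere of $\mathbb{R}^{d+1}$, $|\cdot|_{d+1}$ the Euclidean norm, $\mathbb{B}(\mathbf{x},\delta)=\{\mathbf{y}\in\mathbb{S}^d:|\mathbf{x}-\mathbf{y}|_{d+1}\le\delta\}$. For real $m>0$, $\Pi_m^d$ is the space of restrictions to $\mathbb{S}^d$ of algebraic polynomials in $d+1$ variables of total degree $<m$. $\|g\|_\infty=\sup_{\mathbb{S}^d}|g|$ and $E_{d;m}(f)=\min_{P\in\Pi_m^d}\|f-P\|_\infty$. Convention: $A\lesssim B$ means $A\le cB$ for a positive constant $c$ that may depend on $r$ but is independent of $d$, $n$, $f$. *)

theory Defs
  imports "HOL-Analysis.Analysis"
begin

text \<open>Points of R^(d+1) are represented as functions nat => real whose coordinates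
  vanish outside the index range 0..d.\<close>

definition enorm :: "nat \<Rightarrow> (nat \<Rightarrow> real) \<Rightarrow> real" where
  "enorm d x = sqrt (\<Sum>i\<le>d. (x i)\<^sup>2)"

definition sphere_d :: "nat \<Rightarrow> (nat \<Rightarrow> real) set" where
  "sphere_d d = {x. (\<forall>i>d. x i = 0) \<and> enorm d x = 1}"

definition cap :: "nat \<Rightarrow> (nat \<Rightarrow> real) \<Rightarrow> real \<Rightarrow> (nat \<Rightarrow> real) set" where
  "cap d x \<delta> = {y \<in> sphere_d d. enorm d (x - y) \<le> \<delta>}"

definition polys :: "nat \<Rightarrow> real \<Rightarrow> ((nat \<Rightarrow> real) \<Rightarrow> real) set" where
  "polys d m = {P. \<exists>A c. finite A \<and>
      (\<forall>\<alpha>\<in>A. (\<forall>i>d. \<alpha> i = 0) \<and> real (\<Sum>i\<le>d. \<alpha> i) < m) \<and>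
      P = (\<lambda>x. \<Sum>\<alpha>\<in>A. c \<alpha> * (\<Prod>i\<le>d. x i ^ \<alpha> i))}"

definition dimP :: "nat \<Rightarrow> real \<Rightarrow> nat" where
  "dimP d m = Max {k. \<exists>g :: nat \<Rightarrow> (nat \<Rightarrow> real) \<Rightarrow> real.
      (\<forall>j<k. g j \<in> polys d m) \<and>
      (\<forall>c :: nat \<Rightarrow> real. (\<forall>x\<in>sphere_d d. (\<Sum>j<k. c j * g j x) = 0) \<longrightarrow> (\<forall>j<k. c j = 0))}"

definition sup_norm :: "nat \<Rightarrow> ((nat \<Rightarrow> real) \<Rightarrow> real) \<Rightarrow> real" where
  "sup_norm d g = (SUP x\<in>sphere_d d. \<bar>g x\<bar>)"

definition best_approx :: "nat \<Rightarrow> real \<Rightarrow> ((nat \<Rightarrow> real) \<Rightarrow> real) \<Rightarrow> real" where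
  "best_approx d m f = (INF P\<in>polys d m. sup_norm d (\<lambda>x. f x - P x))"

definition cont_sphere :: "nat \<Rightarrow> ((nat \<Rightarrow> real) \<Rightarrow> real) \<Rightarrow> bool" where
  "cont_sphere d f = (\<forall>x\<in>sphere_d d. \<forall>e>0. \<exists>\<eta>>0. \<forall>y\<in>sphere_d d.
      enorm d (x - y) < \<eta> \<longrightarrow> \<bar>f y - f x\<bar> < e)"

text \<open>The local smoothness norm, valued in the extended reals (may be infinite).
  The point y = x is excluded from the inner maximum (the quotient is undefined there).\<close>
definition W_norm :: "nat \<Rightarrow> real \<Rightarrow> real \<Rightarrow> ((nat \<Rightarrow> real) \<Rightarrow> real) \<Rightarrow> ereal" where
  "W_norm d r \<delta> f = (SUP x\<in>sphere_d d. ereal (sup_norm d f) +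
      (INF P\<in>polys d r. SUP y\<in>cap d x \<delta> - {x}.
         ereal (\<bar>f y - P y\<bar> / enorm d (x - y) powr r)))"

end

theory Submission
  imports Defs "HOL-Computational_Algebra.Polynomial"
begin

text \<open>A Jackson--Stechkin argument in \<open>\<real>\<^sup>d\<^sup>+\<^sup>1\<close>. Let \<open>F\<close> extend \<open>f\<close> from the sphere to the shell
  \<open>1/2 \<le> |y| \<le> 3/2\<close> (zero elsewhere) by \<open>F y = |y|\<^sup>2\<^sup>\<rho> f (y / |y|)\<close>, and let \<open>\<phi>\<close> be a power, of order \<open>d\<close>, of a Fejer kernel
  in \<open>|z|\<^sup>2\<close>. The mean over \<open>z\<close> with density \<open>\<phi>\<close> of the \<open>K\<close>-th difference of \<open>F\<close> at \<open>x\<close> with step \<open>z\<close> is, up to sign,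
  \<open>f x - Q x\<close>, where \<open>Q\<close> is a polynomial on the sphere because \<open>|y - x|\<^sup>2 = 1 + |y|\<^sup>2 - 2 x \<bullet> y\<close> there.
  The power compensates the volume factor \<open>|z|\<^sup>d\<close>, so \<open>\<phi>\<close> lives at scale \<open>1/n\<close> with constants free of
  \<open>d\<close>. The difference annihilates a polynomial agreeing with the local approximant of \<open>f\<close> near \<open>x\<close>; far
  from \<open>x\<close> that approximant grows at most like a power of \<open>1/\<delta>\<close> with \<open>1/\<delta> = O(n\<^sup>1\<^sup>/\<^sup>2)\<close>, which the moments of \<open>\<phi>\<close>
  absorb. Finally the dimension of the polynomial space is at most \<open>(c n)\<^sup>d\<close>.\<close>

section \<open>Finite differences and coefficient bounds\<close>

text \<open>Constants must not depend on d. The local approximants are therefore examined only on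
  lines and great circles, where their degree is bounded in terms of r alone, and the volume of the
  unit ball, present both in the mass and in the moments of the kernel, cancels. The kernel is the
  power d + 1 + s of a Fejer kernel of degree 2 j. Since d + 1 + s \<le> (d + 1) (1 + s), choosing j
  near n / (1 + s) keeps the degree within 2 (d + 2) n while the width stays of order 1/n. The
  second obstacle is parity. Powers of |y|^2 make the even part of a local approximant homogeneous
  of degree 2 \<rho>, which matches F along rays, but the odd part would require an odd power of
  |y|, which is not a polynomial. A polynomial in |y|^2 that is close to 1/|y| near |y| = 1 repairs
  this to any prescribed order. With \<rho> the ceiling of r and s = 4 \<rho>, the moments give
  n^(-4 \<rho>) and the growth of the approximant costs \<delta>^(-6 \<rho>), which is O(n^(3
  \<rho>)); what remains is n^(-\<rho>).\<close>

lemma coeff_bound_unit: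
  "\<exists>C>0. \<forall>(a :: nat \<Rightarrow> real) M. (\<forall>u\<in>{0..1}. \<bar>\<Sum>k\<le>m. a k * u ^ k\<bar> \<le> M) \<longrightarrow> (\<forall>k\<le>m. \<bar>a k\<bar> \<le> C * M)"
proof (induction m)
  case 0
  show ?case by (rule exI[of _ 1]) force
next
  case (Suc m)
  then obtain C where C: "C > 0" and IH: "\<And>(a :: nat \<Rightarrow> real) M k. (\<forall>u\<in>{0..1}. \<bar>\<Sum>k\<le>m. a k * u ^ k\<bar> \<le> M) \<Longrightarrow> k \<le> m \<Longrightarrow> \<bar>a k\<bar> \<le> C * M"
    by blast
  define D where "D = C * (1 + 2 ^ Suc m)"
  have D: "D > 0" unfolding D_def using C by (intro mult_pos_pos add_pos_pos) auto
  define C' where "C' = D + 1 + real (Suc m) * D"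
  have C': "C' > 0" using D by (simp add: C'_def add_pos_nonneg)
  have "\<bar>a k\<bar> \<le> C' * M" if bd: "\<forall>u\<in>{0..1}. \<bar>\<Sum>k\<le>Suc m. a k * u ^ k\<bar> \<le> M" and k: "k \<le> Suc m" for a :: "nat \<Rightarrow> real" and M k
  proof -
    \<comment> \<open>Subtracting \<open>2 ^ Suc m\<close> times the value at \<open>u / 2\<close>
      from the value at \<open>u\<close> cancels the leading term and multiplies the other
      coefficients by \<open>1 - 2 ^ (Suc m - k)\<close>, of modulus at least 1. The induction
      bounds those; the leading one then follows from u = 1.\<close>
    define b where "b k = a k * (1 - 2 ^ (Suc m - k))" for k
    have M0: "M \<ge> 0" using bd[rule_format, of 0] abs_ge_zero[of "\<Sum>k\<le>Suc m. a k * 0 ^ k"] by simp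
    have eq: "(\<Sum>k\<le>m. b k * u ^ k) = (\<Sum>k\<le>Suc m. a k * u ^ k) - 2 ^ Suc m * (\<Sum>k\<le>Suc m. a k * (u / 2) ^ k)" for u
    proof -
      have "(\<Sum>k\<le>Suc m. a k * u ^ k) - 2 ^ Suc m * (\<Sum>k\<le>Suc m. a k * (u / 2) ^ k) = (\<Sum>k\<le>Suc m. b k * u ^ k)"
        unfolding sum_distrib_left sum_subtractf[symmetric]
      proof (rule sum.cong)
        fix k assume "k \<in> {..Suc m}"
        then have "(2::real) ^ Suc m = 2 ^ (Suc m - k) * 2 ^ k" by (simp flip: power_add)
        then show "a k * u ^ k - 2 ^ Suc m * (a k * (u / 2) ^ k) = b k * u ^ k"
          by (simp add: b_def power_divide algebra_simps)
      qed simp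
      then show ?thesis by (simp add: b_def)
    qed
    have bb: "\<bar>\<Sum>k\<le>m. b k * u ^ k\<bar> \<le> (1 + 2 ^ Suc m) * M" if u: "u \<in> {0..1}" for u
    proof -
      have "u / 2 \<in> {0..1}" using u by auto
      then have "\<bar>\<Sum>k\<le>Suc m. a k * u ^ k\<bar> \<le> M" "\<bar>\<Sum>k\<le>Suc m. a k * (u / 2) ^ k\<bar> \<le> M"
        using bd u \<open>u / 2 \<in> {0..1}\<close> by blast+
      moreover have tri: "\<bar>x - 2 ^ Suc m * y\<bar> \<le> \<bar>x\<bar> + 2 ^ Suc m * \<bar>y\<bar>" for x y :: real
        using abs_triangle_ineq4[of x "2 ^ Suc m * y"] by (simp add: abs_mult)
      ultimately show ?thesis unfolding eq
        unfolding distrib_right mult_1 by (intro order_trans[OF tri] add_mono mult_left_mono) auto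
    qed
    have small: "\<bar>a k\<bar> \<le> D * M" if "k \<le> m" for k
    proof -
      have "1 \<le> (2::real) ^ (Suc m - k) - 1" using that
        by (simp add: Suc_diff_le)
      then have "\<bar>a k\<bar> * 1 \<le> \<bar>a k\<bar> * \<bar>1 - 2 ^ (Suc m - k)\<bar>" by (intro mult_left_mono) auto
      also have "\<dots> = \<bar>b k\<bar>" by (simp add: b_def abs_mult)
      also have "\<dots> \<le> D * M" using IH[of b "(1 + 2 ^ Suc m) * M" k] bb that by (simp add: D_def mult.assoc)
      finally show ?thesis by simp
    qed
    show ?thesis
    proof (cases "k \<le> m")
      case True
      then have "\<bar>a k\<bar> \<le> D * M" by (rule small)
      also have "\<dots> \<le> C' * M" using M0 D by (intro mult_right_mono) (auto simp: C'_def)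
      finally show ?thesis .
    next
      case False
      then have [simp]: "k = Suc m" using k by simp
      have "\<bar>\<Sum>k\<le>m. a k\<bar> \<le> (\<Sum>k\<le>m. D * M)" by (intro order_trans[OF sum_abs] sum_mono small) auto
      moreover have "\<bar>(\<Sum>k\<le>m. a k) + a (Suc m)\<bar> \<le> M" using bd[rule_format, of 1] by simp
      ultimately have "\<bar>a k\<bar> \<le> M + real (Suc m) * (D * M)" by auto
      also have "\<dots> \<le> C' * M" using M0 D by (simp add: C'_def algebra_simps)
      finally show ?thesis .
    qed
  qed
  then show ?case using C' by blast
qed

lemma coeff_bound:
  "\<exists>C>0. \<forall>(a :: nat \<Rightarrow> real) M \<eta>. 0 < \<eta> \<longrightarrow> (\<forall>u\<in>{0..\<eta>}. \<bar>\<Sum>k\<le>m. a k * u ^ k\<bar> \<le> M) \<longrightarrow>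
     (\<forall>k\<le>m. \<bar>a k\<bar> \<le> C * M / \<eta> ^ k)"
proof -
  obtain C where C: "C > 0" and IH: "\<And>(a :: nat \<Rightarrow> real) M k. (\<forall>u\<in>{0..1}. \<bar>\<Sum>k\<le>m. a k * u ^ k\<bar> \<le> M) \<Longrightarrow> k \<le> m \<Longrightarrow> \<bar>a k\<bar> \<le> C * M"
    using coeff_bound_unit[of m] by blast
  have "\<bar>a k\<bar> \<le> C * M / \<eta> ^ k" if \<eta>: "0 < \<eta>" and bd: "\<forall>u\<in>{0..\<eta>}. \<bar>\<Sum>k\<le>m. a k * u ^ k\<bar> \<le> M" and "k \<le> m" for a :: "nat \<Rightarrow> real" and M \<eta> k
  proof -
    have "\<bar>a k * \<eta> ^ k\<bar> \<le> C * M"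
    proof (rule IH[OF _ \<open>k \<le> m\<close>, of "\<lambda>k. a k * \<eta> ^ k"], intro ballI)
      fix u :: real assume "u \<in> {0..1}"
      then have "\<eta> * u \<in> {0..\<eta>}" using \<eta> by (auto simp: mult_left_le)
      from bd[rule_format, OF this] show "\<bar>\<Sum>k\<le>m. a k * \<eta> ^ k * u ^ k\<bar> \<le> M"
        by (simp add: power_mult_distrib mult.assoc)
    qed
    then show ?thesis using \<eta> by (simp add: abs_mult field_simps)
  qed
  then show ?thesis using C by blast
qed

text \<open>The absorption identity \<open>(m+1 choose i+1) * (i+1) = (m+1) * (m choose i)\<close>
  trades one factor of the power for a drop in the order of the difference. Expanding the remaining
  \<open>(i+1) ^ l\<close> leaves only powers below the new order.\<close>

lemma alternating_binomial_power_sum: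
  "k < m \<Longrightarrow> (\<Sum>i\<le>m. (-1) ^ i * real (m choose i) * real i ^ k) = 0"
proof (induction m arbitrary: k)
  case 0 then show ?case by simp
next
  case (Suc m)
  show ?case
  proof (cases k)
    case 0
    then show ?thesis using choose_alternating_sum[of "Suc m", where 'a = real] by simp
  next
    case (Suc l)
    have "(\<Sum>i\<le>Suc m. (-1) ^ i * real (Suc m choose i) * real i ^ k)
        = (\<Sum>i\<le>m. (-1) ^ Suc i * real (Suc m choose Suc i) * real (Suc i) ^ k)"
      by (subst sum.atMost_Suc_shift) (simp add: Suc)
    also have "\<dots> = (\<Sum>i\<le>m. \<Sum>q\<le>l. - real (Suc m) * real (l choose q) * ((-1) ^ i * real (m choose i) * real i ^ q))"
    proof (rule sum.cong[OF refl])
      fix i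
      have "real (Suc m choose Suc i) * real (Suc i) = real (Suc m) * real (m choose i)"
        using Suc_times_binomial_eq[of m i] by (metis of_nat_mult)
      then have "(-1) ^ Suc i * real (Suc m choose Suc i) * real (Suc i) ^ k = - real (Suc m) * ((-1) ^ i * real (m choose i)) * real (Suc i) ^ l"
        by (simp add: Suc del: binomial_Suc_Suc of_nat_Suc)
      also have "real (Suc i) ^ l = (\<Sum>q\<le>l. real (l choose q) * real i ^ q)"
        using binomial_ring[of "real i" 1 l] by (simp add: add.commute)
      finally show "(-1) ^ Suc i * real (Suc m choose Suc i) * real (Suc i) ^ k = (\<Sum>q\<le>l. - real (Suc m) * real (l choose q) * ((-1) ^ i * real (m choose i) * real i ^ q))"
        by (simp add: sum_distrib_left mult_ac)
    qed
    also have "\<dots> = (\<Sum>q\<le>l. - real (Suc m) * real (l choose q) * (\<Sum>i\<le>m. (-1) ^ i * real (m choose i) * real i ^ q))"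
      by (subst sum.swap) (simp only: sum_distrib_left)
    also have "\<dots> = 0"
      using Suc.IH Suc Suc.prems by (intro sum.neutral) auto
    finally show ?thesis .
  qed
qed

lemma finite_difference_poly:
  fixes p :: "real poly"
  assumes "degree p < m"
  shows "(\<Sum>i\<le>m. (-1) ^ i * real (m choose i) * poly p (real i)) = 0"
proof -
  have "(\<Sum>i\<le>m. (-1) ^ i * real (m choose i) * poly p (real i))
      = (\<Sum>k\<le>degree p. coeff p k * (\<Sum>i\<le>m. (-1) ^ i * real (m choose i) * real i ^ k))"
    unfolding poly_altdef sum_distrib_left by (subst sum.swap) (simp add: mult_ac)
  then show ?thesis using assms by (simp add: alternating_binomial_power_sum)
qed

text \<open>This is \<open>sin ((2 * j + 1) * t) / sin t\<close> as a polynomial in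
  \<open>u = (sin t)^2\<close>. The recursion is the formula for
  \<open>sin (s + 2 * t) + sin (s - 2 * t)\<close> with
  \<open>2 * cos (2 * t) = 2 - 4 * u\<close>.\<close>

fun odd_cheb :: "nat \<Rightarrow> real poly" where
  "odd_cheb 0 = 1"
| "odd_cheb (Suc 0) = [:3, -4:]"
| "odd_cheb (Suc (Suc j)) = [:2, -4:] * odd_cheb (Suc j) - odd_cheb j"

lemma degree_odd_cheb: "degree (odd_cheb j) \<le> j"
proof (induction j rule: odd_cheb.induct)
  case (3 j)
  have "degree ([:2, -4:] * odd_cheb (Suc j)) \<le> Suc (Suc j)"
    using degree_mult_le[of "[:2, -4:]" "odd_cheb (Suc j)"] 3 by simp
  then show ?case using 3 by (auto intro: degree_diff_le)
qed auto

lemma sin_odd_cheb: "sin t * poly (odd_cheb j) ((sin t)\<^sup>2) = sin ((2 * real j + 1) * t)"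
proof (induction j rule: odd_cheb.induct)
  case 2
  have "sin (3 * t) = sin t * (1 - 2 * (sin t)\<^sup>2) + cos t * (2 * sin t * cos t)"
    using sin_add[of t "2 * t"] by (simp add: sin_double cos_double_sin)
  also have "\<dots> = sin t * (1 - 2 * (sin t)\<^sup>2) + 2 * sin t * (cos t)\<^sup>2"
    by (simp add: power2_eq_square)
  also have "\<dots> = sin t * (3 - 4 * (sin t)\<^sup>2)"
    unfolding cos_squared_eq by (simp add: algebra_simps)
  finally show ?case by (simp add: algebra_simps)
next
  case (3 j)
  define s where "s = (2 * real (Suc j) + 1) * t"
  have "sin (s + 2 * t) + sin (s - 2 * t) = 2 * cos (2 * t) * sin s"
    by (simp add: sin_add sin_diff)
  moreover have "s - 2 * t = (2 * real j + 1) * t"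
    by (auto simp: s_def algebra_simps)
  moreover have "cos (2 * t) = 1 - 2 * (sin t)\<^sup>2" by (simp add: cos_double_sin)
  moreover have "sin t * poly (odd_cheb (Suc (Suc j))) ((sin t)\<^sup>2)
      = 2 * (1 - 2 * (sin t)\<^sup>2) * (sin t * poly (odd_cheb (Suc j)) ((sin t)\<^sup>2)) - sin t * poly (odd_cheb j) ((sin t)\<^sup>2)"
    by (simp add: algebra_simps)
  ultimately have "sin t * poly (odd_cheb (Suc (Suc j))) ((sin t)\<^sup>2) = sin (s + 2 * t)"
    unfolding 3 s_def[symmetric] by algebra
  also have "s + 2 * t = (2 * real (Suc (Suc j)) + 1) * t" by (simp add: s_def algebra_simps)
  finally show ?case .
qed auto

lemma odd_cheb_0: "poly (odd_cheb j) 0 = 2 * real j + 1"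
  by (induction j rule: odd_cheb.induct) auto

lemma sin_ge_half:
  fixes x :: real
  assumes "0 \<le> x" "x \<le> 1" shows "x / 2 \<le> sin x"
proof -
  have "sin x - x / 2 \<ge> sin 0 - 0 / 2"
  proof (rule DERIV_nonneg_imp_nondecreasing[of 0 x "\<lambda>x. sin x - x / 2"])
    fix y assume y: "0 \<le> y" "y \<le> x"
    have "cos (pi / 3) \<le> cos y" using y assms pi_gt3 by (intro cos_monotone_0_pi_le) auto
    then have "cos y - 1 / 2 \<ge> 0" by (simp add: cos_60)
    moreover have "((\<lambda>x. sin x - x / 2) has_real_derivative cos y - 1/2) (at y)"
      by (auto intro!: derivative_eq_intros)
    ultimately show "\<exists>z. ((\<lambda>x. sin x - x / 2) has_real_derivative z) (at y) \<and> 0 \<le> z" by blast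
  qed (use assms in auto)
  then show ?thesis by simp
qed

text \<open>\<open>A\<close> is the Fejer kernel \<open>(sin (k * t) / (k * sin t))^2\<close> in the
  variable \<open>u = (sin t)^2\<close>. The decay bound comes from |sin| \<le> 1, and the lower
  bound from sin x \<ge> x / 2 as long as \<open>k * t\<close> is at most 1.\<close>

lemma fejer_type_poly:
  fixes j :: nat
  defines "k \<equiv> 2 * real j + 1"
  obtains A :: "real poly" where "degree A \<le> 2 * j"
    "\<And>u. 0 \<le> poly A u"
    "\<And>u. 0 \<le> u \<Longrightarrow> u \<le> 1 \<Longrightarrow> poly A u * (k\<^sup>2 * u) \<le> 1"
    "\<And>u. 0 \<le> u \<Longrightarrow> u \<le> 1 / (2 * k)\<^sup>2 \<Longrightarrow> 1/4 \<le> poly A u"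
proof
  define A where "A = smult (1 / k\<^sup>2) ((odd_cheb j)\<^sup>2)"
  have k: "k \<ge> 1" by (simp add: k_def)
  show "degree A \<le> 2 * j"
    using degree_mult_le[of "odd_cheb j" "odd_cheb j"] degree_odd_cheb[of j] unfolding A_def power2_eq_square
    by (intro order_trans[OF degree_smult_le]) simp
  show "0 \<le> poly A u" for u by (simp add: A_def)
  have key: "k * sqrt u * (poly (odd_cheb j) u / k) = sin (k * arcsin (sqrt u))" if "0 \<le> u" "u \<le> 1" for u
  proof -
    have "sin (arcsin (sqrt u)) = sqrt u" using that by (intro sin_arcsin) (auto intro: order_trans[of _ 0])
    then show ?thesis
      using sin_odd_cheb[of "arcsin (sqrt u)" j] that k by (simp add: k_def[symmetric])
  qed
  have A: "poly A u = (poly (odd_cheb j) u / k)\<^sup>2" for u by (simp add: A_def power_divide)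
  show "poly A u * (k\<^sup>2 * u) \<le> 1" if "0 \<le> u" "u \<le> 1" for u
  proof -
    have "poly A u * (k\<^sup>2 * u) = (k * sqrt u * (poly (odd_cheb j) u / k))\<^sup>2"
      using that k by (simp add: A power_mult_distrib power_divide)
    also have "\<dots> \<le> 1" unfolding key[OF that] by (simp add: abs_square_le_1)
    finally show ?thesis .
  qed
  show "1/4 \<le> poly A u" if u: "0 \<le> u" "u \<le> 1 / (2 * k)\<^sup>2" for u
  proof (cases "u = 0")
    case True
    then show ?thesis using k by (simp add: A odd_cheb_0 k_def[symmetric])
  next
    case False
    then have u0: "u > 0" using u by simp
    \<comment> \<open>The threshold \<open>1 / (2 * k)\<close> lies below
      \<open>sin (1 / k)\<close>, which keeps the angle \<open>arcsin (sqrt u)\<close> within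
      \<open>1 / k\<close> and so makes \<open>sin_ge_half\<close> applicable to k times the
      angle.\<close>
    have su: "sqrt u \<le> 1 / (2 * k)" using u k by (intro real_le_lsqrt) (auto simp: power_divide)
    also have "\<dots> \<le> sin (1 / k)" using sin_ge_half[of "1/k"] k by simp
    finally have "arcsin (sqrt u) \<le> arcsin (sin (1 / k))"
      using u0 by (intro arcsin_le_arcsin) (auto intro: order_trans[of _ 0])
    moreover have "1 / k \<le> 1" "2 / k \<le> 2" using k by (auto simp: field_simps)
    ultimately have a1: "arcsin (sqrt u) \<le> 1 / k"
      using pi_gt3 k by (subst (asm) arcsin_sin) (auto intro: order_trans[of _ 0])
    have "1\<^sup>2 \<le> (2 * k)\<^sup>2" using k by (intro power_mono) auto
    then have u1: "u \<le> 1" using k by (intro order_trans[OF u(2)]) (simp add: field_simps)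
    have a0: "0 \<le> arcsin (sqrt u)" using arcsin_le_arcsin[of 0 "sqrt u"] u0 u1 by simp
    have "sin (arcsin (sqrt u)) = sqrt u" using u0 u1 by (intro sin_arcsin) (auto intro: order_trans[of _ 0])
    then have "sqrt u \<le> arcsin (sqrt u)" using sin_x_le_x[OF a0] by simp
    then have "k * sqrt u / 2 \<le> k * arcsin (sqrt u) / 2" using k by simp
    also have "\<dots> \<le> sin (k * arcsin (sqrt u))"
      using a0 a1 k by (intro sin_ge_half) (auto simp: field_simps)
    also have "\<dots> = k * sqrt u * (poly (odd_cheb j) u / k)" using key[of u] u0 u1 by simp
    finally have "1 / 2 \<le> poly (odd_cheb j) u / k" using k u0 by (simp add: field_simps)
    then have "(1/2)\<^sup>2 \<le> (poly (odd_cheb j) u / k)\<^sup>2" by (intro power_mono) auto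
    then show ?thesis by (simp add: A power_divide)
  qed
qed

section \<open>Lebesgue measure on finite products and moments of localized kernels\<close>

text \<open>Points of this space are \<open>undefined\<close> outside \<open>{..d}\<close>, whereas
  points of \<open>sphere_d\<close> vanish there. This is why \<open>restrict\<close> and congruence
  lemmas on coordinates up to d appear whenever integration meets the sphere.\<close>

definition leb :: "nat \<Rightarrow> (nat \<Rightarrow> real) measure" where
  "leb d = PiM {..d} (\<lambda>_. lborel)"

lemma enorm_L2: "enorm d x = L2_set x {..d}"
  by (simp add: enorm_def L2_set_def)

lemma enorm_nonneg [simp]: "0 \<le> enorm d x"
  by (simp add: enorm_L2)

lemma enorm_scale: "enorm d (\<lambda>i. c * x i) = \<bar>c\<bar> * enorm d x"
  by (simp add: enorm_def power_mult_distrib real_sqrt_mult flip: sum_distrib_left)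

lemma enorm_add_le: "enorm d (\<lambda>i. x i + y i) \<le> enorm d x + enorm d y"
  unfolding enorm_L2 by (rule L2_set_triangle_ineq)

lemma enorm_diff_le: "enorm d (\<lambda>i. x i - z i) \<le> enorm d (\<lambda>i. x i - y i) + enorm d (\<lambda>i. y i - z i)"
  using enorm_add_le[of d "\<lambda>i. x i - y i" "\<lambda>i. y i - z i"] by simp

lemma abs_coord_le_enorm: "i \<le> d \<Longrightarrow> \<bar>x i\<bar> \<le> enorm d x"
  unfolding enorm_def by (rule real_le_rsqrt) (auto intro!: member_le_sum[of i "{..d}" "\<lambda>i. (x i)\<^sup>2"])

lemma enorm_cong: "(\<And>i. i \<le> d \<Longrightarrow> x i = y i) \<Longrightarrow> enorm d x = enorm d y"
  by (simp add: enorm_def)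

lemma sets_leb [measurable_cong]: "sets (leb d) = sets (PiM {..d} (\<lambda>_. borel))"
  unfolding leb_def by (rule sets_PiM_cong) auto

lemma space_leb: "space (leb d) = PiE {..d} (\<lambda>_. UNIV)"
  by (simp add: leb_def space_PiM)

lemma measurable_coord: "i \<le> d \<Longrightarrow> (\<lambda>z. z i) \<in> borel_measurable (leb d)"
  unfolding leb_def using measurable_component_singleton[of i "{..d}" "\<lambda>_. lborel :: real measure"] by simp

lemma measurable_enorm [measurable]: "enorm d \<in> borel_measurable (leb d)"
  unfolding enorm_def[abs_def]
  by (intro measurable_compose[OF _ borel_measurable_sqrt] borel_measurable_sum borel_measurable_power measurable_coord) auto

interpretation lborel_prod: product_sigma_finite "\<lambda>_::nat. lborel :: real measure"
  by standard

lemma measurable_affine: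
  "(\<lambda>z. \<lambda>l\<in>{..d}. t l + c * z l) \<in> measurable (leb d) (leb d)"
  unfolding leb_def
  by (rule measurable_restrict) (use measurable_coord[of _ d] in \<open>simp add: leb_def\<close>)

text \<open>It suffices to compare both measures on boxes, where the one-dimensional change of
  variables contributes one factor c for each of the d + 1 coordinates.\<close>

lemma leb_affine:
  assumes "c > 0"
  shows "leb d = density (distr (leb d) (leb d) (\<lambda>z. \<lambda>l\<in>{..d}. t l + c * z l)) (\<lambda>_. ennreal (c ^ Suc d))"
  unfolding leb_def
proof (rule lborel_prod.PiM_eqI[symmetric])
  fix A :: "nat \<Rightarrow> real set" assume A: "\<And>i. i \<in> {..d} \<Longrightarrow> A i \<in> sets lborel"
  let ?T = "\<lambda>z. \<lambda>l\<in>{..d}. t l + c * z l"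
  let ?M = "PiM {..d} (\<lambda>_. lborel :: real measure)"
  have T: "?T \<in> measurable ?M ?M" using measurable_affine[of t c d] by (simp add: leb_def)
  have AE: "Pi\<^sub>E {..d} A \<in> sets ?M" using A by (intro sets_PiM_I_finite) auto
  have pre: "?T -` Pi\<^sub>E {..d} A \<inter> space ?M = Pi\<^sub>E {..d} (\<lambda>i. {y. t i + c * y \<in> A i})"
    by (auto simp: space_PiM PiE_iff extensional_def)
  have one: "emeasure lborel (A i) = ennreal c * emeasure lborel {y. t i + c * y \<in> A i}" if "i \<in> {..d}" for i
  proof -
    have m: "{y. t i + c * y \<in> A i} \<in> sets lborel"
      using A[OF that] by measurable
    have "emeasure lborel (A i) = (\<integral>\<^sup>+x. indicator (A i) x \<partial>lborel)" using A[OF that] by simp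
    also have "\<dots> = ennreal c * (\<integral>\<^sup>+x. indicator (A i) (t i + c * x) \<partial>lborel)"
      using assms A[OF that] by (subst nn_integral_real_affine[of _ c "t i"]) auto
    also have "(\<integral>\<^sup>+x. indicator (A i) (t i + c * x) \<partial>lborel) = (\<integral>\<^sup>+x. indicator {y. t i + c * y \<in> A i} x \<partial>lborel)"
      by (intro nn_integral_cong) (auto simp: indicator_def)
    finally show ?thesis using m by simp
  qed
  have m: "{y. t i + c * y \<in> A i} \<in> sets lborel" if "i \<in> {..d}" for i
    using A[OF that] by measurable
  have "emeasure (density (distr ?M ?M ?T) (\<lambda>_. ennreal (c ^ Suc d))) (Pi\<^sub>E {..d} A)
      = ennreal (c ^ Suc d) * emeasure ?M (?T -` Pi\<^sub>E {..d} A \<inter> space ?M)"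
    using AE T by (simp add: emeasure_density nn_integral_cmult_indicator emeasure_distr del: power_Suc)
  also have "\<dots> = ennreal (c ^ Suc d) * (\<Prod>i\<le>d. emeasure lborel {y. t i + c * y \<in> A i})"
    unfolding pre using m by (subst lborel_prod.emeasure_PiM) auto
  also have "\<dots> = (\<Prod>i\<le>d. ennreal c * emeasure lborel {y. t i + c * y \<in> A i})"
    using assms by (simp add: prod.distrib ennreal_power del: power_Suc)
  also have "\<dots> = (\<Prod>i\<le>d. emeasure lborel (A i))" using one by (intro prod.cong) auto
  finally show "emeasure (density (distr ?M ?M ?T) (\<lambda>_. ennreal (c ^ Suc d))) (Pi\<^sub>E {..d} A) = (\<Prod>i\<le>d. emeasure lborel (A i))" .
qed (auto simp del: power_Suc)

lemma integral_leb_affine: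
  fixes g :: "(nat \<Rightarrow> real) \<Rightarrow> real"
  assumes c: "c > 0" and g: "g \<in> borel_measurable (leb d)"
  shows "(\<integral>z. g z \<partial>leb d) = c ^ Suc d * (\<integral>z. g (\<lambda>l\<in>{..d}. t l + c * z l) \<partial>leb d)"
proof -
  have "(\<integral>z. g z \<partial>leb d) = (\<integral>z. g z \<partial>density (distr (leb d) (leb d) (\<lambda>z. \<lambda>l\<in>{..d}. t l + c * z l)) (\<lambda>_. ennreal (c ^ Suc d)))"
    using leb_affine[OF c, of d t] by simp
  also have "\<dots> = (\<integral>z. c ^ Suc d *\<^sub>R g z \<partial>distr (leb d) (leb d) (\<lambda>z. \<lambda>l\<in>{..d}. t l + c * z l))"
    using c g by (intro integral_density) (auto simp del: power_Suc)
  also have "\<dots> = (\<integral>z. c ^ Suc d *\<^sub>R g (\<lambda>l\<in>{..d}. t l + c * z l) \<partial>leb d)"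
    using g by (intro integral_distr measurable_affine) simp
  finally show ?thesis by simp
qed

section \<open>Volumes of balls and moments of a localized kernel\<close>

definition eball :: "nat \<Rightarrow> real \<Rightarrow> (nat \<Rightarrow> real) set" where
  "eball d \<rho> = {z \<in> space (leb d). enorm d z \<le> \<rho>}"

lemma sets_eball [measurable]: "eball d \<rho> \<in> sets (leb d)"
  unfolding eball_def by measurable

lemma emeasure_eball_finite: "emeasure (leb d) (eball d \<rho>) < \<infinity>"
proof -
  have "emeasure (leb d) (eball d \<rho>) \<le> emeasure (leb d) (PiE {..d} (\<lambda>_. {-\<rho>..\<rho>}))"
  proof (rule emeasure_mono)
    show "eball d \<rho> \<subseteq> PiE {..d} (\<lambda>_. {-\<rho>..\<rho>})"
    proof
      fix z assume z: "z \<in> eball d \<rho>"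
      then have "\<bar>z i\<bar> \<le> \<rho>" if "i \<le> d" for i
        using abs_coord_le_enorm[OF that, of z] by (simp add: eball_def)
      then show "z \<in> PiE {..d} (\<lambda>_. {-\<rho>..\<rho>})"
        using z unfolding eball_def space_leb PiE_iff abs_le_iff by (simp add: minus_le_iff)
    qed
  qed (auto simp: leb_def intro!: sets_PiM_I_finite)
  also have "\<dots> = (\<Prod>i\<le>d. emeasure lborel {-\<rho>..\<rho>})"
    unfolding leb_def by (subst lborel_prod.emeasure_PiM) auto
  also have "\<dots> < \<infinity>" using ennreal_prod_eq_top[of "\<lambda>_. emeasure lborel {-\<rho>..\<rho>}" "{..d}"] emeasure_lborel_Icc_eq[of "-\<rho>" \<rho>]
    by (simp add: less_top del: prod_constant split: if_splits)
  finally show ?thesis .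
qed

lemma emeasure_eball_1_pos: "emeasure (leb d) (eball d 1) > 0"
proof -
  \<comment> \<open>With this half-side the sum of the absolute values of the coordinates, hence the
    norm, is at most 1. A crude cube is enough: only positivity matters, because the volume of the
    unit ball cancels in \<open>kernel_moment\<close>.\<close>
  define a where "a = 1 / real (Suc d)"
  have a: "a > 0" by (simp add: a_def)
  have "0 < (\<Prod>i\<le>d. emeasure lborel {-a..a})"
    using a by (simp add: zero_less_iff_neq_zero del: prod_constant)
  also have "\<dots> = emeasure (leb d) (PiE {..d} (\<lambda>_. {-a..a}))"
    unfolding leb_def by (subst lborel_prod.emeasure_PiM) auto
  also have "\<dots> \<le> emeasure (leb d) (eball d 1)"
  proof (rule emeasure_mono)
    show "PiE {..d} (\<lambda>_. {-a..a}) \<subseteq> eball d 1"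
    proof
      fix z assume z: "z \<in> PiE {..d} (\<lambda>_. {-a..a})"
      have "enorm d z \<le> (\<Sum>i\<le>d. \<bar>z i\<bar>)" unfolding enorm_L2 by (rule L2_set_le_sum_abs)
      also have "\<dots> \<le> (\<Sum>i\<le>d. a)" using z by (intro sum_mono) (force simp: PiE_iff abs_le_iff minus_le_iff)
      also have "\<dots> = 1" by (simp add: a_def)
      finally show "z \<in> eball d 1" using z by (auto simp: eball_def space_leb)
    qed
  qed simp
  finally show ?thesis .
qed

lemma integrable_leb_bounded:
  fixes f :: "(nat \<Rightarrow> real) \<Rightarrow> real"
  assumes "f \<in> borel_measurable (leb d)"
    and "\<And>z. enorm d z \<le> R \<Longrightarrow> \<bar>f z\<bar> \<le> B" and "\<And>z. R < enorm d z \<Longrightarrow> f z = 0"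
  shows "integrable (leb d) f"
  by (rule integrableI_bounded_set[of "eball d R" _ _ B])
     (use assms emeasure_eball_finite[of d R] in \<open>auto simp: eball_def not_le\<close>)

lemma measure_eball_scale:
  assumes "\<rho> > 0"
  shows "measure (leb d) (eball d \<rho>) = \<rho> ^ Suc d * measure (leb d) (eball d 1)"
proof -
  have "measure (leb d) (eball d \<rho>) = (\<integral>z. indicator (eball d \<rho>) z \<partial>leb d)" by simp
  also have "\<dots> = \<rho> ^ Suc d * (\<integral>z. indicator (eball d \<rho>) (\<lambda>l\<in>{..d}. 0 + \<rho> * z l) \<partial>leb d)"
    by (rule integral_leb_affine[OF assms]) simp
  also have "(\<integral>z. indicator (eball d \<rho>) (\<lambda>l\<in>{..d}. 0 + \<rho> * z l) \<partial>leb d) = (\<integral>z. indicator (eball d 1) z \<partial>leb d :: real)"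
  proof (rule Bochner_Integration.integral_cong[OF refl])
    fix z assume z: "z \<in> space (leb d)"
    have "enorm d (\<lambda>l\<in>{..d}. 0 + \<rho> * z l) = enorm d (\<lambda>l. \<rho> * z l)" by (rule enorm_cong) simp
    then have "enorm d (\<lambda>l\<in>{..d}. 0 + \<rho> * z l) = \<rho> * enorm d z" using assms by (simp add: enorm_scale)
    moreover have "(\<lambda>l\<in>{..d}. 0 + \<rho> * z l) \<in> space (leb d)" by (simp add: space_leb)
    ultimately show "indicator (eball d \<rho>) (\<lambda>l\<in>{..d}. 0 + \<rho> * z l) = (indicator (eball d 1) z :: real)"
      using z assms by (auto simp: indicator_def eball_def)
  qed
  finally show ?thesis by simp
qed

lemma measure_eball_1_pos: "measure (leb d) (eball d 1) > 0"
  using emeasure_eball_1_pos[of d] emeasure_eball_finite[of d 1]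
  by (simp add: measure_def enn2real_positive_iff)

text \<open>The moment is cut into the ball of radius 16 h and dyadic shells beyond it. Decay of
  order \<open>2 * e\<close> with \<open>e = Suc d + s\<close> pays for the volume of a shell and
  for the weight \<open>enorm d z ^ s\<close>, and a power \<open>e\<close> of
  \<open>h / \<rho>\<close> is left over. Compared with the lower bound of the mass over the ball of
  radius h / 2, the volume and all powers growing with d cancel.\<close>

lemma kernel_moment:
  fixes \<phi> :: "(nat \<Rightarrow> real) \<Rightarrow> real" and d :: nat
  defines "I \<equiv> (\<integral>z. \<phi> z \<partial>leb d)"
  assumes meas [measurable]: "\<phi> \<in> borel_measurable (leb d)"
    and nonneg: "\<And>z. 0 \<le> \<phi> z" and bdd: "\<And>z. \<phi> z \<le> B"
    and supp: "\<And>z. R < enorm d z \<Longrightarrow> \<phi> z = 0"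
    and h: "h > 0" and e: "e = Suc d + s"
    and low: "\<And>z. enorm d z \<le> h / 2 \<Longrightarrow> (1/4) ^ e \<le> \<phi> z"
    and up: "\<And>z. \<phi> z * enorm d z ^ (2 * e) \<le> h ^ (2 * e)"
  shows "I > 0" and "(\<integral>z. \<phi> z * enorm d z ^ s \<partial>leb d) \<le> (16 ^ s + 2) * h ^ s * I"
proof -
  define V where "V = measure (leb d) (eball d 1)"
  have V: "V > 0" unfolding V_def by (rule measure_eball_1_pos)
  have B: "B \<ge> 0" using nonneg[of undefined] bdd[of undefined] by linarith
  have int: "integrable (leb d) \<phi>"
    using nonneg bdd supp by (intro integrable_leb_bounded[where R = R and B = B]) auto
  have intb: "integrable (leb d) (indicator (eball d \<rho>) :: _ \<Rightarrow> real)" for \<rho>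
    using emeasure_eball_finite[of d \<rho>] by (intro integrable_real_indicator) auto
  have I_low: "(1/4) ^ e * (h / 2) ^ Suc d * V \<le> I"
  proof -
    have "(1/4) ^ e * (h / 2) ^ Suc d * V = (\<integral>z. (1/4) ^ e * indicator (eball d (h / 2)) z \<partial>leb d)"
      using measure_eball_scale[of "h / 2" d] h by (simp add: V_def)
    also have "\<dots> \<le> I" unfolding I_def
    proof (rule integral_mono[OF _ int])
      show "integrable (leb d) (\<lambda>z. (1/4) ^ e * indicator (eball d (h / 2)) z :: real)"
        using intb by (intro integrable_mult_right) auto
      show "(1/4) ^ e * indicator (eball d (h / 2)) z \<le> \<phi> z" for z
        using low[of z] nonneg[of z] by (auto simp: indicator_def eball_def)
    qed
    finally show ?thesis .
  qed
  have "0 < (1/4) ^ e * (h / 2) ^ Suc d * V" using V h by simp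
  with I_low show Ipos: "I > 0" by linarith
  define J where "J \<rho> = (\<integral>z. indicator (eball d \<rho>) z * (\<phi> z * enorm d z ^ s) \<partial>leb d)" for \<rho>
  have intJ: "integrable (leb d) (\<lambda>z. indicator (eball d \<rho>) z * (\<phi> z * enorm d z ^ s))" for \<rho>
  proof (rule integrable_leb_bounded[where R = R and B = "B * \<bar>R\<bar> ^ s"])
    fix z assume "enorm d z \<le> R"
    then have "\<phi> z * enorm d z ^ s \<le> B * \<bar>R\<bar> ^ s"
      using bdd[of z] nonneg[of z] B by (intro mult_mono power_mono) auto
    then show "\<bar>indicator (eball d \<rho>) z * (\<phi> z * enorm d z ^ s)\<bar> \<le> B * \<bar>R\<bar> ^ s"
      using nonneg[of z] B by (auto simp: indicator_def)
  qed (use supp in auto)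
  have J0: "J (16 * h) \<le> 16 ^ s * h ^ s * I"
  proof -
    have "J (16 * h) \<le> (\<integral>z. (16 * h) ^ s * \<phi> z \<partial>leb d)"
      unfolding J_def
    proof (rule integral_mono[OF intJ])
      fix z assume "z \<in> space (leb d)"
      have "\<phi> z * enorm d z ^ s \<le> (16 * h) ^ s * \<phi> z" if "enorm d z \<le> 16 * h"
        using power_mono[OF that, of s] nonneg[of z] by (subst mult.commute) (intro mult_right_mono, auto)
      then show "indicator (eball d (16 * h)) z * (\<phi> z * enorm d z ^ s) \<le> (16 * h) ^ s * \<phi> z"
        using nonneg[of z] h by (auto simp: indicator_def eball_def)
    qed (use int in auto)
    then show ?thesis by (simp add: I_def power_mult_distrib)
  qed
  have step: "J (2 * \<rho>) \<le> J \<rho> + (h / \<rho>) ^ (2 * e) * (2 * \<rho>) ^ s * (2 * \<rho>) ^ Suc d * V" if \<rho>: "\<rho> > 0" for \<rho>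
  proof -
    have "J (2 * \<rho>) \<le> (\<integral>z. indicator (eball d \<rho>) z * (\<phi> z * enorm d z ^ s) + (h / \<rho>) ^ (2 * e) * (2 * \<rho>) ^ s * indicator (eball d (2 * \<rho>)) z \<partial>leb d)"
      unfolding J_def
    proof (rule integral_mono[OF intJ])
      show "integrable (leb d) (\<lambda>z. indicator (eball d \<rho>) z * (\<phi> z * enorm d z ^ s) + (h / \<rho>) ^ (2 * e) * (2 * \<rho>) ^ s * indicator (eball d (2 * \<rho>)) z)"
        using intJ intb by (intro Bochner_Integration.integrable_add integrable_mult_right) auto
      fix z assume z: "z \<in> space (leb d)"
      consider "enorm d z \<le> \<rho>" | "\<rho> < enorm d z" "enorm d z \<le> 2 * \<rho>" | "enorm d z > 2 * \<rho>" by linarith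
      then show "indicator (eball d (2 * \<rho>)) z * (\<phi> z * enorm d z ^ s) \<le> indicator (eball d \<rho>) z * (\<phi> z * enorm d z ^ s) + (h / \<rho>) ^ (2 * e) * (2 * \<rho>) ^ s * indicator (eball d (2 * \<rho>)) z"
      proof cases
        case 2
        have "\<phi> z * \<rho> ^ (2 * e) \<le> \<phi> z * enorm d z ^ (2 * e)"
          using 2 \<rho> nonneg[of z] by (intro mult_left_mono power_mono) auto
        with up[of z] have "\<phi> z \<le> (h / \<rho>) ^ (2 * e)" using \<rho> by (simp add: power_divide field_simps)
        then have "\<phi> z * enorm d z ^ s \<le> (h / \<rho>) ^ (2 * e) * (2 * \<rho>) ^ s"
          using 2 nonneg[of z] h \<rho> by (intro mult_mono power_mono) auto
        then show ?thesis using 2 z by (simp add: indicator_def eball_def)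
      qed (use z \<rho> h nonneg[of z] in \<open>auto simp: indicator_def eball_def\<close>)
    qed
    also have "\<dots> = J \<rho> + (h / \<rho>) ^ (2 * e) * (2 * \<rho>) ^ s * measure (leb d) (eball d (2 * \<rho>))"
      unfolding J_def using intJ intb
      by (subst Bochner_Integration.integral_add) (auto intro: integrable_mult_right)
    finally show ?thesis using measure_eball_scale[of "2 * \<rho>" d] \<rho> by (simp add: V_def)
  qed
  \<comment> \<open>Passing from level l to l + 1 adds at most \<open>h ^ s * I / 2 ^ l\<close>; the
    term \<open>2 - 2 / 2 ^ l\<close> is the partial sum of this geometric series.\<close>
  have ind: "J (16 * h * 2 ^ l) \<le> (16 ^ s + 2 - 2 / 2 ^ l) * h ^ s * I" for l
  proof (induction l)
    case 0
    then show ?case using J0 by simp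
  next
    case (Suc l)
    define \<rho> where "\<rho> = 16 * h * 2 ^ l"
    have \<rho>: "\<rho> > 0" using h by (simp add: \<rho>_def)
    have "(h / \<rho>) ^ (2 * e) = (h / \<rho>) ^ e * (h / \<rho>) ^ e" by (simp only: mult_2 power_add)
    moreover have "(2 * \<rho>) ^ s * (2 * \<rho>) ^ Suc d = (2 * \<rho>) ^ e"
      unfolding e by (simp only: power_add mult.commute)
    ultimately have "(h / \<rho>) ^ (2 * e) * (2 * \<rho>) ^ s * (2 * \<rho>) ^ Suc d = (h / \<rho>) ^ e * (h / \<rho>) ^ e * (2 * \<rho>) ^ e"
      by (simp only: mult.assoc)
    also have "\<dots> = (2 * h * (h / \<rho>)) ^ e"
      unfolding power_mult_distrib[symmetric] using \<rho> by (intro arg_cong[of _ _ "\<lambda>x. x ^ e"]) (simp add: field_simps)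
    \<comment> \<open>The initial radius 16 h is chosen for this identity: the factor
      \<open>(1/4) * (h / 2)\<close> reproduces, after raising to the power \<open>e\<close>, the
      lower bound \<open>I_low\<close>, up to \<open>(h / 2) ^ s\<close>.\<close>
    also have "2 * h * (h / \<rho>) = (1/4) * (h / 2) * (1 / 2 ^ l)" using h by (simp add: \<rho>_def field_simps)
    also have "((1/4) * (h / 2) * (1 / 2 ^ l)) ^ e = (1/4) ^ e * (h / 2) ^ Suc d * (h / 2) ^ s * (1 / 2 ^ l) ^ e"
      unfolding power_mult_distrib by (simp only: e power_add mult_ac)
    finally have "(h / \<rho>) ^ (2 * e) * (2 * \<rho>) ^ s * (2 * \<rho>) ^ Suc d * V
        = ((1/4) ^ e * (h / 2) ^ Suc d * V) * (h / 2) ^ s * (1 / 2 ^ l) ^ e" by (simp add: mult_ac)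
    also have "\<dots> \<le> I * h ^ s * (1 / 2 ^ l)"
    proof (intro mult_mono I_low)
      show "(h / 2) ^ s \<le> h ^ s" using h by (intro power_mono) auto
      have "((1::real) / 2 ^ l) ^ e \<le> (1 / 2 ^ l) ^ 1" by (intro power_decreasing) (auto simp: e)
      then show "((1::real) / 2 ^ l) ^ e \<le> 1 / 2 ^ l" by simp
    qed (use Ipos h in simp_all)
    finally have "J (2 * \<rho>) \<le> J \<rho> + I * h ^ s * (1 / 2 ^ l)" using step[OF \<rho>] by linarith
    also have "\<dots> \<le> (16 ^ s + 2 - 2 / 2 ^ l) * h ^ s * I + I * h ^ s * (1 / 2 ^ l)"
      using Suc by (simp add: \<rho>_def)
    also have "\<dots> = (16 ^ s + 2 - 2 / 2 ^ Suc l) * h ^ s * I" by (simp add: field_simps)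
    finally show ?case by (simp add: \<rho>_def mult_ac)
  qed
  obtain l where l: "R / (16 * h) < 2 ^ l" using real_arch_pow[of 2 "R / (16 * h)"] by auto
  then have l': "R \<le> 16 * h * 2 ^ l" using h by (simp add: field_simps)
  have "(\<integral>z. \<phi> z * enorm d z ^ s \<partial>leb d) = J (16 * h * 2 ^ l)"
    unfolding J_def
  proof (rule Bochner_Integration.integral_cong[OF refl])
    fix z assume "z \<in> space (leb d)"
    then show "\<phi> z * enorm d z ^ s = indicator (eball d (16 * h * 2 ^ l)) z * (\<phi> z * enorm d z ^ s)"
      using supp[of z] l' by (auto simp: indicator_def eball_def)
  qed
  also have "\<dots> \<le> (16 ^ s + 2 - 2 / 2 ^ l) * h ^ s * I" by (rule ind)
  also have "\<dots> \<le> (16 ^ s + 2) * h ^ s * I" using h Ipos by (intro mult_right_mono) auto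
  finally show "(\<integral>z. \<phi> z * enorm d z ^ s \<partial>leb d) \<le> (16 ^ s + 2) * h ^ s * I" .
qed

section \<open>Polynomials in several variables\<close>

definition mono_fun :: "nat \<Rightarrow> (nat \<Rightarrow> nat) \<Rightarrow> (nat \<Rightarrow> real) \<Rightarrow> real" where
  "mono_fun d \<alpha> x = (\<Prod>i\<le>d. x i ^ \<alpha> i)"

lemma polysI:
  assumes "finite A" "\<And>\<alpha>. \<alpha> \<in> A \<Longrightarrow> (\<forall>i>d. \<alpha> i = 0) \<and> real (\<Sum>i\<le>d. \<alpha> i) < m"
    and "\<And>x. P x = (\<Sum>\<alpha>\<in>A. c \<alpha> * mono_fun d \<alpha> x)"
  shows "P \<in> polys d m"
  using assms unfolding polys_def mono_fun_def by blast

lemma polysE: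
  assumes "P \<in> polys d m"
  obtains A c where "finite A" "\<And>\<alpha>. \<alpha> \<in> A \<Longrightarrow> (\<forall>i>d. \<alpha> i = 0) \<and> real (\<Sum>i\<le>d. \<alpha> i) < m"
    "\<And>x. P x = (\<Sum>\<alpha>\<in>A. c \<alpha> * mono_fun d \<alpha> x)"
  using assms unfolding polys_def mono_fun_def by blast

lemma polys_mono: "P \<in> polys d m \<Longrightarrow> m \<le> m' \<Longrightarrow> P \<in> polys d m'"
  by (elim polysE, rule polysI) force+

lemma polys_const: "m > 0 \<Longrightarrow> (\<lambda>x. c) \<in> polys d m"
  by (rule polysI[of "{\<lambda>_. 0}" _ _ _ "\<lambda>_. c"]) (auto simp: mono_fun_def)

lemma polys_zero: "(\<lambda>x. 0) \<in> polys d m"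
  by (rule polysI[of "{}"]) auto

lemma polys_add:
  assumes "P \<in> polys d m" "Q \<in> polys d m"
  shows "(\<lambda>x. P x + Q x) \<in> polys d m"
proof -
  obtain A a where A: "finite A" "\<And>\<alpha>. \<alpha> \<in> A \<Longrightarrow> (\<forall>i>d. \<alpha> i = 0) \<and> real (\<Sum>i\<le>d. \<alpha> i) < m"
    "\<And>x. P x = (\<Sum>\<alpha>\<in>A. a \<alpha> * mono_fun d \<alpha> x)" by (rule polysE[OF assms(1)]) blast
  obtain B b where B: "finite B" "\<And>\<alpha>. \<alpha> \<in> B \<Longrightarrow> (\<forall>i>d. \<alpha> i = 0) \<and> real (\<Sum>i\<le>d. \<alpha> i) < m"
    "\<And>x. Q x = (\<Sum>\<alpha>\<in>B. b \<alpha> * mono_fun d \<alpha> x)" by (rule polysE[OF assms(2)]) blast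
  show ?thesis
  proof (rule polysI[of "A \<union> B" _ _ _ "\<lambda>\<alpha>. (if \<alpha> \<in> A then a \<alpha> else 0) + (if \<alpha> \<in> B then b \<alpha> else 0)"])
    fix x
    have "P x = (\<Sum>\<alpha>\<in>A \<union> B. (if \<alpha> \<in> A then a \<alpha> else 0) * mono_fun d \<alpha> x)"
      unfolding A(3) using A(1) B(1) by (intro sum.mono_neutral_cong_left) auto
    moreover have "Q x = (\<Sum>\<alpha>\<in>A \<union> B. (if \<alpha> \<in> B then b \<alpha> else 0) * mono_fun d \<alpha> x)"
      unfolding B(3) using A(1) B(1) by (intro sum.mono_neutral_cong_left) auto
    ultimately show "P x + Q x = (\<Sum>\<alpha>\<in>A \<union> B. ((if \<alpha> \<in> A then a \<alpha> else 0) + (if \<alpha> \<in> B then b \<alpha> else 0)) * mono_fun d \<alpha> x)"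
      by (simp only: distrib_right sum.distrib)
  qed (use A B in auto)
qed

lemma polys_scale:
  assumes "P \<in> polys d m" shows "(\<lambda>x. c * P x) \<in> polys d m"
  using assms
proof (elim polysE)
  fix A a assume "finite A" "\<And>\<alpha>. \<alpha> \<in> A \<Longrightarrow> (\<forall>i>d. \<alpha> i = 0) \<and> real (\<Sum>i\<le>d. \<alpha> i) < m"
    "\<And>x. P x = (\<Sum>\<alpha>\<in>A. a \<alpha> * mono_fun d \<alpha> x)"
  then show ?thesis
    by (intro polysI[of A _ _ _ "\<lambda>\<alpha>. c * a \<alpha>"]) (auto simp: sum_distrib_left mult.assoc)
qed

lemma polys_sum:
  "(\<And>j. j \<in> J \<Longrightarrow> P j \<in> polys d m) \<Longrightarrow> (\<lambda>x. \<Sum>j\<in>J. P j x) \<in> polys d m"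
  by (induction J rule: infinite_finite_induct) (auto simp: polys_zero polys_add)

lemma mono_fun_upd:
  assumes "i \<le> d" shows "mono_fun d (\<alpha>(i := \<alpha> i + k)) x = x i ^ k * mono_fun d \<alpha> x"
proof -
  have "(\<Prod>l\<in>{..d} - {i}. x l ^ (\<alpha>(i := \<alpha> i + k)) l) = (\<Prod>l\<in>{..d} - {i}. x l ^ \<alpha> l)"
    by (intro prod.cong) auto
  then show ?thesis using assms unfolding mono_fun_def
    by (subst (1 2) prod.remove[of "{..d}" i]) (auto simp: power_add)
qed

lemma sum_upd_add:
  fixes \<alpha> :: "nat \<Rightarrow> nat"
  assumes "i \<le> d" shows "(\<Sum>l\<le>d. (\<alpha>(i := \<alpha> i + k)) l) = (\<Sum>l\<le>d. \<alpha> l) + (k::nat)"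
proof -
  have "(\<Sum>l\<in>{..d} - {i}. (\<alpha>(i := \<alpha> i + k)) l) = (\<Sum>l\<in>{..d} - {i}. \<alpha> l)"
    by (intro sum.cong) auto
  then show ?thesis
    using assms sum.remove[of "{..d}" i \<alpha>, OF finite_atMost]
      sum.remove[of "{..d}" i "\<alpha>(i := \<alpha> i + k)", OF finite_atMost] by simp
qed

lemma polys_mult_coord:
  assumes "P \<in> polys d m" "i \<le> d" shows "(\<lambda>x. x i * P x) \<in> polys d (m + 1)"
  using assms(1)
proof (elim polysE)
  fix A a assume A: "finite A" "\<And>\<alpha>. \<alpha> \<in> A \<Longrightarrow> (\<forall>i>d. \<alpha> i = 0) \<and> real (\<Sum>i\<le>d. \<alpha> i) < m"
    "\<And>x. P x = (\<Sum>\<alpha>\<in>A. a \<alpha> * mono_fun d \<alpha> x)"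
  define up where "up \<alpha> = (\<alpha>(i := \<alpha> i + 1))" for \<alpha> :: "nat \<Rightarrow> nat"
  define dn where "dn \<alpha> = (\<alpha>(i := \<alpha> i - 1))" for \<alpha> :: "nat \<Rightarrow> nat"
  have du: "dn (up \<alpha>) = \<alpha>" for \<alpha> by (simp add: up_def dn_def)
  then have inj: "inj_on up A" by (metis inj_onI)
  show ?thesis
  proof (rule polysI[of "up ` A" _ _ _ "\<lambda>\<alpha>. a (dn \<alpha>)"])
    show "finite (up ` A)" using A by simp
    fix \<alpha> assume "\<alpha> \<in> up ` A"
    then obtain \<beta> where b: "\<beta> \<in> A" "\<alpha> = up \<beta>" by auto
    have "(\<Sum>l\<le>d. \<alpha> l) = (\<Sum>l\<le>d. \<beta> l) + 1" unfolding b(2) up_def by (rule sum_upd_add[OF assms(2)])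
    then show "(\<forall>i>d. \<alpha> i = 0) \<and> real (\<Sum>i\<le>d. \<alpha> i) < m + 1"
      using A(2)[OF b(1)] b(2) assms(2) by (auto simp: up_def)
  next
    fix x show "x i * P x = (\<Sum>\<alpha>\<in>up ` A. a (dn \<alpha>) * mono_fun d \<alpha> x)"
      unfolding A(3) sum.reindex[OF inj] sum_distrib_left
    proof (intro sum.cong refl)
      fix \<alpha>
      show "x i * (a \<alpha> * mono_fun d \<alpha> x) = ((\<lambda>\<alpha>. a (dn \<alpha>) * mono_fun d \<alpha> x) \<circ> up) \<alpha>"
        using mono_fun_upd[OF assms(2), of \<alpha> 1 x] du[of \<alpha>] by (simp add: up_def del: fun_upd_apply)
    qed
  qed
qed

text \<open>Bounded measurable functions supported in a ball are integrable and stay in the class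
  when multiplied by polynomials. Hence factors depending on y alone can be absorbed into
  \<open>G\<close> in the induction of \<open>integral_power_polys\<close>.\<close>

definition cutoff :: "nat \<Rightarrow> real \<Rightarrow> ((nat \<Rightarrow> real) \<Rightarrow> real) \<Rightarrow> bool" where
  "cutoff d \<rho> G \<longleftrightarrow> G \<in> borel_measurable (leb d) \<and> (\<exists>B. \<forall>z. enorm d z \<le> \<rho> \<longrightarrow> \<bar>G z\<bar> \<le> B) \<and>
     (\<forall>z. \<rho> < enorm d z \<longrightarrow> G z = 0)"

lemma cutoff_integrable: "cutoff d \<rho> G \<Longrightarrow> integrable (leb d) G"
  unfolding cutoff_def by (auto intro: integrable_leb_bounded)

lemma cutoff_mult:
  assumes "cutoff d \<rho> G" "H \<in> borel_measurable (leb d)" "\<And>z. enorm d z \<le> \<rho> \<Longrightarrow> \<bar>H z\<bar> \<le> B"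
  shows "cutoff d \<rho> (\<lambda>z. H z * G z)"
proof -
  obtain C where C: "\<And>z. enorm d z \<le> \<rho> \<Longrightarrow> \<bar>G z\<bar> \<le> C" using assms(1) unfolding cutoff_def by blast
  have "\<bar>H z * G z\<bar> \<le> \<bar>B\<bar> * \<bar>C\<bar>" if "enorm d z \<le> \<rho>" for z
    using C[OF that] assms(3)[OF that] unfolding abs_mult by (intro mult_mono) auto
  then show ?thesis using assms unfolding cutoff_def by auto
qed

lemma cutoff_power:
  assumes "cutoff d \<rho> H"
  shows "cutoff d \<rho> (\<lambda>y. (1 + (enorm d y)\<^sup>2 - 2 * (\<Sum>i\<le>d. x i * y i)) ^ l * H y)"
proof -
  define w where "w y = 1 + (enorm d y)\<^sup>2 - 2 * (\<Sum>i\<le>d. x i * y i)" for y :: "nat \<Rightarrow> real"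
  have wmeas: "w \<in> borel_measurable (leb d)"
    unfolding w_def[abs_def]
    by (intro borel_measurable_diff borel_measurable_add borel_measurable_times borel_measurable_sum
        borel_measurable_power borel_measurable_const measurable_coord measurable_enorm) auto
  have wbd: "\<bar>w y\<bar> \<le> 1 + \<rho>\<^sup>2 + 2 * (\<Sum>i\<le>d. \<bar>x i\<bar> * \<rho>)" if "enorm d y \<le> \<rho>" for y
  proof -
    have "(enorm d y)\<^sup>2 \<le> \<rho>\<^sup>2" using that by (intro power_mono) auto
    moreover have "\<bar>\<Sum>i\<le>d. x i * y i\<bar> \<le> (\<Sum>i\<le>d. \<bar>x i\<bar> * \<rho>)"
      using order_trans[OF abs_coord_le_enorm that]
      by (intro order_trans[OF sum_abs] sum_mono) (auto simp: abs_mult intro!: mult_left_mono)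
    ultimately show ?thesis unfolding w_def by (smt (verit) zero_le_power2)
  qed
  show ?thesis
    unfolding w_def[symmetric] using assms
  proof (rule cutoff_mult)
    show "(\<lambda>y. w y ^ l) \<in> borel_measurable (leb d)" using wmeas by (intro borel_measurable_power)
    show "\<bar>w y ^ l\<bar> \<le> (1 + \<rho>\<^sup>2 + 2 * (\<Sum>i\<le>d. \<bar>x i\<bar> * \<rho>)) ^ l" if "enorm d y \<le> \<rho>" for y
      unfolding power_abs by (intro power_mono wbd that) auto
  qed
qed

text \<open>Each factor of the power is affine in x. Splitting off one of them moves
  \<open>1 + |y|^2\<close> or \<open>y i\<close> into \<open>G\<close>, for which the induction
  hypothesis is general, and costs at most one multiplication by a coordinate of x. The bound
  \<open>real l + 1\<close> reflects the strict inequality for degrees in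
  \<open>polys\<close>.\<close>

lemma integral_power_polys:
  assumes "cutoff d \<rho> G"
  shows "(\<lambda>x. \<integral>y. (1 + (enorm d y)\<^sup>2 - 2 * (\<Sum>i\<le>d. x i * y i)) ^ l * G y \<partial>leb d) \<in> polys d (real l + 1)"
  using assms
proof (induction l arbitrary: G)
  case 0
  then show ?case by (simp add: polys_const)
next
  case (Suc l)
  define w where "w x y = 1 + (enorm d y)\<^sup>2 - 2 * (\<Sum>i\<le>d. x i * y i)" for x y :: "nat \<Rightarrow> real"
  have pw: "cutoff d \<rho> (\<lambda>y. w x y ^ l * H y)" if "cutoff d \<rho> H" for x H
    unfolding w_def using that by (rule cutoff_power)
  have c1: "cutoff d \<rho> (\<lambda>y. (1 + (enorm d y)\<^sup>2) * G y)"
  proof (rule cutoff_mult[OF Suc.prems])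
    show "\<bar>1 + (enorm d y)\<^sup>2\<bar> \<le> 1 + \<rho>\<^sup>2" if "enorm d y \<le> \<rho>" for y
      using that by (auto intro!: power_mono)
  qed measurable
  have c2: "cutoff d \<rho> (\<lambda>y. y i * G y)" if "i \<le> d" for i
    using order_trans[OF abs_coord_le_enorm[OF that]]
    by (intro cutoff_mult[OF Suc.prems measurable_coord[OF that]]) auto
  have eq: "(\<integral>y. w x y ^ Suc l * G y \<partial>leb d) =
      (\<integral>y. w x y ^ l * ((1 + (enorm d y)\<^sup>2) * G y) \<partial>leb d) + (\<Sum>i\<le>d. -2 * (x i * (\<integral>y. w x y ^ l * (y i * G y) \<partial>leb d)))" for x
  proof -
    have "w x y ^ Suc l * G y = w x y ^ l * ((1 + (enorm d y)\<^sup>2) * G y) + (\<Sum>i\<le>d. -2 * (x i * (w x y ^ l * (y i * G y))))" for y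
    proof -
      have "w x y ^ Suc l * G y = w x y * (w x y ^ l * G y)" by simp
      also have "\<dots> = (1 + (enorm d y)\<^sup>2) * (w x y ^ l * G y) - 2 * ((\<Sum>i\<le>d. x i * y i) * (w x y ^ l * G y))"
        by (subst (1) w_def) (simp add: algebra_simps)
      also have "2 * ((\<Sum>i\<le>d. x i * y i) * (w x y ^ l * G y)) = - (\<Sum>i\<le>d. -2 * (x i * (w x y ^ l * (y i * G y))))"
        by (simp add: sum_distrib_left sum_distrib_right sum_negf mult.assoc mult.left_commute)
      finally show ?thesis by (simp add: mult.left_commute)
    qed
    then have "(\<integral>y. w x y ^ Suc l * G y \<partial>leb d) =
      (\<integral>y. w x y ^ l * ((1 + (enorm d y)\<^sup>2) * G y) + (\<Sum>i\<le>d. -2 * (x i * (w x y ^ l * (y i * G y)))) \<partial>leb d)"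
      by simp
    also have "\<dots> = (\<integral>y. w x y ^ l * ((1 + (enorm d y)\<^sup>2) * G y) \<partial>leb d) + (\<integral>y. (\<Sum>i\<le>d. -2 * (x i * (w x y ^ l * (y i * G y)))) \<partial>leb d)"
      using cutoff_integrable[OF pw[OF c1]] cutoff_integrable[OF pw[OF c2]]
      by (intro Bochner_Integration.integral_add Bochner_Integration.integrable_sum integrable_mult_right) auto
    also have "(\<integral>y. (\<Sum>i\<le>d. -2 * (x i * (w x y ^ l * (y i * G y)))) \<partial>leb d) = (\<Sum>i\<le>d. -2 * (x i * (\<integral>y. w x y ^ l * (y i * G y) \<partial>leb d)))"
      using cutoff_integrable[OF pw[OF c2]]
      by (subst Bochner_Integration.integral_sum) (auto intro!: integrable_mult_right)
    finally show ?thesis .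
  qed
  have "(\<lambda>x. (\<integral>y. w x y ^ l * ((1 + (enorm d y)\<^sup>2) * G y) \<partial>leb d) + (\<Sum>i\<le>d. -2 * (x i * (\<integral>y. w x y ^ l * (y i * G y) \<partial>leb d)))) \<in> polys d (real l + 1 + 1)"
    using Suc.IH[OF c1] Suc.IH[OF c2] unfolding w_def[symmetric]
    by (intro polys_add polys_sum polys_scale polys_mult_coord) (auto intro: polys_mono)
  then show ?case unfolding w_def[symmetric] eq by (simp add: add_ac)
qed

lemma integral_poly_polys:
  fixes q :: "real poly"
  assumes "cutoff d \<rho> G"
  shows "(\<lambda>x. \<integral>y. poly q (a * (1 + (enorm d y)\<^sup>2 - 2 * (\<Sum>i\<le>d. x i * y i))) * G y \<partial>leb d) \<in> polys d (real (degree q) + 1)"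
proof -
  define w where "w x y = 1 + (enorm d y)\<^sup>2 - 2 * (\<Sum>i\<le>d. x i * y i)" for x y :: "nat \<Rightarrow> real"
  have int: "integrable (leb d) (\<lambda>y. w x y ^ k * G y)" for x k
    unfolding w_def by (rule cutoff_integrable[OF cutoff_power[OF assms]])
  have "(\<integral>y. poly q (a * w x y) * G y \<partial>leb d) = (\<Sum>k\<le>degree q. coeff q k * a ^ k * (\<integral>y. w x y ^ k * G y \<partial>leb d))" for x
  proof -
    have "(\<integral>y. poly q (a * w x y) * G y \<partial>leb d) = (\<integral>y. (\<Sum>k\<le>degree q. coeff q k * a ^ k * (w x y ^ k * G y)) \<partial>leb d)"
      by (simp add: poly_altdef sum_distrib_right power_mult_distrib mult.assoc)
    also have "\<dots> = (\<Sum>k\<le>degree q. coeff q k * a ^ k * (\<integral>y. w x y ^ k * G y \<partial>leb d))"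
      using int by (subst Bochner_Integration.integral_sum) (auto intro!: integrable_mult_right)
    finally show ?thesis .
  qed
  moreover have "(\<lambda>x. \<Sum>k\<le>degree q. coeff q k * a ^ k * (\<integral>y. w x y ^ k * G y \<partial>leb d)) \<in> polys d (real (degree q) + 1)"
    using integral_power_polys[OF assms] unfolding w_def
    by (intro polys_sum polys_scale polys_mono[OF integral_power_polys[OF assms]]) auto
  ultimately show ?thesis by (simp only: w_def)
qed

section \<open>Dimension of the polynomial spaces on the sphere\<close>

text \<open>Gaussian elimination: a nonzero entry \<open>a p b\<close> solves the equation
  \<open>b\<close> for the unknown \<open>c p\<close>, and substituting it leaves one unknown and
  one equation fewer.\<close>

lemma linear_dependence:
  fixes a :: "'a \<Rightarrow> 'b \<Rightarrow> real"
  assumes "finite B" "finite J" "card B < card J"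
  shows "\<exists>c. (\<exists>j\<in>J. c j \<noteq> 0) \<and> (\<forall>b\<in>B. (\<Sum>j\<in>J. c j * a j b) = 0)"
  using assms
proof (induction B arbitrary: J a rule: finite_induct)
  case empty
  then have "J \<noteq> {}" by auto
  then show ?case by (intro exI[of _ "\<lambda>_. 1"]) auto
next
  case (insert b B)
  show ?case
  proof (cases "\<forall>j\<in>J. a j b = 0")
    case True
    have "card B < card J" using insert by simp
    from insert.IH[OF insert.prems(1) this] show ?thesis using True by (auto intro!: sum.neutral)
  next
    case False
    then obtain p where p: "p \<in> J" "a p b \<noteq> 0" by blast
    have "card B < card (J - {p})" "finite (J - {p})" using insert p by auto
    from insert.IH[OF this(2,1), of "\<lambda>j l. a j l - a j b / a p b * a p l"]
    obtain c where c: "\<exists>j\<in>J - {p}. c j \<noteq> 0" "\<And>l. l \<in> B \<Longrightarrow> (\<Sum>j\<in>J - {p}. c j * (a j l - a j b / a p b * a p l)) = 0"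
      by blast
    define S where "S = (\<Sum>j\<in>J - {p}. c j * a j b)"
    define c' where "c' = c(p := - S / a p b)"
    have split: "(\<Sum>j\<in>J. c' j * a j l) = - S / a p b * a p l + (\<Sum>j\<in>J - {p}. c j * a j l)" for l
    proof -
      have "(\<Sum>j\<in>J - {p}. c' j * a j l) = (\<Sum>j\<in>J - {p}. c j * a j l)"
        by (intro sum.cong) (auto simp: c'_def)
      then show ?thesis
        using sum.remove[OF insert.prems(1) p(1), of "\<lambda>j. c' j * a j l"] by (simp add: c'_def)
    qed
    have "(\<Sum>j\<in>J. c' j * a j b) = 0" unfolding split using p by (simp add: S_def)
    moreover have "(\<Sum>j\<in>J. c' j * a j l) = 0" if "l \<in> B" for l
    proof -
      have "(\<Sum>j\<in>J - {p}. c j * (a j l - a j b / a p b * a p l)) = (\<Sum>j\<in>J - {p}. c j * a j l) - S / a p b * a p l"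
        unfolding S_def sum_divide_distrib sum_distrib_right sum_subtractf[symmetric]
        by (intro sum.cong) (auto simp: algebra_simps)
      then show ?thesis unfolding split using c(2)[OF that] by simp
    qed
    moreover have "\<exists>j\<in>J. c' j \<noteq> 0" using c(1) by (auto simp: c'_def)
    ultimately show ?thesis by blast
  qed
qed

text \<open>On the sphere the square of \<open>x 0\<close> is 1 minus the other squares, so
  exponents 0 and 1 of \<open>x 0\<close> suffice. This keeps the count of order
  \<open>N ^ d\<close>; all monomials in d + 1 variables would give \<open>N ^ (d + 1)\<close> and
  spoil the d-th root of the dimension.\<close>

definition reduced_exps :: "nat \<Rightarrow> nat \<Rightarrow> (nat \<Rightarrow> nat) set" where
  "reduced_exps d N = {\<alpha>. \<alpha> 0 \<le> 1 \<and> (\<forall>i>d. \<alpha> i = 0) \<and> (\<Sum>i\<le>d. \<alpha> i) \<le> N}"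

lemma sphere_sum_squares: "x \<in> sphere_d d \<Longrightarrow> (\<Sum>i\<le>d. (x i)\<^sup>2) = 1"
  by (auto simp: sphere_d_def enorm_def)

lemma card_reduced_exps:
  "finite (reduced_exps d N)" "card (reduced_exps d N) \<le> 2 * ((N + d) choose N)"
proof -
  define L where "L = {l :: nat list. length l = Suc d \<and> sum_list l = N}"
  have cL: "card L = (N + d) choose N" unfolding L_def card_length_sum_list by simp
  have "0 < (N + d) choose N" by (simp add: zero_less_binomial)
  then have fL: "finite L" using cL card_ge_0_finite[of L] by simp
  \<comment> \<open>The last list entry is the slack that brings the sum to exactly N, so the lists
    are counted by stars and bars; the exponent of \<open>x 0\<close> is recorded separately and
    takes two values.\<close>
  define \<psi> where "\<psi> \<alpha> = (\<alpha> 0, map \<alpha> [1..<Suc d] @ [N - (\<Sum>i=1..d. \<alpha> i)])" for \<alpha> :: "nat \<Rightarrow> nat"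
  have S: "(\<Sum>i=1..d. \<alpha> i) = sum_list (map \<alpha> [1..<Suc d])" for \<alpha> :: "nat \<Rightarrow> nat"
    by (simp add: sum_list_distinct_conv_sum_set atLeastLessThanSuc_atLeastAtMost del: upt_Suc)
  have "inj_on \<psi> (reduced_exps d N)"
  proof (rule inj_onI)
    fix \<alpha> \<beta> assume a: "\<alpha> \<in> reduced_exps d N" "\<beta> \<in> reduced_exps d N" "\<psi> \<alpha> = \<psi> \<beta>"
    show "\<alpha> = \<beta>"
    proof
      fix i
      show "\<alpha> i = \<beta> i"
      proof (cases "i = 0 \<or> i > d")
        case True
        then show ?thesis using a by (auto simp: \<psi>_def reduced_exps_def)
      next
        case False
        then have "i \<in> set [1..<Suc d]" by auto
        moreover have "map \<alpha> [1..<Suc d] = map \<beta> [1..<Suc d]" using a(3) by (simp add: \<psi>_def del: upt_Suc)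
        ultimately show ?thesis by (metis map_eq_conv)
      qed
    qed
  qed
  moreover have "\<psi> ` reduced_exps d N \<subseteq> {0, 1} \<times> L"
  proof (rule image_subsetI)
    fix \<alpha> assume a: "\<alpha> \<in> reduced_exps d N"
    have "(\<Sum>i=1..d. \<alpha> i) \<le> (\<Sum>i\<le>d. \<alpha> i)" by (intro sum_mono2) auto
    also have "\<dots> \<le> N" using a by (simp add: reduced_exps_def)
    finally have "sum_list (map \<alpha> [1..<Suc d]) \<le> N" by (simp only: S)
    then show "\<psi> \<alpha> \<in> {0, 1} \<times> L"
      using a by (auto simp: \<psi>_def L_def reduced_exps_def S[unfolded One_nat_def] le_Suc_eq simp del: upt_Suc)
  qed
  moreover have "finite ({0, 1 :: nat} \<times> L)" using fL by simp
  moreover have "card ({0, 1 :: nat} \<times> L) = 2 * ((N + d) choose N)" using cL by (simp add: card_cartesian_product)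
  ultimately show "finite (reduced_exps d N)" and "card (reduced_exps d N) \<le> 2 * ((N + d) choose N)"
    using inj_on_finite[of \<psi> "reduced_exps d N" "{0, 1} \<times> L"] card_inj_on_le[of \<psi> "reduced_exps d N" "{0, 1} \<times> L"]
    by simp_all
qed

lemma mono_fun_reduce:
  assumes "\<forall>i>d. \<alpha> i = 0" "(\<Sum>i\<le>d. \<alpha> i) \<le> N"
  shows "\<exists>c. \<forall>x\<in>sphere_d d. mono_fun d \<alpha> x = (\<Sum>\<beta>\<in>reduced_exps d N. c \<beta> * mono_fun d \<beta> x)"
  using assms
proof (induction "\<alpha> 0" arbitrary: \<alpha> rule: less_induct)
  case less
  show ?case
  proof (cases "\<alpha> 0 \<le> 1")
    case True
    then have "\<alpha> \<in> reduced_exps d N" using less by (simp add: reduced_exps_def)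
    then show ?thesis using card_reduced_exps(1)[of d N]
      by (intro exI[of _ "\<lambda>\<beta>. if \<beta> = \<alpha> then 1 else 0"]) (simp add: if_distrib[of "\<lambda>c. c * _"] cong: if_cong)
  next
    case False
    define \<gamma> where "\<gamma> = \<alpha>(0 := \<alpha> 0 - 2)"
    \<comment> \<open>Replacing the square of \<open>x 0\<close> by 1 minus the other squares yields
      \<open>\<eta> 0\<close> from the 1 and \<open>\<eta> i\<close> from the square of
      \<open>x i\<close>. Each has a smaller exponent at index 0 and no larger total degree.\<close>
    define \<eta> where "\<eta> i = (if i = 0 then \<gamma> else \<gamma>(i := \<gamma> i + 2))" for i
    have \<alpha>: "\<alpha> = \<gamma>(0 := \<gamma> 0 + 2)" by (rule ext) (use False in \<open>auto simp: \<gamma>_def\<close>)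
    have tot: "(\<Sum>i\<le>d. \<alpha> i) = (\<Sum>i\<le>d. \<gamma> i) + 2" by (subst \<alpha>, rule sum_upd_add) simp
    have "\<exists>c. \<forall>x\<in>sphere_d d. mono_fun d (\<eta> i) x = (\<Sum>\<beta>\<in>reduced_exps d N. c \<beta> * mono_fun d \<beta> x)" if i: "i \<le> d" for i
    proof (rule less.hyps)
      show "\<eta> i 0 < \<alpha> 0" using False by (auto simp: \<eta>_def \<gamma>_def)
      show "\<forall>l>d. \<eta> i l = 0" using less.prems i by (auto simp: \<eta>_def \<gamma>_def)
      show "(\<Sum>l\<le>d. \<eta> i l) \<le> N"
        using sum_upd_add[OF i, of \<gamma> 2] less.prems(2) tot by (auto simp: \<eta>_def)
    qed
    then obtain c where c: "\<And>i x. i \<le> d \<Longrightarrow> x \<in> sphere_d d \<Longrightarrow> mono_fun d (\<eta> i) x = (\<Sum>\<beta>\<in>reduced_exps d N. c i \<beta> * mono_fun d \<beta> x)"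
      by metis
    have "mono_fun d \<alpha> x = (\<Sum>\<beta>\<in>reduced_exps d N. (c 0 \<beta> - (\<Sum>i=1..d. c i \<beta>)) * mono_fun d \<beta> x)" if x: "x \<in> sphere_d d" for x
    proof -
      have "mono_fun d \<alpha> x = (x 0)\<^sup>2 * mono_fun d \<gamma> x" by (subst \<alpha>, rule mono_fun_upd) simp
      also have "(x 0)\<^sup>2 = 1 - (\<Sum>i=1..d. (x i)\<^sup>2)"
        using sphere_sum_squares[OF x] by (simp add: sum.atMost_shift sum.atLeast1_atMost_eq)
      also have "\<dots> * mono_fun d \<gamma> x = mono_fun d (\<eta> 0) x - (\<Sum>i=1..d. mono_fun d (\<eta> i) x)"
        unfolding left_diff_distrib sum_distrib_right mult_1
        using mono_fun_upd[of _ d \<gamma> 2 x] by (intro arg_cong2[of _ _ _ _ "(-)"] sum.cong) (auto simp: \<eta>_def)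
      also have "\<dots> = (\<Sum>\<beta>\<in>reduced_exps d N. c 0 \<beta> * mono_fun d \<beta> x) - (\<Sum>i=1..d. \<Sum>\<beta>\<in>reduced_exps d N. c i \<beta> * mono_fun d \<beta> x)"
        using c x by simp
      also have "\<dots> = (\<Sum>\<beta>\<in>reduced_exps d N. (c 0 \<beta> - (\<Sum>i=1..d. c i \<beta>)) * mono_fun d \<beta> x)"
        by (subst sum.swap) (simp add: left_diff_distrib sum_subtractf sum_distrib_right)
      finally show ?thesis .
    qed
    then show ?thesis by (intro exI[of _ "\<lambda>\<beta>. c 0 \<beta> - (\<Sum>i=1..d. c i \<beta>)"] ballI)
  qed
qed

lemma polys_reduce:
  assumes "P \<in> polys d m" "m > 0"
  shows "\<exists>c. \<forall>x\<in>sphere_d d. P x = (\<Sum>\<beta>\<in>reduced_exps d (nat \<lfloor>m\<rfloor>). c \<beta> * mono_fun d \<beta> x)"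
proof -
  obtain A a where A: "finite A" "\<And>\<alpha>. \<alpha> \<in> A \<Longrightarrow> (\<forall>i>d. \<alpha> i = 0) \<and> real (\<Sum>i\<le>d. \<alpha> i) < m"
    "\<And>x. P x = (\<Sum>\<alpha>\<in>A. a \<alpha> * mono_fun d \<alpha> x)" by (rule polysE[OF assms(1)]) blast
  have "\<exists>c. \<forall>x\<in>sphere_d d. mono_fun d \<alpha> x = (\<Sum>\<beta>\<in>reduced_exps d (nat \<lfloor>m\<rfloor>). c \<beta> * mono_fun d \<beta> x)" if "\<alpha> \<in> A" for \<alpha>
    using A(2)[OF that] by (intro mono_fun_reduce) (auto simp: le_nat_floor)
  then obtain c where c: "\<And>\<alpha> x. \<alpha> \<in> A \<Longrightarrow> x \<in> sphere_d d \<Longrightarrow> mono_fun d \<alpha> x = (\<Sum>\<beta>\<in>reduced_exps d (nat \<lfloor>m\<rfloor>). c \<alpha> \<beta> * mono_fun d \<beta> x)"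
    by metis
  have "P x = (\<Sum>\<beta>\<in>reduced_exps d (nat \<lfloor>m\<rfloor>). (\<Sum>\<alpha>\<in>A. a \<alpha> * c \<alpha> \<beta>) * mono_fun d \<beta> x)" if "x \<in> sphere_d d" for x
    unfolding A(3) sum_distrib_right using c[OF _ that]
    by (subst sum.swap) (simp add: sum_distrib_left mult.assoc)
  then show ?thesis by (intro exI[of _ "\<lambda>\<beta>. \<Sum>\<alpha>\<in>A. a \<alpha> * c \<alpha> \<beta>"] ballI)
qed

lemma unit_vector_sphere: "i \<le> d \<Longrightarrow> (\<lambda>l. if l = i then 1 else 0) \<in> sphere_d d"
  by (auto simp: sphere_d_def enorm_def if_distrib[of "\<lambda>t. t\<^sup>2"] cong: if_cong)

text \<open>\<open>Max\<close> is informative only for a finite nonempty set. The constant function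
  shows that 1 belongs to it, and more functions than reduced monomials are dependent on the sphere
  by \<open>linear_dependence\<close>, which bounds it.\<close>

lemma dimP_bounds:
  assumes "m > 0"
  shows "1 \<le> dimP d m" "dimP d m \<le> 2 * ((nat \<lfloor>m\<rfloor> + d) choose d)"
proof -
  define K where "K = {k. \<exists>g :: nat \<Rightarrow> (nat \<Rightarrow> real) \<Rightarrow> real.
      (\<forall>j<k. g j \<in> polys d m) \<and>
      (\<forall>c :: nat \<Rightarrow> real. (\<forall>x\<in>sphere_d d. (\<Sum>j<k. c j * g j x) = 0) \<longrightarrow> (\<forall>j<k. c j = 0))}"
  have le: "k \<le> card (reduced_exps d (nat \<lfloor>m\<rfloor>))" if k: "k \<in> K" for k
  proof (rule ccontr)
    assume "\<not> ?thesis"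
    then have card: "card (reduced_exps d (nat \<lfloor>m\<rfloor>)) < card {..<k}" by simp
    from k obtain g :: "nat \<Rightarrow> (nat \<Rightarrow> real) \<Rightarrow> real" where g: "\<And>j. j < k \<Longrightarrow> g j \<in> polys d m"
      and ind: "\<And>c j. (\<forall>x\<in>sphere_d d. (\<Sum>j<k. c j * g j x) = 0) \<Longrightarrow> j < k \<Longrightarrow> c j = (0::real)"
      unfolding K_def by blast
    obtain a where a: "\<And>j x. j < k \<Longrightarrow> x \<in> sphere_d d \<Longrightarrow> g j x = (\<Sum>\<beta>\<in>reduced_exps d (nat \<lfloor>m\<rfloor>). a j \<beta> * mono_fun d \<beta> x)"
      using polys_reduce[OF g assms] by metis
    obtain c where c: "\<exists>j\<in>{..<k}. c j \<noteq> 0" "\<And>\<beta>. \<beta> \<in> reduced_exps d (nat \<lfloor>m\<rfloor>) \<Longrightarrow> (\<Sum>j<k. c j * a j \<beta>) = 0"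
      using linear_dependence[OF card_reduced_exps(1) _ card, of a] by blast
    have "(\<Sum>j<k. c j * g j x) = 0" if x: "x \<in> sphere_d d" for x
    proof -
      have "(\<Sum>j<k. c j * g j x) = (\<Sum>j<k. \<Sum>\<beta>\<in>reduced_exps d (nat \<lfloor>m\<rfloor>). c j * a j \<beta> * mono_fun d \<beta> x)"
        using a x by (simp add: sum_distrib_left mult.assoc)
      also have "\<dots> = (\<Sum>\<beta>\<in>reduced_exps d (nat \<lfloor>m\<rfloor>). (\<Sum>j<k. c j * a j \<beta>) * mono_fun d \<beta> x)"
        by (subst sum.swap) (simp add: sum_distrib_right)
      finally show ?thesis using c(2) by simp
    qed
    with ind c(1) show False by blast
  qed
  then have fin: "finite K" by (meson finite_nat_set_iff_bounded_le)
  have "1 \<in> K"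
    unfolding K_def mem_Collect_eq
  proof (intro exI[of _ "\<lambda>_ _. 1"] conjI allI impI)
    fix c :: "nat \<Rightarrow> real" and j :: nat
    assume "\<forall>x\<in>sphere_d d. (\<Sum>j<1. c j * 1) = 0" "j < 1"
    then show "c j = 0" using unit_vector_sphere[of 0 d] by auto
  qed (use polys_const[OF assms] in auto)
  have D: "dimP d m = Max K" by (simp add: dimP_def K_def)
  show "1 \<le> dimP d m" unfolding D using fin \<open>1 \<in> K\<close> by (rule Max_ge)
  have "dimP d m \<le> card (reduced_exps d (nat \<lfloor>m\<rfloor>))" unfolding D using fin \<open>1 \<in> K\<close> le by (subst Max_le_iff) auto
  also have "\<dots> \<le> 2 * ((nat \<lfloor>m\<rfloor> + d) choose d)"
    using card_reduced_exps(2)[of d "nat \<lfloor>m\<rfloor>"] binomial_symmetric[of d "nat \<lfloor>m\<rfloor> + d"] by simp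
  finally show "dimP d m \<le> 2 * ((nat \<lfloor>m\<rfloor> + d) choose d)" .
qed

text \<open>The quotient \<open>d ^ d / fact d\<close> is a single term of the exponential series at
  d.\<close>

lemma power_le_exp_fact: "real d ^ d \<le> exp 1 ^ d * fact d"
proof -
  have "(\<Sum>n\<in>{d}. real d ^ n /\<^sub>R fact n) \<le> exp (real d)"
    unfolding exp_def by (intro sum_le_suminf summable_exp_generic) auto
  then have "real d ^ d / fact d \<le> exp (real d)" by (simp add: divide_inverse mult.commute)
  also have "exp (real d) = exp 1 ^ d" using exp_of_nat_mult[of d "1::real"] by simp
  finally show ?thesis by (simp add: field_simps)
qed

text \<open>The factorial in the binomial coefficient cancels \<open>d ^ d\<close> up to
  \<open>exp 1 ^ d\<close>, so the d-th root is linear in n uniformly in d. In the constant, 7 comes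
  from N + d \<le> 6 d n + d n, and 2 from bounding the factor 2 of \<open>dimP_bounds\<close> by
  \<open>2 ^ d\<close>.\<close>

lemma dimP_root_le:
  assumes "d \<ge> 1" "n \<ge> 1" "r > 0"
  shows "real (dimP d (2 * (real d + 2) * n)) powr (r / real d) \<le> (14 * exp 1 * n) powr r"
proof -
  define N where "N = nat \<lfloor>2 * (real d + 2) * n\<rfloor>"
  have pos: "2 * (real d + 2) * n > 0" using assms by (intro mult_pos_pos) auto
  have "real N \<le> 2 * (real d + 2) * n" using pos by (simp add: N_def)
  also have "\<dots> \<le> 2 * (3 * real d) * n" using assms by (intro mult_right_mono mult_left_mono) auto
  finally have N: "real N \<le> 6 * (real d * n)" by simp
  have "real d * 1 \<le> real d * n" using assms by (intro mult_left_mono) auto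
  then have "real (N + d) \<le> 7 * (real d * n)" using N by simp
  then have Nd: "real (N + d) \<le> 7 * n * real d" by (simp add: mult_ac)
  have "real (dimP d (2 * (real d + 2) * n)) \<le> 2 * real ((N + d) choose d)"
    using of_nat_mono[OF dimP_bounds(2)[OF pos, of d], where 'a = real] by (simp add: N_def)
  also have "real ((N + d) choose d) \<le> real (N + d) ^ d / fact d"
  proof -
    have "real (((N + d) choose d) * fact d) \<le> real ((N + d) ^ d)"
      using binomial_fact_pow[of "N + d" d] of_nat_le_iff by blast
    then show ?thesis by (simp add: field_simps)
  qed
  also have "\<dots> \<le> (7 * n * real d) ^ d / fact d" using Nd by (intro divide_right_mono power_mono) auto
  also have "\<dots> = (7 * n) ^ d * (real d ^ d / fact d)" by (simp add: power_mult_distrib)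
  also have "\<dots> \<le> (7 * n) ^ d * exp 1 ^ d"
    using power_le_exp_fact[of d] assms by (intro mult_left_mono) (auto simp: field_simps)
  also have "2 * ((7 * n) ^ d * exp 1 ^ d) \<le> 2 ^ d * ((7 * n) ^ d * exp 1 ^ d)"
  proof (rule mult_right_mono)
    have "(2::real) ^ 1 \<le> 2 ^ d" using assms by (intro power_increasing) auto
    then show "(2::real) \<le> 2 ^ d" by simp
  qed (use assms in auto)
  also have "\<dots> = (14 * exp 1 * n) ^ d" 
    unfolding power_mult_distrib[symmetric] by (intro arg_cong[of _ _ "\<lambda>t. t ^ d"]) simp
  finally have "real (dimP d (2 * (real d + 2) * n)) \<le> (14 * exp 1 * n) ^ d" by simp
  then have "real (dimP d (2 * (real d + 2) * n)) powr (r / real d) \<le> ((14 * exp 1 * n) ^ d) powr (r / real d)"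
    using assms by (intro powr_mono2) auto
  also have "\<dots> = (14 * exp 1 * n) powr r"
    using assms by (simp add: powr_powr flip: powr_realpow)
  finally show ?thesis .
qed

section \<open>Growth of spherical polynomials along great circles\<close>

definition ip :: "nat \<Rightarrow> (nat \<Rightarrow> real) \<Rightarrow> (nat \<Rightarrow> real) \<Rightarrow> real" where
  "ip d x y = (\<Sum>i\<le>d. x i * y i)"

lemma enorm_sq: "(enorm d x)\<^sup>2 = ip d x x"
  by (simp add: enorm_def ip_def power2_eq_square sum_nonneg)

lemma ip_comm: "ip d x y = ip d y x"
  by (simp add: ip_def mult.commute)

lemma ip_lincomb:
  "ip d (\<lambda>i. a * x i + b * y i) z = a * ip d x z + b * ip d y z"
  by (simp add: ip_def distrib_right sum.distrib sum_distrib_left mult.assoc)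

lemma enorm_sq_lincomb:
  "(enorm d (\<lambda>i. a * x i + b * y i))\<^sup>2 = a\<^sup>2 * (enorm d x)\<^sup>2 + 2 * a * b * ip d x y + b\<^sup>2 * (enorm d y)\<^sup>2"
  unfolding enorm_sq ip_lincomb ip_comm[of d _ "\<lambda>i. a * x i + b * y i"]
  by (simp add: ip_comm[of d y x] power2_eq_square algebra_simps)

lemma enorm_minus_commute: "enorm d (\<lambda>i. x i - y i) = enorm d (\<lambda>i. y i - x i)"
  by (simp add: enorm_def power2_commute)

lemma sphere_enorm: "x \<in> sphere_d d \<Longrightarrow> enorm d x = 1"
  by (simp add: sphere_d_def)

lemma sphere_lincomb:
  assumes "x \<in> sphere_d d" "v \<in> sphere_d d" "ip d x v = 0" "a\<^sup>2 + b\<^sup>2 = 1"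
  shows "(\<lambda>i. a * x i + b * v i) \<in> sphere_d d"
    and "(enorm d (\<lambda>i. x i - (a * x i + b * v i)))\<^sup>2 = 2 - 2 * a"
proof -
  have "(enorm d (\<lambda>i. a * x i + b * v i))\<^sup>2 = 1"
    unfolding enorm_sq_lincomb using assms by (simp add: sphere_enorm)
  then have "enorm d (\<lambda>i. a * x i + b * v i) = 1"
    by (simp add: power2_eq_1_iff) (smt (verit) enorm_nonneg)
  then show "(\<lambda>i. a * x i + b * v i) \<in> sphere_d d" using assms by (simp add: sphere_d_def)
  have "(enorm d (\<lambda>i. (1 - a) * x i + (- b) * v i))\<^sup>2 = (1 - a)\<^sup>2 + b\<^sup>2"
    unfolding enorm_sq_lincomb using assms by (simp add: sphere_enorm)
  also have "\<dots> = 2 - 2 * a" using assms(4) by (simp add: power2_eq_square algebra_simps)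
  finally show "(enorm d (\<lambda>i. x i - (a * x i + b * v i)))\<^sup>2 = 2 - 2 * a"
    by (simp add: algebra_simps)
qed

text \<open>A quarter turn of \<open>x\<close> inside the plane of two coordinates, one of them
  nonzero at \<open>x\<close>, gives the orthogonal direction; d \<ge> 1 provides the second
  coordinate.\<close>

lemma sphere_orthogonal:
  assumes "x \<in> sphere_d d" "d \<ge> 1"
  shows "\<exists>v\<in>sphere_d d. ip d x v = 0"
proof -
  have "\<exists>i\<le>d. x i \<noteq> 0"
  proof (rule ccontr)
    assume "\<not> ?thesis"
    then have "(\<Sum>i\<le>d. (x i)\<^sup>2) = 0" by (intro sum.neutral) auto
    with sphere_sum_squares[OF assms(1)] show False by simp
  qed
  then obtain i where i: "i \<le> d" "x i \<noteq> 0" by blast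
  define j where "j = (if i = 0 then 1 else 0 :: nat)"
  have j: "j \<le> d" "j \<noteq> i" using assms(2) by (auto simp: j_def)
  define D where "D = sqrt ((x i)\<^sup>2 + (x j)\<^sup>2)"
  have D: "D > 0" "D\<^sup>2 = (x i)\<^sup>2 + (x j)\<^sup>2" unfolding D_def using i
    by (auto intro!: add_pos_nonneg)
  define v where "v l = (if l = i then - x j / D else if l = j then x i / D else 0)" for l
  have two: "(\<Sum>l\<le>d. g l) = g i + g j" if "\<And>l. l \<noteq> i \<Longrightarrow> l \<noteq> j \<Longrightarrow> g l = 0" for g :: "nat \<Rightarrow> real"
  proof -
    have "(\<Sum>l\<le>d. g l) = (\<Sum>l\<in>{i, j}. g l)" using i j that by (intro sum.mono_neutral_right) auto
    then show ?thesis using j by simp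
  qed
  have "(\<Sum>l\<le>d. (v l)\<^sup>2) = (x j)\<^sup>2 / D\<^sup>2 + (x i)\<^sup>2 / D\<^sup>2"
    using j by (subst two) (auto simp: v_def power_divide)
  also have "\<dots> = D\<^sup>2 / D\<^sup>2" unfolding D(2) by (simp only: add_divide_distrib add.commute)
  also have "\<dots> = 1" using D(1) by simp
  finally have "v \<in> sphere_d d" using i j by (auto simp: sphere_d_def enorm_def v_def)
  moreover have "ip d x v = 0" unfolding ip_def using j by (subst two) (auto simp: v_def)
  ultimately show ?thesis by blast
qed

lemma great_circle:
  assumes x: "x \<in> sphere_d d" and y: "y \<in> sphere_d d" and d: "d \<ge> 1"
  obtains v t where "v \<in> sphere_d d" "ip d x v = 0" "y = (\<lambda>i. cos t * x i + sin t * v i)"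
proof -
  define c where "c = ip d x y"
  \<comment> \<open>This is the component of \<open>y\<close> orthogonal to \<open>x\<close>. It
    vanishes only if y is x or its antipode, and then any unit vector orthogonal to \<open>x\<close>
    spans a suitable circle.\<close>
  define e where "e i = (- c) * x i + 1 * y i" for i
  have e2: "(enorm d e)\<^sup>2 = 1 - c\<^sup>2"
    unfolding e_def enorm_sq_lincomb using x y by (simp add: sphere_enorm c_def power2_eq_square)
  show ?thesis
  proof (cases "enorm d e = 0")
    case True
    obtain v where v: "v \<in> sphere_d d" "ip d x v = 0" using sphere_orthogonal[OF x d] by blast
    have "c = 1 \<or> c = -1" using True e2 by (simp add: power2_eq_1_iff)
    moreover have "cos 0 = (1::real)" "sin 0 = (0::real)" "cos pi = -1" "sin pi = 0" by auto
    ultimately obtain t where t: "cos t = c" "sin t = 0" by metis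
    have "y i = c * x i" for i
    proof (cases "i \<le> d")
      case True
      then have "\<bar>e i\<bar> \<le> 0" using abs_coord_le_enorm[of i d e] \<open>enorm d e = 0\<close> by simp
      then show ?thesis by (simp add: e_def)
    next
      case False
      then show ?thesis using x y by (simp add: sphere_d_def)
    qed
    then have "y = (\<lambda>i. cos t * x i + sin t * v i)" by (auto simp: t)
    with v show ?thesis by (rule that)
  next
    case False
    define v where "v i = (1 / enorm d e) * e i" for i
    have "enorm d v = 1" unfolding v_def[abs_def] enorm_scale using False by simp
    then have v: "v \<in> sphere_d d" using x y by (simp add: sphere_d_def v_def e_def)
    have "ip d e x = (- c) * ip d x x + 1 * ip d y x" unfolding e_def by (rule ip_lincomb)
    also have "ip d x x = 1" using x enorm_sq[of d x] by (simp add: sphere_enorm)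
    finally have "ip d x e = 0" using ip_comm[of d y x] ip_comm[of d e x] by (simp add: c_def)
    then have o: "ip d x v = 0" by (simp add: v_def ip_def sum_divide_distrib[symmetric])
    have "c\<^sup>2 + (enorm d e)\<^sup>2 = 1" using e2 by simp
    then obtain t where t: "cos t = c" "sin t = enorm d e" by (metis sincos_total_2pi)
    have "y = (\<lambda>i. cos t * x i + sin t * v i)" using False by (auto simp: t v_def e_def)
    with v o show ?thesis by (rule that)
  qed
qed

text \<open>Binary forms of degree m in the half-angle coordinates u = sin (t/2), w = cos (t/2).
  Here cos t and sin t become the quadratic forms \<open>w\<^sup>2 - u\<^sup>2\<close> and
  \<open>2 * u * w\<close>, so a spherical polynomial on a great circle becomes one form with real
  coefficients, which dividing by \<open>w ^ m\<close> turns into a polynomial in tan (t/2).\<close>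

definition circle_form :: "nat \<Rightarrow> (real \<Rightarrow> real \<Rightarrow> real) \<Rightarrow> bool" where
  "circle_form m h \<longleftrightarrow> (\<exists>a. \<forall>u w. u\<^sup>2 + w\<^sup>2 = 1 \<longrightarrow> h u w = (\<Sum>k\<le>m. a k * u ^ k * w ^ (m - k)))"

lemma circle_form_add: "circle_form m g \<Longrightarrow> circle_form m h \<Longrightarrow> circle_form m (\<lambda>u w. g u w + h u w)"
  unfolding circle_form_def
proof (elim exE)
  fix a b
  assume "\<forall>u w. u\<^sup>2 + w\<^sup>2 = 1 \<longrightarrow> g u w = (\<Sum>k\<le>m. a k * u ^ k * w ^ (m - k))"
    "\<forall>u w. u\<^sup>2 + w\<^sup>2 = 1 \<longrightarrow> h u w = (\<Sum>k\<le>m. b k * u ^ k * w ^ (m - k))"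
  then show "\<exists>a. \<forall>u w. u\<^sup>2 + w\<^sup>2 = 1 \<longrightarrow> g u w + h u w = (\<Sum>k\<le>m. a k * u ^ k * w ^ (m - k))"
    by (intro exI[of _ "\<lambda>k. a k + b k"]) (simp add: distrib_right sum.distrib)
qed

lemma circle_form_scale: "circle_form m g \<Longrightarrow> circle_form m (\<lambda>u w. c * g u w)"
  unfolding circle_form_def
proof (elim exE)
  fix a
  assume "\<forall>u w. u\<^sup>2 + w\<^sup>2 = 1 \<longrightarrow> g u w = (\<Sum>k\<le>m. a k * u ^ k * w ^ (m - k))"
  then show "\<exists>a. \<forall>u w. u\<^sup>2 + w\<^sup>2 = 1 \<longrightarrow> c * g u w = (\<Sum>k\<le>m. a k * u ^ k * w ^ (m - k))"
    by (intro exI[of _ "\<lambda>k. c * a k"]) (simp add: sum_distrib_left mult.assoc)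
qed

lemma circle_form_sum: "(\<And>j. j \<in> J \<Longrightarrow> circle_form m (g j)) \<Longrightarrow> circle_form m (\<lambda>u w. \<Sum>j\<in>J. g j u w)"
proof (induction J rule: infinite_finite_induct)
  case (insert j J)
  then show ?case by (simp add: circle_form_add)
qed (auto simp: circle_form_def intro!: exI[of _ "\<lambda>_. 0"])

lemma circle_form_mult_u: "circle_form m g \<Longrightarrow> circle_form (Suc m) (\<lambda>u w. u * g u w)"
  unfolding circle_form_def
proof (elim exE)
  fix a
  assume "\<forall>u w. u\<^sup>2 + w\<^sup>2 = 1 \<longrightarrow> g u w = (\<Sum>k\<le>m. a k * u ^ k * w ^ (m - k))"
  then show "\<exists>a. \<forall>u w. u\<^sup>2 + w\<^sup>2 = 1 \<longrightarrow> u * g u w = (\<Sum>k\<le>Suc m. a k * u ^ k * w ^ (Suc m - k))"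
    by (intro exI[of _ "\<lambda>k. if k = 0 then 0 else a (k - 1)"], subst sum.atMost_Suc_shift)
      (simp add: sum_distrib_left mult_ac)
qed

lemma circle_form_mult_w: "circle_form m g \<Longrightarrow> circle_form (Suc m) (\<lambda>u w. w * g u w)"
  unfolding circle_form_def
proof (elim exE)
  fix a
  assume "\<forall>u w. u\<^sup>2 + w\<^sup>2 = 1 \<longrightarrow> g u w = (\<Sum>k\<le>m. a k * u ^ k * w ^ (m - k))"
  then show "\<exists>a. \<forall>u w. u\<^sup>2 + w\<^sup>2 = 1 \<longrightarrow> w * g u w = (\<Sum>k\<le>Suc m. a k * u ^ k * w ^ (Suc m - k))"
    by (intro exI[of _ "\<lambda>k. if k \<le> m then a k else 0"])
      (simp add: sum_distrib_left mult.left_commute Suc_diff_le)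
qed

text \<open>Multiplying by \<open>u\<^sup>2 + w\<^sup>2\<close>, which is 1 on the circle, raises
  the degree by 2. This brings monomials of different degrees to one common degree.\<close>

lemma circle_form_lift: "circle_form m g \<Longrightarrow> circle_form (m + 2 * k) g"
proof (induction k)
  case (Suc k)
  have "circle_form (Suc (Suc (m + 2 * k))) (\<lambda>u w. u * (u * g u w) + w * (w * g u w))"
    using Suc by (intro circle_form_add circle_form_mult_u circle_form_mult_w)
  moreover have "u * (u * g u w) + w * (w * g u w) = (u\<^sup>2 + w\<^sup>2) * g u w" for u w
    by (simp add: power2_eq_square algebra_simps)
  ultimately show ?case by (simp add: circle_form_def)
qed simp

lemma circle_form_coord_power:
  assumes "circle_form m g"
  shows "circle_form (m + 2 * k) (\<lambda>u w. ((w\<^sup>2 - u\<^sup>2) * a + 2 * u * w * b) ^ k * g u w)"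
proof (induction k)
  case (Suc k)
  define G where "G u w = ((w\<^sup>2 - u\<^sup>2) * a + 2 * u * w * b) ^ k * g u w" for u w
  have G: "circle_form (m + 2 * k) G" using Suc by (simp add: G_def[abs_def])
  have "circle_form (Suc (Suc (m + 2 * k))) (\<lambda>u w. a * (w * (w * G u w)) + ((- a) * (u * (u * G u w)) + (2 * b) * (u * (w * G u w))))"
    using G by (intro circle_form_add circle_form_scale circle_form_mult_u circle_form_mult_w)
  moreover have "a * (w * (w * G u w)) + ((- a) * (u * (u * G u w)) + (2 * b) * (u * (w * G u w))) = ((w\<^sup>2 - u\<^sup>2) * a + 2 * u * w * b) ^ Suc k * g u w" for u w
    unfolding G_def power_Suc by algebra
  ultimately show ?case by simp
qed (use assms in simp)

lemma circle_form_polys: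
  assumes P: "P \<in> polys d r" and r: "r \<le> real \<rho>"
  shows "circle_form (2 * \<rho>) (\<lambda>u w. P (\<lambda>i. (w\<^sup>2 - u\<^sup>2) * x i + 2 * u * w * v i))"
proof -
  obtain A c where A: "\<And>\<alpha>. \<alpha> \<in> A \<Longrightarrow> (\<forall>i>d. \<alpha> i = 0) \<and> real (\<Sum>i\<le>d. \<alpha> i) < r"
    "\<And>x. P x = (\<Sum>\<alpha>\<in>A. c \<alpha> * mono_fun d \<alpha> x)" by (rule polysE[OF P]) blast
  have pr: "circle_form (2 * (\<Sum>i\<in>I. \<alpha> i)) (\<lambda>u w. \<Prod>i\<in>I. ((w\<^sup>2 - u\<^sup>2) * x i + 2 * u * w * v i) ^ \<alpha> i)" if "finite I" for I \<alpha>
    using that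
  proof (induction I rule: finite_induct)
    case empty
    show ?case by (auto simp: circle_form_def intro!: exI[of _ "\<lambda>_. 1"])
  next
    case (insert i I)
    from circle_form_coord_power[OF insert.IH, of "\<alpha> i" "x i" "v i"] insert(1,2)
    show ?case by (simp add: add.commute)
  qed
  have "circle_form (2 * \<rho>) (\<lambda>u w. mono_fun d \<alpha> (\<lambda>i. (w\<^sup>2 - u\<^sup>2) * x i + 2 * u * w * v i))" if "\<alpha> \<in> A" for \<alpha>
  proof -
    have "real (\<Sum>i\<le>d. \<alpha> i) < real \<rho>" using A(1)[OF that] r by linarith
    then have "(\<Sum>i\<le>d. \<alpha> i) \<le> \<rho>" by (simp only: of_nat_less_iff less_imp_le)
    then have eq: "2 * (\<Sum>i\<le>d. \<alpha> i) + 2 * (\<rho> - (\<Sum>i\<le>d. \<alpha> i)) = 2 * \<rho>" by simp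
    show ?thesis using circle_form_lift[OF pr[of "{..d}" \<alpha>], of "\<rho> - (\<Sum>i\<le>d. \<alpha> i)"]
      unfolding eq mono_fun_def by simp
  qed
  then show ?thesis unfolding A(2) by (intro circle_form_sum circle_form_scale)
qed

text \<open>A great circle from x to y reduces the claim to one variable, which keeps the constant
  free of d. Near x the variable s = tan (t/2) runs over an interval of length \<delta>/2, where
  \<open>coeff_bound\<close> controls the coefficients at the cost of (2/\<delta>)^(2 \<rho>); the
  coefficients in turn control P on the whole circle.\<close>

lemma polys_cap_growth:
  "\<exists>C>0. \<forall>d r P x \<delta> M. d \<ge> 1 \<longrightarrow> r \<le> real \<rho> \<longrightarrow> P \<in> polys d r \<longrightarrow> x \<in> sphere_d d \<longrightarrow> 0 < \<delta> \<longrightarrow> \<delta> \<le> 1 \<longrightarrow>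
     (\<forall>y\<in>sphere_d d. enorm d (\<lambda>i. x i - y i) \<le> \<delta> \<longrightarrow> \<bar>P y\<bar> \<le> M) \<longrightarrow>
     (\<forall>y\<in>sphere_d d. \<bar>P y\<bar> \<le> C * M / \<delta> ^ (2 * \<rho>))"
proof -
  obtain C0 where C0: "C0 > 0" and cb: "\<And>(a :: nat \<Rightarrow> real) M \<eta> k. 0 < \<eta> \<Longrightarrow> (\<forall>u\<in>{0..\<eta>}. \<bar>\<Sum>k\<le>2 * \<rho>. a k * u ^ k\<bar> \<le> M) \<Longrightarrow>
     k \<le> 2 * \<rho> \<Longrightarrow> \<bar>a k\<bar> \<le> C0 * M / \<eta> ^ k"
    using coeff_bound[of "2 * \<rho>"] by blast
  define C where "C = real (2 * \<rho> + 1) * (C0 * 2 ^ \<rho> * 2 ^ (2 * \<rho>))"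
  have "C > 0" using C0 by (simp add: C_def)
  moreover have "\<bar>P y\<bar> \<le> C * M / \<delta> ^ (2 * \<rho>)"
    if d: "d \<ge> 1" and r: "r \<le> real \<rho>" and P: "P \<in> polys d r" and x: "x \<in> sphere_d d" and \<delta>: "0 < \<delta>" "\<delta> \<le> 1"
      and bd: "\<forall>y\<in>sphere_d d. enorm d (\<lambda>i. x i - y i) \<le> \<delta> \<longrightarrow> \<bar>P y\<bar> \<le> M" and y: "y \<in> sphere_d d"
    for d r P x \<delta> M y
  proof -
    have "\<bar>P x\<bar> \<le> M" using bd x \<delta> by (auto simp: enorm_def)
    then have M: "M \<ge> 0" by linarith
    obtain v t where v: "v \<in> sphere_d d" "ip d x v = 0" and yt: "y = (\<lambda>i. cos t * x i + sin t * v i)"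
      using great_circle[OF x y d] by blast
    obtain a where a: "\<And>u w. u\<^sup>2 + w\<^sup>2 = 1 \<Longrightarrow> P (\<lambda>i. (w\<^sup>2 - u\<^sup>2) * x i + 2 * u * w * v i) = (\<Sum>k\<le>2 * \<rho>. a k * u ^ k * w ^ (2 * \<rho> - k))"
      using circle_form_polys[OF P r, of x v] unfolding circle_form_def by blast
    have small: "\<bar>\<Sum>k\<le>2 * \<rho>. a k * s ^ k\<bar> \<le> M * 2 ^ \<rho>" if s: "s \<in> {0..\<delta> / 2}" for s
    proof -
      \<comment> \<open>Here s = tan (t/2) and w = cos (t/2). The corresponding point of the circle
        is at distance 2 |u| \<le> 2 s from x, so s \<le> \<delta>/2 keeps it in the cap.\<close>
      define w where "w = 1 / sqrt (1 + s\<^sup>2)"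
      define u where "u = s * w"
      have "1 + s\<^sup>2 > 0" by (intro add_pos_nonneg) auto
      then have w: "w > 0" "w\<^sup>2 * (1 + s\<^sup>2) = 1" by (auto simp: w_def power_divide intro: add_pos_nonneg)
      have uw: "u\<^sup>2 + w\<^sup>2 = 1" using w(2) by (simp add: u_def power_mult_distrib algebra_simps)
      have c1: "(w\<^sup>2 - u\<^sup>2)\<^sup>2 + (2 * u * w)\<^sup>2 = 1"
      proof -
        have "(w\<^sup>2 - u\<^sup>2)\<^sup>2 + (2 * u * w)\<^sup>2 = (u\<^sup>2 + w\<^sup>2)\<^sup>2" by algebra
        then show ?thesis using uw by simp
      qed
      have w1: "w\<^sup>2 \<le> 1" using uw by (smt (verit) zero_le_power2)
      have "(enorm d (\<lambda>i. x i - ((w\<^sup>2 - u\<^sup>2) * x i + 2 * u * w * v i)))\<^sup>2 = 4 * u\<^sup>2"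
        using sphere_lincomb(2)[OF x v c1] uw by simp
      also have "\<dots> \<le> \<delta>\<^sup>2"
      proof -
        have "u\<^sup>2 \<le> s\<^sup>2" using w1 mult_left_mono[OF w1, of "s\<^sup>2"] by (simp add: u_def power_mult_distrib)
        also have "\<dots> \<le> (\<delta> / 2)\<^sup>2" using s by (intro power_mono) auto
        finally show ?thesis by (simp add: power_divide)
      qed
      finally have "enorm d (\<lambda>i. x i - ((w\<^sup>2 - u\<^sup>2) * x i + 2 * u * w * v i)) \<le> \<delta>"
        using \<delta> by (simp add: power2_le_iff_abs_le)
      then have "\<bar>P (\<lambda>i. (w\<^sup>2 - u\<^sup>2) * x i + 2 * u * w * v i)\<bar> \<le> M"
        using bd[rule_format, OF sphere_lincomb(1)[OF x v c1]] by simp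
      also have "P (\<lambda>i. (w\<^sup>2 - u\<^sup>2) * x i + 2 * u * w * v i) = (\<Sum>k\<le>2 * \<rho>. a k * s ^ k) * w ^ (2 * \<rho>)"
        unfolding a[OF uw] sum_distrib_right
      proof (rule sum.cong[OF refl])
        fix k assume "k \<in> {..2 * \<rho>}"
        then have "w ^ (2 * \<rho>) = w ^ k * w ^ (2 * \<rho> - k)" by (simp flip: power_add)
        then show "a k * u ^ k * w ^ (2 * \<rho> - k) = a k * s ^ k * w ^ (2 * \<rho>)"
          by (simp add: u_def power_mult_distrib)
      qed
      finally have "\<bar>\<Sum>k\<le>2 * \<rho>. a k * s ^ k\<bar> * w ^ (2 * \<rho>) \<le> M" using w by (simp add: abs_mult)
      then have "\<bar>\<Sum>k\<le>2 * \<rho>. a k * s ^ k\<bar> * (w ^ (2 * \<rho>) * (1 + s\<^sup>2) ^ \<rho>) \<le> M * (1 + s\<^sup>2) ^ \<rho>"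
        by (subst mult.assoc[symmetric]) (intro mult_right_mono, auto)
      also have "w ^ (2 * \<rho>) * (1 + s\<^sup>2) ^ \<rho> = 1"
        unfolding power_mult power_mult_distrib[symmetric] w(2) by simp
      also have "M * (1 + s\<^sup>2) ^ \<rho> \<le> M * 2 ^ \<rho>"
      proof (intro mult_left_mono power_mono M)
        have "s\<^sup>2 \<le> 1\<^sup>2" using s \<delta> by (intro power_mono) auto
        then show "1 + s\<^sup>2 \<le> 2" by simp
      qed auto
      finally show ?thesis by simp
    qed
    have ak: "\<bar>a k\<bar> \<le> C0 * 2 ^ \<rho> * 2 ^ (2 * \<rho>) * M / \<delta> ^ (2 * \<rho>)" if k: "k \<le> 2 * \<rho>" for k
    proof -
      have "\<bar>a k\<bar> \<le> C0 * (M * 2 ^ \<rho>) / (\<delta> / 2) ^ k"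
        using \<delta> small k by (intro cb) auto
      also have "\<dots> \<le> C0 * (M * 2 ^ \<rho>) / (\<delta> / 2) ^ (2 * \<rho>)"
        using k \<delta> C0 M by (intro divide_left_mono power_decreasing) auto
      finally show ?thesis by (simp add: power_divide mult_ac)
    qed
    \<comment> \<open>For an arbitrary point the homogeneous form is evaluated directly: at the
      antipode of x the tangent is infinite, while |u| and |w| never exceed 1.\<close>
    define u w where "u = sin (t / 2)" and "w = cos (t / 2)"
    have uw: "u\<^sup>2 + w\<^sup>2 = 1" by (simp add: u_def w_def)
    have "cos t = w\<^sup>2 - u\<^sup>2" "sin t = 2 * u * w"
      using cos_double[of "t / 2"] sin_double[of "t / 2"] by (auto simp: u_def w_def)
    then have "P y = (\<Sum>k\<le>2 * \<rho>. a k * u ^ k * w ^ (2 * \<rho> - k))" using a[OF uw] yt by simp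
    also have "\<bar>\<dots>\<bar> \<le> (\<Sum>k\<le>2 * \<rho>. C0 * 2 ^ \<rho> * 2 ^ (2 * \<rho>) * M / \<delta> ^ (2 * \<rho>))"
    proof (intro order_trans[OF sum_abs] sum_mono)
      fix k assume k: "k \<in> {..2 * \<rho>}"
      have "\<bar>u ^ k\<bar> \<le> 1" "\<bar>w ^ (2 * \<rho> - k)\<bar> \<le> 1"
        unfolding power_abs by (auto simp: u_def w_def intro!: power_le_one)
      then have "\<bar>a k\<bar> * \<bar>u ^ k\<bar> * \<bar>w ^ (2 * \<rho> - k)\<bar> \<le> \<bar>a k\<bar> * 1 * 1" by (intro mult_mono) auto
      then show "\<bar>a k * u ^ k * w ^ (2 * \<rho> - k)\<bar> \<le> C0 * 2 ^ \<rho> * 2 ^ (2 * \<rho>) * M / \<delta> ^ (2 * \<rho>)"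
        using ak k by (fastforce simp: abs_mult)
    qed
    also have "\<dots> = C * M / \<delta> ^ (2 * \<rho>)" by (simp add: C_def)
    finally show ?thesis .
  qed
  ultimately show ?thesis by blast
qed

section \<open>Homogeneous extensions and local approximation\<close>

text \<open>Being a polynomial of bounded degree on every line is all that a finite difference along
  a line can see. The notion avoids multivariate expansions and carries no dependence on d.\<close>

definition line_poly :: "nat \<Rightarrow> ((nat \<Rightarrow> real) \<Rightarrow> real) \<Rightarrow> bool" where
  "line_poly N g \<longleftrightarrow> (\<forall>x z. \<exists>q :: real poly. degree q \<le> N \<and> (\<forall>t. g (\<lambda>i. x i + t * z i) = poly q t))"

lemma line_poly_mono: "line_poly N g \<Longrightarrow> N \<le> M \<Longrightarrow> line_poly M g"
  unfolding line_poly_def by (meson order_trans)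

lemma line_poly_const: "line_poly N (\<lambda>y. c)"
  unfolding line_poly_def by (auto intro!: exI[of _ "[:c:]"])

lemma line_poly_coord: "line_poly 1 (\<lambda>y. y i)"
  unfolding line_poly_def
proof (intro allI)
  fix x z :: "nat \<Rightarrow> real"
  show "\<exists>q :: real poly. degree q \<le> 1 \<and> (\<forall>t. x i + t * z i = poly q t)"
    by (rule exI[of _ "[:x i, z i:]"]) auto
qed

lemma line_poly_add: "line_poly N g \<Longrightarrow> line_poly N h \<Longrightarrow> line_poly N (\<lambda>y. g y + h y)"
  unfolding line_poly_def by (metis degree_add_le poly_add)

lemma line_poly_mult: "line_poly N g \<Longrightarrow> line_poly M h \<Longrightarrow> line_poly (N + M) (\<lambda>y. g y * h y)"
  unfolding line_poly_def by (metis add_mono degree_mult_le order_trans poly_mult)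

lemma line_poly_sum: "(\<And>j. j \<in> J \<Longrightarrow> line_poly N (g j)) \<Longrightarrow> line_poly N (\<lambda>y. \<Sum>j\<in>J. g j y)"
  by (induction J rule: infinite_finite_induct) (auto simp: line_poly_const line_poly_add)

lemma line_poly_power: "line_poly N g \<Longrightarrow> line_poly (N * k) (\<lambda>y. g y ^ k)"
proof (induction k)
  case (Suc k)
  from line_poly_mult[OF Suc.prems Suc.IH[OF Suc.prems]] show ?case by (simp add: add.commute)
qed (simp add: line_poly_const)

lemma line_poly_prod: "finite I \<Longrightarrow> (\<And>i. i \<in> I \<Longrightarrow> line_poly (N i) (g i)) \<Longrightarrow> line_poly (\<Sum>i\<in>I. N i) (\<lambda>y. \<Prod>i\<in>I. g i y)"
proof (induction I rule: finite_induct)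
  case (insert i I)
  then have "line_poly (N i + (\<Sum>i\<in>I. N i)) (\<lambda>y. g i y * (\<Prod>i\<in>I. g i y))"
    by (intro line_poly_mult) auto
  then show ?case using insert by simp
qed (simp add: line_poly_const)

lemma line_poly_poly:
  assumes "line_poly N g" shows "line_poly (N * degree q) (\<lambda>y. poly q (g y))"
  unfolding poly_altdef
proof (rule line_poly_sum)
  fix k assume k: "k \<in> {..degree q}"
  have "line_poly (0 + N * k) (\<lambda>y. coeff q k * g y ^ k)"
    by (intro line_poly_mult line_poly_power line_poly_const assms)
  then show "line_poly (N * degree q) (\<lambda>y. coeff q k * g y ^ k)"
    by (rule line_poly_mono) (use k in auto)
qed

lemma line_poly_enorm_sq: "line_poly 2 (\<lambda>y. (enorm d y)\<^sup>2)"
proof -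
  have "line_poly (1 * 2) (\<lambda>y. \<Sum>i\<le>d. (y i)\<^sup>2)"
    by (intro line_poly_sum line_poly_power line_poly_coord)
  then show ?thesis by (simp add: enorm_def sum_nonneg)
qed

lemma finite_difference_line_poly:
  assumes "line_poly N g" "N < m"
  shows "(\<Sum>i\<le>m. (-1) ^ i * real (m choose i) * g (\<lambda>l. x l + real i * z l)) = 0"
proof -
  obtain q :: "real poly" where q: "degree q \<le> N" "\<And>t. g (\<lambda>l. x l + t * z l) = poly q t"
    using assms(1) unfolding line_poly_def by meson
  have "degree q < m" using q(1) assms(2) by simp
  from finite_difference_poly[OF this] show ?thesis by (simp add: q(2))
qed

text \<open>Monomials are padded with powers of |y|^2, which is 1 on the sphere. Padding preserves
  the parity of the degree, so the even and the odd part must be homogenized separately, to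
  consecutive degrees.\<close>

lemma homogeneous_extension:
  assumes P: "P \<in> polys d r" and r: "r \<le> real \<rho>"
  obtains pe po where "line_poly (2 * \<rho>) pe" "line_poly (2 * \<rho> + 1) po"
    "\<And>t y. pe (\<lambda>i. t * y i) = t ^ (2 * \<rho>) * pe y" "\<And>t y. po (\<lambda>i. t * y i) = t ^ (2 * \<rho> + 1) * po y"
    "\<And>y. y \<in> sphere_d d \<Longrightarrow> P y = pe y + po y"
    "\<And>y y'. (\<And>i. i \<le> d \<Longrightarrow> y i = y' i) \<Longrightarrow> pe y = pe y'" "\<And>y y'. (\<And>i. i \<le> d \<Longrightarrow> y i = y' i) \<Longrightarrow> po y = po y'"
proof -
  obtain A c where A: "finite A" "\<And>\<alpha>. \<alpha> \<in> A \<Longrightarrow> (\<forall>i>d. \<alpha> i = 0) \<and> real (\<Sum>i\<le>d. \<alpha> i) < r"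
    "\<And>x. P x = (\<Sum>\<alpha>\<in>A. c \<alpha> * mono_fun d \<alpha> x)" by (rule polysE[OF P]) blast
  define D where "D \<alpha> = (\<Sum>i\<le>d. \<alpha> i)" for \<alpha> :: "nat \<Rightarrow> nat"
  have D: "D \<alpha> \<le> \<rho>" if "\<alpha> \<in> A" for \<alpha>
  proof -
    have "real (D \<alpha>) < real \<rho>" using A(2)[OF that] r unfolding D_def by linarith
    then show ?thesis by simp
  qed
  \<comment> \<open>For the index sets used below the parity of \<open>m\<close> agrees with that of
    \<open>D \<alpha>\<close>, so the halving is exact (fact \<open>ex\<close>) and every summand
    has degree exactly \<open>m\<close>.\<close>
  define p where "p m B y = (\<Sum>\<alpha>\<in>B. c \<alpha> * (mono_fun d \<alpha> y * ((enorm d y)\<^sup>2) ^ ((m - D \<alpha>) div 2)))" for m B y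
  define Ae where "Ae = {\<alpha>\<in>A. even (D \<alpha>)}"
  define Ao where "Ao = {\<alpha>\<in>A. odd (D \<alpha>)}"
  have ex: "D \<alpha> + 2 * ((m - D \<alpha>) div 2) = m" if "even (m + D \<alpha>)" "D \<alpha> \<le> m" for m \<alpha>
    using that by (metis add.commute dvd_mult_div_cancel even_add even_diff_nat le_add_diff_inverse2)
  have line: "line_poly m (p m B)" if B: "\<And>\<alpha>. \<alpha> \<in> B \<Longrightarrow> even (m + D \<alpha>) \<and> D \<alpha> \<le> m" for m B
    unfolding p_def
  proof (rule line_poly_sum)
    fix \<alpha> assume "\<alpha> \<in> B"
    then have e: "D \<alpha> + 2 * ((m - D \<alpha>) div 2) = m" using ex B by blast
    have "line_poly (\<Sum>i\<le>d. 1 * \<alpha> i) (mono_fun d \<alpha>)"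
      unfolding mono_fun_def by (intro line_poly_prod line_poly_power line_poly_coord) auto
    then have "line_poly (D \<alpha>) (mono_fun d \<alpha>)" by (simp add: D_def)
    then have "line_poly (0 + (D \<alpha> + 2 * ((m - D \<alpha>) div 2))) (\<lambda>y. c \<alpha> * (mono_fun d \<alpha> y * ((enorm d y)\<^sup>2) ^ ((m - D \<alpha>) div 2)))"
      by (intro line_poly_mult line_poly_power line_poly_const line_poly_enorm_sq)
    then show "line_poly m (\<lambda>y. c \<alpha> * (mono_fun d \<alpha> y * ((enorm d y)\<^sup>2) ^ ((m - D \<alpha>) div 2)))" by (simp only: e add_0)
  qed
  have hom: "p m B (\<lambda>i. t * y i) = t ^ m * p m B y" if B: "\<And>\<alpha>. \<alpha> \<in> B \<Longrightarrow> even (m + D \<alpha>) \<and> D \<alpha> \<le> m" for m B t y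
    unfolding p_def sum_distrib_left
  proof (rule sum.cong[OF refl])
    fix \<alpha> assume "\<alpha> \<in> B"
    then have e: "D \<alpha> + 2 * ((m - D \<alpha>) div 2) = m" using ex B by blast
    have m1: "mono_fun d \<alpha> (\<lambda>i. t * y i) = t ^ D \<alpha> * mono_fun d \<alpha> y"
      by (simp add: mono_fun_def D_def power_mult_distrib prod.distrib power_sum)
    have e1: "(enorm d (\<lambda>i. t * y i))\<^sup>2 = t\<^sup>2 * (enorm d y)\<^sup>2"
      by (simp add: enorm_scale power_mult_distrib)
    have "mono_fun d \<alpha> (\<lambda>i. t * y i) * ((enorm d (\<lambda>i. t * y i))\<^sup>2) ^ ((m - D \<alpha>) div 2)
       = (t ^ D \<alpha> * (t\<^sup>2) ^ ((m - D \<alpha>) div 2)) * (mono_fun d \<alpha> y * ((enorm d y)\<^sup>2) ^ ((m - D \<alpha>) div 2))"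
      unfolding m1 e1 power_mult_distrib[of "t\<^sup>2"] by (simp only: mult_ac)
    also have "t ^ D \<alpha> * (t\<^sup>2) ^ ((m - D \<alpha>) div 2) = t ^ m"
      unfolding power_mult[symmetric] power_add[symmetric] e ..
    finally show "c \<alpha> * (mono_fun d \<alpha> (\<lambda>i. t * y i) * ((enorm d (\<lambda>i. t * y i))\<^sup>2) ^ ((m - D \<alpha>) div 2)) =
        t ^ m * (c \<alpha> * (mono_fun d \<alpha> y * ((enorm d y)\<^sup>2) ^ ((m - D \<alpha>) div 2)))"
      by (simp only: mult.left_commute)
  qed
  have cong: "p m B y = p m B y'" if y: "\<And>i. i \<le> d \<Longrightarrow> y i = y' i" for m B y y'
  proof -
    have "mono_fun d \<alpha> y = mono_fun d \<alpha> y'" for \<alpha> unfolding mono_fun_def using y by (intro prod.cong) auto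
    moreover have "enorm d y = enorm d y'" using y by (rule enorm_cong)
    ultimately show ?thesis by (simp add: p_def)
  qed
  have Be: "even (2 * \<rho> + D \<alpha>) \<and> D \<alpha> \<le> 2 * \<rho>" if "\<alpha> \<in> Ae" for \<alpha> using that D[of \<alpha>] by (auto simp: Ae_def)
  have Bo: "even (2 * \<rho> + 1 + D \<alpha>) \<and> D \<alpha> \<le> 2 * \<rho> + 1" if "\<alpha> \<in> Ao" for \<alpha> using that D[of \<alpha>] by (auto simp: Ao_def)
  have split: "P y = p (2 * \<rho>) Ae y + p (2 * \<rho> + 1) Ao y" if "y \<in> sphere_d d" for y
  proof -
    have "A = Ae \<union> Ao" "Ae \<inter> Ao = {}" "finite Ae" "finite Ao" using A(1) by (auto simp: Ae_def Ao_def)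
    then have "(\<Sum>\<alpha>\<in>A. c \<alpha> * mono_fun d \<alpha> y) = (\<Sum>\<alpha>\<in>Ae. c \<alpha> * mono_fun d \<alpha> y) + (\<Sum>\<alpha>\<in>Ao. c \<alpha> * mono_fun d \<alpha> y)"
      by (simp add: sum.union_disjoint)
    then show ?thesis unfolding A(3) p_def by (simp add: sphere_enorm[OF that])
  qed
  show ?thesis
  proof (rule that[of "p (2 * \<rho>) Ae" "p (2 * \<rho> + 1) Ao"])
    show "line_poly (2 * \<rho>) (p (2 * \<rho>) Ae)" using Be by (rule line)
    show "line_poly (2 * \<rho> + 1) (p (2 * \<rho> + 1) Ao)" using Bo by (rule line)
    show "p (2 * \<rho>) Ae (\<lambda>i. t * y i) = t ^ (2 * \<rho>) * p (2 * \<rho>) Ae y" for t y using Be by (rule hom)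
    show "p (2 * \<rho> + 1) Ao (\<lambda>i. t * y i) = t ^ (2 * \<rho> + 1) * p (2 * \<rho> + 1) Ao y" for t y using Bo by (rule hom)
  qed (fact split cong)+
qed

text \<open>Newton's iteration \<open>t \<mapsto> (3 t - t^3) / 2\<close>, started at \<open>t = s\<close>, converges quadratically
  to \<open>1\<close> and stays odd in \<open>s\<close>.\<close>

lemma newton_odd_approx:
  "\<exists>q :: real poly. \<exists>C. \<forall>s. \<bar>1 - s\<bar> \<le> 1/2 \<longrightarrow> \<bar>1 - s * poly q (s\<^sup>2)\<bar> \<le> 1/2 \<and> \<bar>1 - s * poly q (s\<^sup>2)\<bar> \<le> C * \<bar>1 - s\<bar> ^ (2 ^ j)"
proof (induction j)
  case 0
  show ?case by (rule exI[of _ 1], rule exI[of _ 1]) simp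
next
  case (Suc j)
  then obtain q :: "real poly" and C where q: "\<And>s. \<bar>1 - s\<bar> \<le> 1/2 \<Longrightarrow> \<bar>1 - s * poly q (s\<^sup>2)\<bar> \<le> 1/2"
    "\<And>s. \<bar>1 - s\<bar> \<le> 1/2 \<Longrightarrow> \<bar>1 - s * poly q (s\<^sup>2)\<bar> \<le> C * \<bar>1 - s\<bar> ^ (2 ^ j)"
    by blast
  define q' where "q' = smult (1/2) (q * ([:3:] - [:0, 1:] * q\<^sup>2))"
  show ?case
  proof (rule exI[of _ q'], rule exI[of _ "2 * C\<^sup>2"], intro allI impI)
    fix s :: real assume s: "\<bar>1 - s\<bar> \<le> 1/2"
    define e where "e = 1 - s * poly q (s\<^sup>2)"
    \<comment> \<open>With t = 1 - e, the Newton map gives 1 - (3 t - t^3) / 2 = e^2 (3 - e) / 2, so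
      the error is squared up to a bounded factor.\<close>
    have eq: "1 - s * poly q' (s\<^sup>2) = e\<^sup>2 * ((3 - e) / 2)"
      unfolding q'_def e_def by (simp add: field_simps power2_eq_square power3_eq_cube)
    have e: "\<bar>e\<bar> \<le> 1/2" "\<bar>e\<bar> \<le> C * \<bar>1 - s\<bar> ^ (2 ^ j)" using q[OF s] by (auto simp: e_def)
    have f: "\<bar>(3 - e) / 2\<bar> \<le> 2" using e(1) by (auto simp: abs_le_iff)
    have "\<bar>e\<bar>\<^sup>2 \<le> (1/2)\<^sup>2" using e(1) by (intro power_mono) auto
    then have e4: "e\<^sup>2 \<le> 1/4" by (simp add: power_divide)
    have "\<bar>e\<^sup>2 * ((3 - e) / 2)\<bar> \<le> (1/4) * 2" unfolding abs_mult using e4 f by (intro mult_mono) auto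
    moreover have "\<bar>e\<^sup>2 * ((3 - e) / 2)\<bar> \<le> (C * \<bar>1 - s\<bar> ^ (2 ^ j))\<^sup>2 * 2"
    proof -
      have "\<bar>e\<bar>\<^sup>2 \<le> (C * \<bar>1 - s\<bar> ^ (2 ^ j))\<^sup>2" using e(2) by (intro power_mono) auto
      then show ?thesis unfolding abs_mult using f by (intro mult_mono) auto
    qed
    moreover have "(C * \<bar>1 - s\<bar> ^ (2 ^ j))\<^sup>2 * 2 = 2 * C\<^sup>2 * \<bar>1 - s\<bar> ^ (2 ^ Suc j)"
      unfolding power_mult_distrib power_mult[symmetric] by (simp only: power_Suc2 mult.commute mult.left_commute)
    ultimately show "\<bar>1 - s * poly q' (s\<^sup>2)\<bar> \<le> 1/2 \<and> \<bar>1 - s * poly q' (s\<^sup>2)\<bar> \<le> 2 * C\<^sup>2 * \<bar>1 - s\<bar> ^ (2 ^ Suc j)"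
      unfolding eq by simp
  qed
qed

text \<open>After k Newton steps the order of contact at s = 1 is \<open>2 ^ k\<close>, which is at
  least k. The polynomial \<open>q\<close>, evaluated at |y|^2, serves as a substitute for 1 / |y|
  near the sphere and lowers the radial degree of the odd part by one.\<close>

lemma odd_approx:
  obtains q :: "real poly" and C where "C > 0" "\<And>s. \<bar>1 - s\<bar> \<le> 1/2 \<Longrightarrow> \<bar>1 - s * poly q (s\<^sup>2)\<bar> \<le> C * \<bar>1 - s\<bar> ^ k"
proof -
  obtain q :: "real poly" and C where q: "\<And>s. \<bar>1 - s\<bar> \<le> 1/2 \<Longrightarrow> \<bar>1 - s * poly q (s\<^sup>2)\<bar> \<le> C * \<bar>1 - s\<bar> ^ (2 ^ k)"
    using newton_odd_approx[of k] by blast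
  have "\<bar>1 - s * poly q (s\<^sup>2)\<bar> \<le> (\<bar>C\<bar> + 1) * \<bar>1 - s\<bar> ^ k" if s: "\<bar>1 - s\<bar> \<le> 1/2" for s
  proof -
    have "\<bar>1 - s * poly q (s\<^sup>2)\<bar> \<le> C * \<bar>1 - s\<bar> ^ (2 ^ k)" using q[OF s] .
    also have "\<dots> \<le> (\<bar>C\<bar> + 1) * \<bar>1 - s\<bar> ^ k"
    proof (rule mult_mono)
      show "\<bar>1 - s\<bar> ^ (2 ^ k) \<le> \<bar>1 - s\<bar> ^ k" using s by (intro power_decreasing) auto
    qed auto
    finally show ?thesis .
  qed
  then show ?thesis by (intro that[of "\<bar>C\<bar> + 1" q]) auto
qed

section \<open>The extension to a shell and its local polynomial approximation\<close>

definition radial_proj :: "nat \<Rightarrow> (nat \<Rightarrow> real) \<Rightarrow> nat \<Rightarrow> real" where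
  "radial_proj d y = (\<lambda>i. if i \<le> d then y i / enorm d y else 0)"

lemma radial_proj_sphere: "enorm d y > 0 \<Longrightarrow> radial_proj d y \<in> sphere_d d"
proof -
  assume y: "enorm d y > 0"
  have "enorm d (radial_proj d y) = enorm d (\<lambda>i. (1 / enorm d y) * y i)"
    by (rule enorm_cong) (simp add: radial_proj_def)
  also have "\<dots> = 1" unfolding enorm_scale using y by simp
  finally show ?thesis by (simp add: sphere_d_def radial_proj_def)
qed

lemma enorm_eq_0_coord: "enorm d y = 0 \<Longrightarrow> i \<le> d \<Longrightarrow> y i = 0"
  using abs_coord_le_enorm[of i d y] by simp

lemma radial_decomposition: "\<exists>w\<in>sphere_d d. \<forall>i\<le>d. y i = enorm d y * w i"
proof (cases "enorm d y = 0")
  case True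
  then show ?thesis using unit_vector_sphere[of 0 d] enorm_eq_0_coord[of d y] by auto
next
  case False
  then have "enorm d y > 0" by (simp add: less_le)
  then show ?thesis using radial_proj_sphere[of d y] by (intro bexI[of _ "radial_proj d y"]) (auto simp: radial_proj_def)
qed

definition shell_ext :: "nat \<Rightarrow> nat \<Rightarrow> ((nat \<Rightarrow> real) \<Rightarrow> real) \<Rightarrow> (nat \<Rightarrow> real) \<Rightarrow> real" where
  "shell_ext d \<rho> f y = (if 1/2 \<le> enorm d y \<and> enorm d y \<le> 3/2 then enorm d y ^ (2 * \<rho>) * f (radial_proj d y) else 0)"

lemma shell_ext_bound:
  assumes "\<And>y. y \<in> sphere_d d \<Longrightarrow> \<bar>f y\<bar> \<le> V"
  shows "\<bar>shell_ext d \<rho> f y\<bar> \<le> (3/2) ^ (2 * \<rho>) * V"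
proof -
  have V: "V \<ge> 0" using assms[OF unit_vector_sphere[of 0 d]] by auto
  show ?thesis
  proof (cases "1/2 \<le> enorm d y \<and> enorm d y \<le> 3/2")
    case True
    then have "\<bar>f (radial_proj d y)\<bar> \<le> V" by (intro assms radial_proj_sphere) auto
    then show ?thesis using True by (auto simp: shell_ext_def abs_mult power_mult intro!: mult_mono power_mono)
  qed (use V in \<open>auto simp: shell_ext_def\<close>)
qed

text \<open>The order of quantifiers matters: \<open>m\<close> fixes the order of the difference,
  and only then is the range \<open>L\<close> of its steps known. Close to x the local hypothesis is
  applied at the radial projection. Farther away, crude bounds on both functions lose a power of
  1/\<delta>, and the term with exponent \<open>s\<close> makes up for it.\<close>

lemma shell_ext_local_approx:
  fixes r :: real and \<rho> s :: nat
  assumes r: "0 < r" "r \<le> real \<rho>"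
  shows "\<exists>m. \<forall>L\<ge>0. \<exists>C>0. \<forall>d f V \<delta> x P. d \<ge> 1 \<longrightarrow> 0 < \<delta> \<longrightarrow> \<delta> \<le> 1 \<longrightarrow> x \<in> sphere_d d \<longrightarrow>
     (\<forall>y\<in>sphere_d d. \<bar>f y\<bar> \<le> V) \<longrightarrow> P \<in> polys d r \<longrightarrow>
     (\<forall>y\<in>sphere_d d. enorm d (\<lambda>i. x i - y i) \<le> \<delta> \<longrightarrow> \<bar>f y - P y\<bar> \<le> V * enorm d (\<lambda>i. x i - y i) powr r) \<longrightarrow>
     (\<exists>G. line_poly m G \<and> (\<forall>y. enorm d (\<lambda>i. x i - y i) \<le> L \<longrightarrow>
        \<bar>shell_ext d \<rho> f y - G y\<bar> \<le> C * V * (enorm d (\<lambda>i. x i - y i) powr r + enorm d (\<lambda>i. x i - y i) ^ s / \<delta> ^ (2 * \<rho> + s))))"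
proof -
  obtain q :: "real poly" and Cq where Cq: "Cq > 0" and q: "\<And>t. \<bar>1 - t\<bar> \<le> 1/2 \<Longrightarrow> \<bar>1 - t * poly q (t\<^sup>2)\<bar> \<le> Cq * \<bar>1 - t\<bar> ^ s"
    by (rule odd_approx[of s]) blast
  obtain C1 where C1: "C1 > 0" and growth: "\<And>d r P x \<delta> M y. d \<ge> 1 \<Longrightarrow> r \<le> real \<rho> \<Longrightarrow> P \<in> polys d r \<Longrightarrow> x \<in> sphere_d d \<Longrightarrow> 0 < \<delta> \<Longrightarrow> \<delta> \<le> 1 \<Longrightarrow>
     (\<forall>y\<in>sphere_d d. enorm d (\<lambda>i. x i - y i) \<le> \<delta> \<longrightarrow> \<bar>P y\<bar> \<le> M) \<Longrightarrow> y \<in> sphere_d d \<Longrightarrow> \<bar>P y\<bar> \<le> C1 * M / \<delta> ^ (2 * \<rho>)"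
    using polys_cap_growth[of \<rho>] by blast
  define m where "m = 2 * \<rho> + 1 + 2 * degree q"
  show ?thesis
  proof (intro exI[of _ m] allI impI)
    fix L :: real assume L: "L \<ge> 0"
    have "bounded (poly q ` {0..(1 + L)\<^sup>2})"
      by (intro compact_imp_bounded compact_continuous_image continuous_intros) auto
    then obtain Q where Q0: "\<And>t. t \<in> {0..(1 + L)\<^sup>2} \<Longrightarrow> \<bar>poly q t\<bar> \<le> Q" unfolding bounded_iff real_norm_def by blast
    have "\<bar>poly q 0\<bar> \<le> Q" by (rule Q0) simp
    then have Q: "Q \<ge> 0" by linarith
    define E where "E = (1 + L) ^ (2 * \<rho>) + (1 + L) ^ (2 * \<rho> + 1) * Q"
    have E: "E \<ge> 0" using L Q by (simp add: E_def)
    define Ca where "Ca = (3/2) ^ (2 * \<rho>) * (2 powr r + 2 * C1 * Cq)"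
    define Cb where "Cb = ((3/2) ^ (2 * \<rho>) + E * (2 * C1)) * 2 ^ s"
    have Ca: "Ca \<ge> 0" and Cb: "Cb \<ge> 0" using C1 Cq E by (auto simp: Ca_def Cb_def)
    define C where "C = Ca + Cb + 1"
    have C: "C > 0" "Ca \<le> C" "Cb \<le> C" using Ca Cb by (auto simp: C_def)
    show "\<exists>C>0. \<forall>d f V \<delta> x P. d \<ge> 1 \<longrightarrow> 0 < \<delta> \<longrightarrow> \<delta> \<le> 1 \<longrightarrow> x \<in> sphere_d d \<longrightarrow>
     (\<forall>y\<in>sphere_d d. \<bar>f y\<bar> \<le> V) \<longrightarrow> P \<in> polys d r \<longrightarrow>
     (\<forall>y\<in>sphere_d d. enorm d (\<lambda>i. x i - y i) \<le> \<delta> \<longrightarrow> \<bar>f y - P y\<bar> \<le> V * enorm d (\<lambda>i. x i - y i) powr r) \<longrightarrow>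
     (\<exists>G. line_poly m G \<and> (\<forall>y. enorm d (\<lambda>i. x i - y i) \<le> L \<longrightarrow>
        \<bar>shell_ext d \<rho> f y - G y\<bar> \<le> C * V * (enorm d (\<lambda>i. x i - y i) powr r + enorm d (\<lambda>i. x i - y i) ^ s / \<delta> ^ (2 * \<rho> + s))))"
    proof (intro exI[of _ C] conjI C(1) allI impI)
      fix d :: nat and f :: "(nat \<Rightarrow> real) \<Rightarrow> real" and V \<delta> :: real and x P
      assume d: "d \<ge> 1" and \<delta>: "0 < \<delta>" "\<delta> \<le> 1" and x: "x \<in> sphere_d d" and fV: "\<forall>y\<in>sphere_d d. \<bar>f y\<bar> \<le> V"
        and P: "P \<in> polys d r"
        and loc: "\<forall>y\<in>sphere_d d. enorm d (\<lambda>i. x i - y i) \<le> \<delta> \<longrightarrow> \<bar>f y - P y\<bar> \<le> V * enorm d (\<lambda>i. x i - y i) powr r"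
      have "\<bar>f x\<bar> \<le> V" using fV x by blast
      then have V: "V \<ge> 0" by linarith
      define B where "B = 2 * C1 * V / \<delta> ^ (2 * \<rho>)"
      have B: "B \<ge> 0" using C1 V \<delta> by (simp add: B_def)
      \<comment> \<open>Since \<delta> \<le> 1, the approximation error on the cap is at most V,
        hence |P| \<le> 2 V there; \<open>polys_cap_growth\<close> extends this to the whole
        sphere.\<close>
      have PB: "\<bar>P y\<bar> \<le> B" if y: "y \<in> sphere_d d" for y
      proof -
        have "\<bar>P y\<bar> \<le> C1 * (2 * V) / \<delta> ^ (2 * \<rho>)"
        proof (rule growth[OF d r(2) P x \<delta> _ y], intro ballI impI)
          fix y assume y: "y \<in> sphere_d d" and c: "enorm d (\<lambda>i. x i - y i) \<le> \<delta>"
          have "enorm d (\<lambda>i. x i - y i) powr r \<le> 1 powr r"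
            using c \<delta> r by (intro powr_mono2) auto
          then have "V * enorm d (\<lambda>i. x i - y i) powr r \<le> V * 1" using V by (intro mult_left_mono) auto
          then have "\<bar>f y - P y\<bar> \<le> V" using loc y c by fastforce
          moreover have "\<bar>f y\<bar> \<le> V" using fV y by blast
          ultimately show "\<bar>P y\<bar> \<le> 2 * V" by linarith
        qed
        then show ?thesis by (simp add: B_def mult_ac)
      qed
      obtain pe po where line: "line_poly (2 * \<rho>) pe" "line_poly (2 * \<rho> + 1) po"
        and hom: "\<And>t y. pe (\<lambda>i. t * y i) = t ^ (2 * \<rho>) * pe y" "\<And>t y. po (\<lambda>i. t * y i) = t ^ (2 * \<rho> + 1) * po y"
        and Psum: "\<And>y. y \<in> sphere_d d \<Longrightarrow> P y = pe y + po y"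
        and cong: "\<And>y y'. (\<And>i. i \<le> d \<Longrightarrow> y i = y' i) \<Longrightarrow> pe y = pe y'" "\<And>y y'. (\<And>i. i \<le> d \<Longrightarrow> y i = y' i) \<Longrightarrow> po y = po y'"
        by (rule homogeneous_extension[OF P r(2)]) blast
      \<comment> \<open>The two parts are half the sum and half the difference of the values of P at
        y and at its antipode, so they inherit the bound of P.\<close>
      have parts: "\<bar>pe y\<bar> \<le> B" "\<bar>po y\<bar> \<le> B" if y: "y \<in> sphere_d d" for y
      proof -
        have my: "(\<lambda>i. (-1) * y i) \<in> sphere_d d" using y enorm_scale[of d "-1" y] by (simp add: sphere_d_def)
        have "P (\<lambda>i. (-1) * y i) = pe y - po y" unfolding Psum[OF my] hom by simp
        moreover have "P y = pe y + po y" by (rule Psum[OF y])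
        ultimately show "\<bar>pe y\<bar> \<le> B" "\<bar>po y\<bar> \<le> B" using PB[OF y] PB[OF my] by linarith+
      qed
      \<comment> \<open>Along the ray through w the target is
        \<open>R ^ (2 * \<rho>) * (pe w + po w)\<close>. The factor with \<open>q\<close> cancels
        the surplus R of the odd part near R = 1, to order \<open>s\<close>.\<close>
      define G where "G y = pe y + po y * poly q ((enorm d y)\<^sup>2)" for y
      have "line_poly m G"
      proof -
        have "line_poly (2 * \<rho> + 1 + 2 * degree q) (\<lambda>y. po y * poly q ((enorm d y)\<^sup>2))"
          by (intro line_poly_mult line_poly_poly line_poly_enorm_sq line)
        moreover have "line_poly (2 * \<rho> + 1 + 2 * degree q) pe" using line(1) by (rule line_poly_mono) simp
        ultimately show ?thesis unfolding G_def m_def by (intro line_poly_add)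
      qed
      moreover have "\<bar>shell_ext d \<rho> f y - G y\<bar> \<le> C * V * (enorm d (\<lambda>i. x i - y i) powr r + enorm d (\<lambda>i. x i - y i) ^ s / \<delta> ^ (2 * \<rho> + s))"
        if yL: "enorm d (\<lambda>i. x i - y i) \<le> L" for y
      proof -
        define a where "a = enorm d (\<lambda>i. x i - y i)"
        define R where "R = enorm d y"
        have a: "a \<ge> 0" and R: "R \<ge> 0" by (auto simp: a_def R_def)
        have Ra: "\<bar>1 - R\<bar> \<le> a"
          using enorm_add_le[of d "\<lambda>i. x i - y i" y] enorm_add_le[of d "\<lambda>i. y i - x i" x] sphere_enorm[OF x]
          by (simp add: a_def R_def enorm_minus_commute[of d y x] abs_le_iff)
        obtain w where w: "w \<in> sphere_d d" "\<And>i. i \<le> d \<Longrightarrow> y i = R * w i"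
          using radial_decomposition[of d y] unfolding R_def by blast
        have pey: "pe y = R ^ (2 * \<rho>) * pe w" using cong(1)[of y "\<lambda>i. R * w i"] w(2) hom(1)[of R w] by simp
        have poy: "po y = R ^ (2 * \<rho> + 1) * po w" using cong(2)[of y "\<lambda>i. R * w i"] w(2) hom(2)[of R w] by simp
        show ?thesis
        proof (cases "a \<le> \<delta> / 2")
          case True
          then have R12: "\<bar>1 - R\<bar> \<le> 1/2" using Ra \<delta> by linarith
          then have Rr: "1/2 \<le> R" "R \<le> 3/2" by linarith+
          have pw: "radial_proj d y = w"
            using w Rr by (auto simp: radial_proj_def fun_eq_iff sphere_d_def simp flip: R_def)
          have "enorm d (\<lambda>i. y i - w i) = enorm d (\<lambda>i. (R - 1) * w i)"
            using w(2) by (intro enorm_cong) (simp add: algebra_simps)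
          then have "enorm d (\<lambda>i. y i - w i) = \<bar>R - 1\<bar>" using w(1) by (simp add: enorm_scale sphere_enorm)
          \<comment> \<open>This is the reason for the threshold \<delta>/2 in the case distinction:
            w then lies in the cap around x.\<close>
          then have xw: "enorm d (\<lambda>i. x i - w i) \<le> 2 * a"
            using enorm_diff_le[of d x w y] Ra by (simp add: a_def)
          then have "\<bar>f w - P w\<bar> \<le> V * enorm d (\<lambda>i. x i - w i) powr r"
            using loc w(1) True by auto
          also have "\<dots> \<le> V * (2 * a) powr r" using xw r V by (intro mult_left_mono powr_mono2) auto
          finally have fP: "\<bar>f w - P w\<bar> \<le> V * (2 powr r * a powr r)" using a by (simp add: powr_mult)
          have "\<bar>po w * (1 - R * poly q (R\<^sup>2))\<bar> \<le> B * (Cq * a ^ s)"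
          proof -
            have "\<bar>1 - R * poly q (R\<^sup>2)\<bar> \<le> Cq * \<bar>1 - R\<bar> ^ s" by (rule q[OF R12])
            also have "\<dots> \<le> Cq * a ^ s" using Cq Ra by (intro mult_left_mono power_mono) auto
            finally show ?thesis unfolding abs_mult using parts(2)[OF w(1)] B by (intro mult_mono) auto
          qed
          also have "B * (Cq * a ^ s) \<le> V * (2 * C1 * Cq * (a ^ s / \<delta> ^ (2 * \<rho> + s)))"
          proof -
            have "\<delta> ^ (2 * \<rho> + s) \<le> \<delta> ^ (2 * \<rho>)" using \<delta> by (intro power_decreasing) auto
            then have "a ^ s / \<delta> ^ (2 * \<rho>) \<le> a ^ s / \<delta> ^ (2 * \<rho> + s)" using \<delta> a by (intro divide_left_mono) auto
            then have "V * (2 * C1 * Cq) * (a ^ s / \<delta> ^ (2 * \<rho>)) \<le> V * (2 * C1 * Cq) * (a ^ s / \<delta> ^ (2 * \<rho> + s))"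
              using V C1 Cq by (intro mult_left_mono) auto
            then show ?thesis by (simp add: B_def mult_ac)
          qed
          finally have poE: "\<bar>po w * (1 - R * poly q (R\<^sup>2))\<bar> \<le> V * (2 * C1 * Cq * (a ^ s / \<delta> ^ (2 * \<rho> + s)))" .
          have as: "0 \<le> a ^ s / \<delta> ^ (2 * \<rho> + s)" using a \<delta> by simp
          have "shell_ext d \<rho> f y - G y = R ^ (2 * \<rho>) * ((f w - P w) + po w * (1 - R * poly q (R\<^sup>2)))"
            using Rr unfolding shell_ext_def G_def pw pey poy R_def[symmetric] Psum[OF w(1)]
            by (simp add: algebra_simps)
          then have "\<bar>shell_ext d \<rho> f y - G y\<bar> = R ^ (2 * \<rho>) * \<bar>(f w - P w) + po w * (1 - R * poly q (R\<^sup>2))\<bar>"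
            using R by (simp add: abs_mult)
          also have "\<dots> \<le> (3/2) ^ (2 * \<rho>) * (V * (2 powr r * a powr r) + V * (2 * C1 * Cq * (a ^ s / \<delta> ^ (2 * \<rho> + s))))"
            using Rr fP poE by (intro mult_mono power_mono) (linarith | simp)+
          also have "\<dots> = (3/2) ^ (2 * \<rho>) * (V * (2 powr r * a powr r + 2 * C1 * Cq * (a ^ s / \<delta> ^ (2 * \<rho> + s))))"
            by (simp only: distrib_left)
          also have "\<dots> \<le> (3/2) ^ (2 * \<rho>) * (V * ((2 powr r + 2 * C1 * Cq) * (a powr r + a ^ s / \<delta> ^ (2 * \<rho> + s))))"
          proof (intro mult_left_mono V)
            have "p * b + c * e \<le> (p + c) * (b + e)" if "0 \<le> p" "0 \<le> c" "0 \<le> b" "0 \<le> e" for p b c e :: real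
              using that by (simp add: algebra_simps)
            note gen = this
            show "2 powr r * a powr r + 2 * C1 * Cq * (a ^ s / \<delta> ^ (2 * \<rho> + s)) \<le> (2 powr r + 2 * C1 * Cq) * (a powr r + a ^ s / \<delta> ^ (2 * \<rho> + s))"
              by (rule gen) (use as C1 Cq in auto)
          qed auto
          also have "\<dots> = Ca * V * (a powr r + a ^ s / \<delta> ^ (2 * \<rho> + s))" 
          proof -
            have "p * (V * (b * c)) = p * b * V * c" for p b c :: real by simp
            then show ?thesis unfolding Ca_def by blast
          qed
          also have "\<dots> \<le> C * V * (a powr r + a ^ s / \<delta> ^ (2 * \<rho> + s))"
            using C V as by (intro mult_right_mono) auto
          finally show ?thesis by (simp only: a_def)
        next
          case False
          have R1: "R \<le> 1 + L" using Ra yL by (simp add: a_def)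
          then have "R\<^sup>2 \<in> {0..(1 + L)\<^sup>2}" using R by (auto intro: power_mono)
          then have Qb: "\<bar>poly q (R\<^sup>2)\<bar> \<le> Q" by (rule Q0)
          \<comment> \<open>Away from x the quantity 2 a / \<delta> exceeds 1, so its s-th power may
            be inserted into the crude bound, which gives it the form of a moment of order
            \<open>s\<close>.\<close>
          have one: "1 \<le> 2 ^ s * (a ^ s / \<delta> ^ s)"
          proof -
            have "1 \<le> 2 * a / \<delta>" using False \<delta> by (simp add: field_simps)
            then have "1 \<le> (2 * a / \<delta>) ^ s" by (rule one_le_power)
            then show ?thesis by (simp add: power_mult_distrib power_divide)
          qed
          have "\<bar>pe y\<bar> \<le> (1 + L) ^ (2 * \<rho>) * B"
            unfolding pey abs_mult using R R1 parts(1)[OF w(1)] L by (intro mult_mono) (auto simp: power_abs intro: power_mono)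
          moreover have "\<bar>po y * poly q (R\<^sup>2)\<bar> \<le> (1 + L) ^ (2 * \<rho> + 1) * B * Q"
            unfolding poy abs_mult using R R1 parts(2)[OF w(1)] L Qb B
            by (intro mult_mono) (auto simp: power_abs simp del: power_Suc intro: power_mono)
          ultimately have "\<bar>G y\<bar> \<le> E * B" unfolding G_def R_def[symmetric] E_def distrib_right
            by (smt (verit) mult.assoc mult.commute)
          moreover have "\<bar>shell_ext d \<rho> f y\<bar> \<le> (3/2) ^ (2 * \<rho>) * V" using fV by (intro shell_ext_bound) auto
          moreover have "(3/2) ^ (2 * \<rho>) * V \<le> (3/2) ^ (2 * \<rho>) * (V / \<delta> ^ (2 * \<rho>))"
          proof -
            have "\<delta> ^ (2 * \<rho>) \<le> 1" using \<delta> by (intro power_le_one) auto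
            then have "V \<le> V / \<delta> ^ (2 * \<rho>)" using V \<delta> by (simp add: field_simps mult_left_le)
            then show ?thesis by (intro mult_left_mono) auto
          qed
          moreover have "E * B = E * (2 * C1) * (V / \<delta> ^ (2 * \<rho>))" by (simp add: B_def)
          ultimately have "\<bar>shell_ext d \<rho> f y - G y\<bar> \<le> ((3/2) ^ (2 * \<rho>) + E * (2 * C1)) * (V / \<delta> ^ (2 * \<rho>)) * 1"
            unfolding distrib_right by linarith
          also have "\<dots> \<le> ((3/2) ^ (2 * \<rho>) + E * (2 * C1)) * (V / \<delta> ^ (2 * \<rho>)) * (2 ^ s * (a ^ s / \<delta> ^ s))"
            using E C1 V \<delta> one by (intro mult_left_mono mult_nonneg_nonneg add_nonneg_nonneg) auto
          also have "\<dots> = Cb * V * (a ^ s / \<delta> ^ (2 * \<rho> + s))"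
            by (simp add: Cb_def power_add)
          also have "\<dots> \<le> C * V * (a powr r + a ^ s / \<delta> ^ (2 * \<rho> + s))"
            using C Cb V a \<delta> by (intro mult_mono) auto
          finally show ?thesis by (simp only: a_def)
        qed
      qed
      ultimately show "\<exists>G. line_poly m G \<and> (\<forall>y. enorm d (\<lambda>i. x i - y i) \<le> L \<longrightarrow>
        \<bar>shell_ext d \<rho> f y - G y\<bar> \<le> C * V * (enorm d (\<lambda>i. x i - y i) powr r + enorm d (\<lambda>i. x i - y i) ^ s / \<delta> ^ (2 * \<rho> + s)))"
        by blast
    qed
  qed
qed

section \<open>Approximation on the sphere\<close>

lemma continuous_on_enorm [continuous_intros]:
  assumes "continuous_on S g" shows "continuous_on S (\<lambda>x. enorm d (g x))"
  unfolding enorm_def using continuous_on_product_then_coordinatewise[OF assms]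
  by (intro continuous_intros)

lemma continuous_on_polys: "P \<in> polys d m \<Longrightarrow> continuous_on S P"
proof (elim polysE)
  fix A c assume P: "\<And>x. P x = (\<Sum>\<alpha>\<in>A. c \<alpha> * mono_fun d \<alpha> x)"
  have "continuous_on S (\<lambda>x. \<Sum>\<alpha>\<in>A. c \<alpha> * mono_fun d \<alpha> x)"
    unfolding mono_fun_def
    by (intro continuous_intros continuous_on_product_then_coordinatewise[OF continuous_on_id])
  moreover have "P = (\<lambda>x. \<Sum>\<alpha>\<in>A. c \<alpha> * mono_fun d \<alpha> x)" using P by blast
  ultimately show "continuous_on S P" by (simp only:)
qed

lemma cont_sphere_continuous_on:
  assumes "cont_sphere d f" shows "continuous_on (sphere_d d) f"
  unfolding continuous_on_def
proof (intro ballI tendstoI)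
  fix x and e :: real assume x: "x \<in> sphere_d d" and e: "e > 0"
  obtain \<eta> where \<eta>: "\<eta> > 0" "\<And>y. y \<in> sphere_d d \<Longrightarrow> enorm d (\<lambda>i. x i - y i) < \<eta> \<Longrightarrow> \<bar>f y - f x\<bar> < e"
    using assms x e unfolding cont_sphere_def fun_diff_def by blast
  have "continuous_on UNIV (\<lambda>y. enorm d (\<lambda>i. x i - y i))"
    by (intro continuous_intros continuous_on_coordinatewise_then_product continuous_on_product_then_coordinatewise[OF continuous_on_id])
  then have "((\<lambda>y. enorm d (\<lambda>i. x i - y i)) \<longlongrightarrow> enorm d (\<lambda>i. x i - x i)) (at x within sphere_d d)"
    by (meson UNIV_I continuous_on_def tendsto_within_subset subset_UNIV)
  moreover have "enorm d (\<lambda>i. x i - x i) < \<eta>" using \<eta>(1) by (simp add: enorm_def)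
  ultimately have "\<forall>\<^sub>F y in at x within sphere_d d. enorm d (\<lambda>i. x i - y i) < \<eta>" by (rule order_tendstoD)
  moreover have "\<forall>\<^sub>F y in at x within sphere_d d. y \<in> sphere_d d" by (simp add: eventually_at_filter)
  ultimately show "\<forall>\<^sub>F y in at x within sphere_d d. dist (f y) (f x) < e"
    by eventually_elim (simp add: dist_real_def \<eta>(2))
qed

lemma closed_coord_zero: "closed {x :: nat \<Rightarrow> real. \<forall>i>d. x i = 0}"
proof -
  have "{x :: nat \<Rightarrow> real. \<forall>i>d. x i = 0} = (\<Inter>i\<in>{d<..}. {x. x i = 0})" by auto
  also have "closed \<dots>"
    by (intro closed_INT ballI closed_Collect_eq continuous_on_product_then_coordinatewise[OF continuous_on_id] continuous_on_const)
  finally show ?thesis .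
qed

text \<open>The ambient type \<open>nat \<Rightarrow> real\<close> is an infinite product, so
  compactness comes from Tychonoff's theorem for the cube with sides [-1, 1], of which the sphere is
  a closed subset.\<close>

lemma compact_sphere_d: "compact (sphere_d d)"
proof -
  have "compactin (product_topology (\<lambda>_::nat. euclidean) UNIV) (PiE UNIV (\<lambda>_. {-1..1::real}))"
    unfolding compactin_PiE by simp
  then have c: "compact (PiE UNIV (\<lambda>_::nat. {-1..1::real}))" by (simp add: euclidean_product_topology)
  have "sphere_d d = {x. \<forall>i>d. x i = 0} \<inter> {x. enorm d x = 1}" by (auto simp: sphere_d_def)
  moreover have "closed {x. enorm d x = 1}"
    by (intro closed_Collect_eq continuous_intros continuous_on_id)
  ultimately have "closed (sphere_d d)" using closed_coord_zero by (simp add: closed_Int)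
  then have "compact (PiE UNIV (\<lambda>_::nat. {-1..1::real}) \<inter> sphere_d d)" using c by (rule compact_Int_closed[rotated])
  moreover have "sphere_d d \<subseteq> PiE UNIV (\<lambda>_::nat. {-1..1::real})"
  proof
    fix x assume x: "x \<in> sphere_d d"
    have "\<bar>x i\<bar> \<le> 1" for i
      using abs_coord_le_enorm[of i d x] x by (cases "i \<le> d") (auto simp: sphere_d_def)
    then show "x \<in> PiE UNIV (\<lambda>_::nat. {-1..1::real})" by (auto simp: PiE_iff abs_le_iff minus_le_iff)
  qed
  ultimately show ?thesis by (simp add: Int_absorb1)
qed

lemma abs_le_sup_norm:
  assumes "continuous_on (sphere_d d) g" "x \<in> sphere_d d"
  shows "\<bar>g x\<bar> \<le> sup_norm d g"
proof -
  have "compact ((\<lambda>x. \<bar>g x\<bar>) ` sphere_d d)"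
    using assms(1) compact_sphere_d by (intro compact_continuous_image continuous_intros)
  then have "bdd_above ((\<lambda>x. \<bar>g x\<bar>) ` sphere_d d)" by (intro bounded_imp_bdd_above compact_imp_bounded)
  then show ?thesis unfolding sup_norm_def using assms(2) by (intro cSUP_upper)
qed

lemma sup_norm_nonneg: "continuous_on (sphere_d d) g \<Longrightarrow> 0 \<le> sup_norm d g"
  using abs_le_sup_norm[OF _ unit_vector_sphere[of 0 d], of g] by (meson abs_ge_zero le0 order_trans)

lemma shell_ext_cong:
  assumes "\<And>i. i \<le> d \<Longrightarrow> y i = y' i" shows "shell_ext d \<rho> f y = shell_ext d \<rho> f y'"
proof -
  have "enorm d y = enorm d y'" using assms by (rule enorm_cong)
  moreover from this have "radial_proj d y = radial_proj d y'" using assms by (auto simp: radial_proj_def)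
  ultimately show ?thesis by (simp add: shell_ext_def)
qed

lemma measurable_shell_ext:
  assumes "continuous_on (sphere_d d) f"
  shows "shell_ext d \<rho> f \<in> borel_measurable (leb d)"
proof -
  define S where "S = {y :: nat \<Rightarrow> real. 1/2 \<le> enorm d y \<and> enorm d y \<le> 3/2}"
  have "S = {y. 1/2 \<le> enorm d y} \<inter> {y. enorm d y \<le> 3/2}" by (auto simp: S_def)
  moreover have "closed {y. 1/2 \<le> enorm d y}" "closed {y. enorm d y \<le> 3/2}"
    by (intro closed_Collect_le continuous_intros continuous_on_id)+
  ultimately have S: "S \<in> sets borel" by (simp add: closed_Int borel_closed)
  have cp: "continuous_on S (radial_proj d)"
  proof (rule continuous_on_coordinatewise_then_product)
    fix i
    show "continuous_on S (\<lambda>y. radial_proj d y i)"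
    proof (cases "i \<le> d")
      case True
      then have "(\<lambda>y. radial_proj d y i) = (\<lambda>y. y i / enorm d y)" by (simp add: radial_proj_def)
      moreover have "continuous_on S (\<lambda>y. y i / enorm d y)"
        by (intro continuous_intros continuous_on_id continuous_on_product_then_coordinatewise[OF continuous_on_id])
          (auto simp: S_def)
      ultimately show ?thesis by (simp only:)
    qed (simp add: radial_proj_def)
  qed
  have "radial_proj d ` S \<subseteq> sphere_d d" using radial_proj_sphere[of d] by (force simp: S_def)
  then have "continuous_on S (\<lambda>y. f (radial_proj d y))"
    using continuous_on_compose2[OF assms cp] by blast
  then have "continuous_on S (\<lambda>y. enorm d y ^ (2 * \<rho>) * f (radial_proj d y))"
    by (intro continuous_intros continuous_on_id)
  from borel_measurable_continuous_on_indicator[OF S this]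
  have "(\<lambda>y. indicator S y *\<^sub>R (enorm d y ^ (2 * \<rho>) * f (radial_proj d y))) \<in> borel_measurable borel" .
  also have "(\<lambda>y. indicator S y *\<^sub>R (enorm d y ^ (2 * \<rho>) * f (radial_proj d y))) = shell_ext d \<rho> f"
    by (auto simp: fun_eq_iff shell_ext_def S_def indicator_def)
  finally have F: "shell_ext d \<rho> f \<in> borel_measurable borel" .
  \<comment> \<open>Borel measurability was obtained on all of
    \<open>nat \<Rightarrow> real\<close>, while \<open>leb d\<close> lives on functions that are
    \<open>undefined\<close> beyond d. Setting those coordinates to 0 is a measurable passage
    between the two and does not change \<open>shell_ext\<close>.\<close>
  define T where "T y i = (if i \<le> d then y i else 0)" for y :: "nat \<Rightarrow> real" and i
  have "T \<in> measurable (leb d) (PiM UNIV (\<lambda>_. borel))"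
    unfolding T_def[abs_def]
  proof (rule measurable_PiM_single')
    fix i :: nat
    show "(\<lambda>y. if i \<le> d then y i else 0) \<in> borel_measurable (leb d)"
      using measurable_coord[of i d] by (cases "i \<le> d") auto
  qed auto
  then have "T \<in> measurable (leb d) borel"
    using measurable_cong_sets[OF refl sets_PiM_equal_borel] by blast
  then have "(\<lambda>y. shell_ext d \<rho> f (T y)) \<in> borel_measurable (leb d)" using F by (rule measurable_compose)
  moreover have "shell_ext d \<rho> f (T y) = shell_ext d \<rho> f y" for y by (rule shell_ext_cong) (simp add: T_def)
  ultimately show ?thesis by simp
qed

lemma shell_ext_on_sphere: "x \<in> sphere_d d \<Longrightarrow> shell_ext d \<rho> f x = f x"
  using sphere_enorm[of x d] by (auto simp: shell_ext_def radial_proj_def sphere_d_def intro!: arg_cong[of _ _ f])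

text \<open>The variable u = |z|^2 / 9 maps the ball of radius 3 to [0, 1], so the Fejer width 1 / k
  becomes h = 3 / k. Raising to the power \<open>e\<close> turns the decay 1 / (k^2 u) into (h /
  |z|)^(2 e), the form required by \<open>kernel_moment\<close>.\<close>

lemma localized_kernel:
  fixes d s j :: nat
  defines "e \<equiv> Suc d + s" and "h \<equiv> 3 / (2 * real j + 1)"
  obtains q :: "real poly" and \<phi> where "degree q \<le> 2 * j * e"
    "\<And>z. \<phi> z = (if enorm d z \<le> 3 then poly q ((enorm d z)\<^sup>2 / 9) else 0)"
    "cutoff d 3 \<phi>" "\<And>z. 0 \<le> \<phi> z" "(\<integral>z. \<phi> z \<partial>leb d) > 0"
    "(\<integral>z. \<phi> z * enorm d z ^ s \<partial>leb d) \<le> (16 ^ s + 2) * h ^ s * (\<integral>z. \<phi> z \<partial>leb d)"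
proof -
  define k where "k = 2 * real j + 1"
  have k: "k \<ge> 1" and h: "h = 3 / k" by (auto simp: k_def h_def)
  obtain A :: "real poly" where A: "degree A \<le> 2 * j" "\<And>u. 0 \<le> poly A u"
    "\<And>u. 0 \<le> u \<Longrightarrow> u \<le> 1 \<Longrightarrow> poly A u * (k\<^sup>2 * u) \<le> 1"
    "\<And>u. 0 \<le> u \<Longrightarrow> u \<le> 1 / (2 * k)\<^sup>2 \<Longrightarrow> 1/4 \<le> poly A u"
    unfolding k_def by (rule fejer_type_poly[of j]) blast
  define q where "q = A ^ e"
  define \<phi> where "\<phi> z = (if enorm d z \<le> 3 then poly q ((enorm d z)\<^sup>2 / 9) else 0)" for z
  have "bounded (poly A ` {0..1})"
    by (intro compact_imp_bounded compact_continuous_image continuous_intros) auto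
  then obtain M where M: "\<And>u. u \<in> {0..1} \<Longrightarrow> \<bar>poly A u\<bar> \<le> M" unfolding bounded_iff real_norm_def by blast
  have u01: "(enorm d z)\<^sup>2 / 9 \<in> {0..1}" if "enorm d z \<le> 3" for z
    using power_mono[OF that, of 2] by simp
  have nonneg: "0 \<le> \<phi> z" for z using A(2) by (simp add: \<phi>_def q_def)
  have bdd: "\<phi> z \<le> \<bar>M\<bar> ^ e" for z
  proof (cases "enorm d z \<le> 3")
    case True
    have "poly A ((enorm d z)\<^sup>2 / 9) \<le> \<bar>M\<bar>" using M[OF u01[OF True]] by linarith
    then show ?thesis using True A(2) by (simp add: \<phi>_def q_def power_mono)
  qed (simp add: \<phi>_def)
  have meas: "\<phi> \<in> borel_measurable (leb d)"
  proof -
    have "(\<lambda>z. poly q ((enorm d z)\<^sup>2 / 9)) \<in> borel_measurable (leb d)"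
      by (rule measurable_compose[OF _ borel_measurable_continuous_onI[of "poly q"]]) (auto intro: continuous_intros)
    then show ?thesis unfolding \<phi>_def[abs_def] by (intro measurable_If) auto
  qed
  have supp: "\<phi> z = 0" if "3 < enorm d z" for z using that by (simp add: \<phi>_def)
  have low: "(1/4) ^ e \<le> \<phi> z" if z: "enorm d z \<le> h / 2" for z
  proof -
    have "h \<le> 3" using k by (simp add: h field_simps)
    then have z3: "enorm d z \<le> 3" using z enorm_nonneg[of d z] by linarith
    have "(enorm d z)\<^sup>2 \<le> (h / 2)\<^sup>2" using z by (intro power_mono) auto
    also have "\<dots> = 9 * (1 / (2 * k)\<^sup>2)" by (simp add: h power_divide power_mult_distrib)
    finally have "1/4 \<le> poly A ((enorm d z)\<^sup>2 / 9)" by (intro A(4)) auto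
    then show ?thesis using z3 by (auto simp: \<phi>_def q_def intro: power_mono)
  qed
  have up: "\<phi> z * enorm d z ^ (2 * e) \<le> h ^ (2 * e)" for z
  proof (cases "enorm d z \<le> 3")
    case True
    have "poly A ((enorm d z)\<^sup>2 / 9) * (k\<^sup>2 * ((enorm d z)\<^sup>2 / 9)) \<le> 1" using u01[OF True] by (intro A(3)) auto
    then have "poly A ((enorm d z)\<^sup>2 / 9) * (enorm d z)\<^sup>2 \<le> h\<^sup>2"
      using k by (simp add: h power_divide field_simps)
    then have "(poly A ((enorm d z)\<^sup>2 / 9) * (enorm d z)\<^sup>2) ^ e \<le> (h\<^sup>2) ^ e" using A(2) by (intro power_mono) auto
    then show ?thesis using True by (simp add: \<phi>_def q_def power_mult_distrib power_mult)
  next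
    case False
    have "0 \<le> h" using k by (simp add: h)
    then show ?thesis using False by (simp add: \<phi>_def)
  qed
  have hpos: "h > 0" using k by (simp add: h)
  show ?thesis
  proof (rule that[of q \<phi>])
    have "degree q \<le> degree A * e" unfolding q_def by (rule degree_power_le)
    also have "\<dots> \<le> 2 * j * e" using A(1) by (intro mult_right_mono) auto
    finally show "degree q \<le> 2 * j * e" .
    have "\<bar>\<phi> z\<bar> \<le> \<bar>M\<bar> ^ e" for z using bdd[of z] nonneg[of z] by simp
    then show "cutoff d 3 \<phi>" unfolding cutoff_def using meas supp by blast
    show "(\<integral>z. \<phi> z \<partial>leb d) > 0"
      by (rule kernel_moment(1)[where R = 3 and s = s, OF meas nonneg bdd supp hpos _ low up]) (simp_all add: e_def)
    show "(\<integral>z. \<phi> z * enorm d z ^ s \<partial>leb d) \<le> (16 ^ s + 2) * h ^ s * (\<integral>z. \<phi> z \<partial>leb d)"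
      by (rule kernel_moment(2)[where R = 3 and s = s, OF meas nonneg bdd supp hpos _ low up]) (simp_all add: e_def)
  qed (use \<phi>_def nonneg in auto)
qed

text \<open>Restricted to the sphere, \<open>|y - x|\<^sup>2 = 1 + |y|\<^sup>2 - 2 x \<bullet> y\<close> is affine in \<open>x\<close>, so a
  convolution with a polynomial in \<open>|y - x|\<^sup>2\<close> of degree \<open>m\<close> has degree at most \<open>m\<close> there.\<close>

lemma convolution_affine:
  fixes q :: "real poly" and i :: nat
  assumes x: "x \<in> sphere_d d" and i: "i \<ge> 1" and f: "continuous_on (sphere_d d) f"
    and F: "cutoff d (3/2) (shell_ext d \<rho> f)"
    and \<phi>: "\<And>z. \<phi> z = (if enorm d z \<le> 3 then poly q ((enorm d z)\<^sup>2 / 9) else 0)"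
  shows "(\<integral>y. poly q (1 / (9 * (real i)\<^sup>2) * (1 + (enorm d y)\<^sup>2 - 2 * (\<Sum>l\<le>d. x l * y l))) * shell_ext d \<rho> f y \<partial>leb d)
     = real i ^ Suc d * (\<integral>z. \<phi> z * shell_ext d \<rho> f (\<lambda>l. x l + real i * z l) \<partial>leb d)"
proof -
  define g where "g y = poly q (1 / (9 * (real i)\<^sup>2) * (1 + (enorm d y)\<^sup>2 - 2 * (\<Sum>l\<le>d. x l * y l))) * shell_ext d \<rho> f y" for y
  have "(\<lambda>y. 1 / (9 * (real i)\<^sup>2) * (1 + (enorm d y)\<^sup>2 - 2 * (\<Sum>l\<le>d. x l * y l))) \<in> borel_measurable (leb d)"
    by (intro borel_measurable_diff borel_measurable_add borel_measurable_times borel_measurable_sum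
        borel_measurable_power borel_measurable_const measurable_coord measurable_enorm) auto
  then have "(\<lambda>y. poly q (1 / (9 * (real i)\<^sup>2) * (1 + (enorm d y)\<^sup>2 - 2 * (\<Sum>l\<le>d. x l * y l)))) \<in> borel_measurable (leb d)"
    by (rule measurable_compose[OF _ borel_measurable_continuous_onI[of "poly q"]]) (auto intro: continuous_intros)
  then have "g \<in> borel_measurable (leb d)"
    unfolding g_def[abs_def] using F by (intro borel_measurable_times) (auto simp: cutoff_def)
  then have "(\<integral>y. g y \<partial>leb d) = real i ^ Suc d * (\<integral>z. g (\<lambda>l\<in>{..d}. x l + real i * z l) \<partial>leb d)"
    using i by (intro integral_leb_affine) auto
  also have "(\<lambda>z. g (\<lambda>l\<in>{..d}. x l + real i * z l)) = (\<lambda>z. \<phi> z * shell_ext d \<rho> f (\<lambda>l. x l + real i * z l))"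
  proof
    fix z
    define w where "w l = 1 * x l + real i * z l" for l
    have w: "(\<lambda>l. x l + real i * z l) = w" by (rule ext) (simp add: w_def)
    have e: "enorm d (\<lambda>l\<in>{..d}. x l + real i * z l) = enorm d w" by (rule enorm_cong) (simp add: w_def)
    have s: "shell_ext d \<rho> f (\<lambda>l\<in>{..d}. x l + real i * z l) = shell_ext d \<rho> f w" by (rule shell_ext_cong) (simp add: w_def)
    have xx: "ip d x x = 1" using enorm_sq[of d x] sphere_enorm[OF x] by simp
    have "(\<Sum>l\<le>d. x l * (\<lambda>l\<in>{..d}. x l + real i * z l) l) = ip d w x"
      unfolding ip_def by (intro sum.cong) (auto simp: w_def)
    also have "\<dots> = 1 * ip d x x + real i * ip d z x" unfolding w_def by (rule ip_lincomb)
    finally have ipw: "(\<Sum>l\<le>d. x l * (\<lambda>l\<in>{..d}. x l + real i * z l) l) = 1 + real i * ip d x z"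
      using xx by (simp add: ip_comm)
    have "(enorm d w)\<^sup>2 = 1 + 2 * real i * ip d x z + (real i)\<^sup>2 * (enorm d z)\<^sup>2"
      unfolding w_def enorm_sq_lincomb using sphere_enorm[OF x] by simp
    then have arg: "1 / (9 * (real i)\<^sup>2) * (1 + (enorm d (\<lambda>l\<in>{..d}. x l + real i * z l))\<^sup>2 - 2 * (\<Sum>l\<le>d. x l * (\<lambda>l\<in>{..d}. x l + real i * z l) l)) = (enorm d z)\<^sup>2 / 9"
      unfolding e ipw using i by simp
    have g: "g (\<lambda>l\<in>{..d}. x l + real i * z l) = poly q ((enorm d z)\<^sup>2 / 9) * shell_ext d \<rho> f w"
      unfolding g_def arg s ..
    show "g (\<lambda>l\<in>{..d}. x l + real i * z l) = \<phi> z * shell_ext d \<rho> f (\<lambda>l. x l + real i * z l)"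
    \<comment> \<open>The truncation of the kernel at radius 3 is invisible: where the extension is
      nonzero, the step satisfies i |z| \<le> 3/2 + 1. This lets the truncated kernel be replaced by
      its polynomial.\<close>
    proof (cases "enorm d w \<le> 3/2")
      case True
      have "enorm d (\<lambda>l. real i * z l) = enorm d (\<lambda>l. w l + (-1) * x l)" by (simp add: w_def)
      also have "\<dots> \<le> enorm d w + enorm d (\<lambda>l. (-1) * x l)" by (rule enorm_add_le)
      also have "enorm d (\<lambda>l. (-1) * x l) = 1" unfolding enorm_scale using sphere_enorm[OF x] by simp
      finally have "real i * enorm d z \<le> 5/2" using True by (simp add: enorm_scale)
      moreover have "1 * enorm d z \<le> real i * enorm d z" using i by (intro mult_right_mono) auto
      ultimately have z3: "enorm d z \<le> 3" by linarith
      show ?thesis by (rule trans[OF g]) (simp add: w \<phi> z3)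
    next
      case False
      then have "shell_ext d \<rho> f w = 0" by (simp add: shell_ext_def)
      then show ?thesis by (intro trans[OF g]) (simp add: w)
    qed
  qed
  finally show ?thesis by (simp only: g_def)
qed

lemma sphere_jackson:
  fixes r c\<^sub>0 :: real
  assumes r: "r > 0" and c\<^sub>0: "c\<^sub>0 > 0"
  shows "\<exists>C>0. \<forall>d n \<delta> f V. d \<ge> 1 \<longrightarrow> n \<ge> 1 \<longrightarrow> continuous_on (sphere_d d) f \<longrightarrow> \<delta> \<le> 1 \<longrightarrow> c\<^sub>0 \<le> \<delta> * sqrt n \<longrightarrow>
     (\<forall>y\<in>sphere_d d. \<bar>f y\<bar> \<le> V) \<longrightarrow>
     (\<forall>x\<in>sphere_d d. \<exists>P\<in>polys d r. \<forall>y\<in>sphere_d d. enorm d (\<lambda>i. x i - y i) \<le> \<delta> \<longrightarrow>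
        \<bar>f y - P y\<bar> \<le> V * enorm d (\<lambda>i. x i - y i) powr r) \<longrightarrow>
     (\<exists>Q\<in>polys d (2 * (real d + 2) * n). \<forall>x\<in>sphere_d d. \<bar>f x - Q x\<bar> \<le> C * V / n powr r)"
proof -
  define \<rho> where "\<rho> = nat \<lceil>r\<rceil>"
  have \<rho>: "r \<le> real \<rho>" using r unfolding \<rho>_def by linarith
  \<comment> \<open>The exponent is dictated by the final balance: h^s is of order n^(-4 \<rho>),
    and \<delta>^(-(2 \<rho> + s)) = \<delta>^(-6 \<rho>) is at most a constant times n^(3 \<rho>),
    which leaves n^(-\<rho>) \<le> n^(-r).\<close>
  define s where "s = 4 * \<rho>"
  obtain m where m: "\<And>L. L \<ge> 0 \<Longrightarrow> \<exists>C>0. \<forall>d f V \<delta> x P. d \<ge> 1 \<longrightarrow> 0 < \<delta> \<longrightarrow> \<delta> \<le> 1 \<longrightarrow> x \<in> sphere_d d \<longrightarrow>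
     (\<forall>y\<in>sphere_d d. \<bar>f y\<bar> \<le> V) \<longrightarrow> P \<in> polys d r \<longrightarrow>
     (\<forall>y\<in>sphere_d d. enorm d (\<lambda>i. x i - y i) \<le> \<delta> \<longrightarrow> \<bar>f y - P y\<bar> \<le> V * enorm d (\<lambda>i. x i - y i) powr r) \<longrightarrow>
     (\<exists>G. line_poly m G \<and> (\<forall>y. enorm d (\<lambda>i. x i - y i) \<le> L \<longrightarrow>
        \<bar>shell_ext d \<rho> f y - G y\<bar> \<le> C * V * (enorm d (\<lambda>i. x i - y i) powr r + enorm d (\<lambda>i. x i - y i) ^ s / \<delta> ^ (2 * \<rho> + s))))"
    using shell_ext_local_approx[OF r \<rho>, of s] by blast
  \<comment> \<open>A difference of order m + 1 annihilates polynomials of degree m on lines. As |z|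
    \<le> 3 on the support of the kernel, its nodes stay within 3 K of x, hence the choice L = 3 K
    below.\<close>
  define K where "K = Suc m"
  define k where "k = real K"
  have k: "k \<ge> 1" by (simp add: k_def K_def)
  obtain C1 where C1: "C1 > 0" and approx: "\<And>d f V \<delta> x P. d \<ge> 1 \<Longrightarrow> 0 < \<delta> \<Longrightarrow> \<delta> \<le> 1 \<Longrightarrow> x \<in> sphere_d d \<Longrightarrow>
     (\<forall>y\<in>sphere_d d. \<bar>f y\<bar> \<le> V) \<Longrightarrow> P \<in> polys d r \<Longrightarrow>
     (\<forall>y\<in>sphere_d d. enorm d (\<lambda>i. x i - y i) \<le> \<delta> \<longrightarrow> \<bar>f y - P y\<bar> \<le> V * enorm d (\<lambda>i. x i - y i) powr r) \<Longrightarrow>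
     \<exists>G. line_poly m G \<and> (\<forall>y. enorm d (\<lambda>i. x i - y i) \<le> 3 * k \<longrightarrow>
        \<bar>shell_ext d \<rho> f y - G y\<bar> \<le> C1 * V * (enorm d (\<lambda>i. x i - y i) powr r + enorm d (\<lambda>i. x i - y i) ^ s / \<delta> ^ (2 * \<rho> + s)))"
    using m[of "3 * k"] k by (auto simp del: of_nat_Suc)
  define H where "H = 3 * real (1 + s)"
  have H: "H > 0" by (simp add: H_def)
  define M :: real where "M = 16 ^ s + 2"
  have M: "M > 0" unfolding M_def by (intro add_pos_pos) auto
  define C where "C = 2 ^ K * C1 * (k powr r * (1 + M) * H powr r + k ^ s * M * (H ^ s / c\<^sub>0 ^ (6 * \<rho>)))"
  have C: "C > 0" unfolding C_def using C1 k M H c\<^sub>0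
    by (intro mult_pos_pos add_pos_pos zero_less_power divide_pos_pos) auto
  show ?thesis
  proof (intro exI[of _ C] conjI C allI impI)
    fix d :: nat and n \<delta> :: real and f :: "(nat \<Rightarrow> real) \<Rightarrow> real" and V :: real
    assume d: "d \<ge> 1" and n: "n \<ge> 1" and cont: "continuous_on (sphere_d d) f" and \<delta>1: "\<delta> \<le> 1" and \<delta>n: "c\<^sub>0 \<le> \<delta> * sqrt n"
      and fV: "\<forall>y\<in>sphere_d d. \<bar>f y\<bar> \<le> V"
      and loc: "\<forall>x\<in>sphere_d d. \<exists>P\<in>polys d r. \<forall>y\<in>sphere_d d. enorm d (\<lambda>i. x i - y i) \<le> \<delta> \<longrightarrow>
        \<bar>f y - P y\<bar> \<le> V * enorm d (\<lambda>i. x i - y i) powr r"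
    have "\<bar>f (\<lambda>l. if l = 0 then 1 else 0)\<bar> \<le> V" using fV unit_vector_sphere[of 0 d] by blast
    then have V: "V \<ge> 0" by linarith
    have "0 < \<delta> * sqrt n" using c\<^sub>0 \<delta>n by linarith
    then have \<delta>: "\<delta> > 0" using n by (simp add: zero_less_mult_iff)
    define F where "F = shell_ext d \<rho> f"
    have Fb: "\<bar>F y\<bar> \<le> (3/2) ^ (2 * \<rho>) * V" for y unfolding F_def using fV by (intro shell_ext_bound) auto
    have Fm: "F \<in> borel_measurable (leb d)" unfolding F_def by (rule measurable_shell_ext[OF cont])
    have "F y = 0" if "3/2 < enorm d y" for y using that by (simp add: F_def shell_ext_def)
    then have Fc: "cutoff d (3/2) F" unfolding cutoff_def using Fb Fm by blast
    \<comment> \<open>Because \<open>e\<close> is at most \<open>Suc d * (1 + s)\<close>, the degree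
      \<open>2 * j * e\<close> is at most 2 (d + 1) n; the further 2 n in the target absorbs the 1
      from the strict degree bound. The value j = 0 is allowed: then n < 1 + s and h = 3.\<close>
    define j where "j = nat \<lfloor>n / real (1 + s)\<rfloor>"
    define h where "h = 3 / (2 * real j + 1)"
    define e where "e = Suc d + s"
    have jn: "real j \<le> n / real (1 + s)" "n / real (1 + s) < real j + 1"
    proof -
      have "0 \<le> n / real (1 + s)" using n by simp
      then show "real j \<le> n / real (1 + s)" "n / real (1 + s) < real j + 1" unfolding j_def by linarith+
    qed
    have h0: "h > 0" by (simp add: h_def)
    have hn: "h \<le> H / n"
    proof -
      have "n / real (1 + s) \<le> 2 * real j + 1" using jn by linarith
      then have "3 / (2 * real j + 1) \<le> 3 / (n / real (1 + s))" using n by (intro divide_left_mono) auto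
      then show ?thesis by (simp add: h_def H_def)
    qed
    obtain q :: "real poly" and \<phi> where q: "degree q \<le> 2 * j * e"
      and \<phi>: "\<And>z. \<phi> z = (if enorm d z \<le> 3 then poly q ((enorm d z)\<^sup>2 / 9) else 0)"
      and \<phi>c: "cutoff d 3 \<phi>" and \<phi>0: "\<And>z. 0 \<le> \<phi> z" and I0: "(\<integral>z. \<phi> z \<partial>leb d) > 0"
      and mom: "(\<integral>z. \<phi> z * enorm d z ^ s \<partial>leb d) \<le> M * h ^ s * (\<integral>z. \<phi> z \<partial>leb d)"
      unfolding e_def h_def M_def by (rule localized_kernel[of j d s]) blast
    define I where "I = (\<integral>z. \<phi> z \<partial>leb d)"
    have I: "I > 0" using I0 by (simp add: I_def)
    have deg: "real (degree q) + 1 \<le> 2 * (real d + 2) * n"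
    proof -
      have "real e \<le> real (Suc d) * real (1 + s)" by (simp add: e_def algebra_simps)
      then have "real j * real e \<le> (n / real (1 + s)) * (real (Suc d) * real (1 + s))"
        using jn n by (intro mult_mono) auto
      also have "\<dots> = n * real (Suc d)" by simp
      finally have "2 * (real j * real e) + 1 \<le> 2 * (real d + 2) * n" using n by (simp add: algebra_simps)
      moreover have "real (degree q) \<le> real (2 * j * e)" using q by (rule of_nat_mono)
      ultimately show ?thesis by simp
    qed
    define T where "T i x = (\<integral>y. poly q (1 / (9 * (real i)\<^sup>2) * (1 + (enorm d y)\<^sup>2 - 2 * (\<Sum>l\<le>d. x l * y l))) * F y \<partial>leb d)" for i x
    \<comment> \<open>Dividing by \<open>real i ^ Suc d\<close> undoes the Jacobian of y = x + i z.
      The shifted sign moves the terms i \<ge> 1 of the difference to the other side, while the term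
      i = 0 is f x.\<close>
    define Q where "Q x = (\<Sum>i=1..K. ((-1) ^ Suc i * real (K choose i) / real i ^ Suc d / I) * T i x)" for x
    have "Q \<in> polys d (2 * (real d + 2) * n)"
      unfolding Q_def[abs_def]
    proof (intro polys_sum polys_scale)
      fix i
      have "T i \<in> polys d (real (degree q) + 1)" unfolding T_def[abs_def] by (rule integral_poly_polys[OF Fc])
      then show "(\<lambda>x. T i x) \<in> polys d (2 * (real d + 2) * n)" using deg polys_mono by blast
    qed
    moreover have "\<bar>f x - Q x\<bar> \<le> C * V / n powr r" if x: "x \<in> sphere_d d" for x
    proof -
      define S where "S i z = F (\<lambda>l. x l + real i * z l)" for i z
      have S0: "S 0 z = f x" for z unfolding S_def F_def using shell_ext_on_sphere[OF x] by simp
      have Sm: "S i \<in> borel_measurable (leb d)" for i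
      proof -
        have "(\<lambda>z. F (\<lambda>l\<in>{..d}. x l + real i * z l)) \<in> borel_measurable (leb d)"
          using measurable_affine Fm by (rule measurable_compose)
        moreover have "F (\<lambda>l\<in>{..d}. x l + real i * z l) = S i z" for z
          unfolding S_def F_def by (rule shell_ext_cong) simp
        ultimately show ?thesis by simp
      qed
      have int: "integrable (leb d) (\<lambda>z. S i z * \<phi> z)" for i
        using Fb by (intro cutoff_integrable[OF cutoff_mult[OF \<phi>c Sm]]) (auto simp: S_def)
      have QI: "I * Q x = (\<Sum>i=1..K. (-1) ^ Suc i * real (K choose i) * (\<integral>z. S i z * \<phi> z \<partial>leb d))"
        unfolding Q_def sum_distrib_left
      proof (rule sum.cong[OF refl])
        fix i assume "i \<in> {1..K}"
        then have i: "i \<ge> 1" by simp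
        have "T i x = real i ^ Suc d * (\<integral>z. S i z * \<phi> z \<partial>leb d)"
          unfolding T_def F_def convolution_affine[OF x i cont Fc[unfolded F_def] \<phi>] S_def by (simp only: mult.commute)
        then show "I * ((-1) ^ Suc i * real (K choose i) / real i ^ Suc d / I * T i x) = (-1) ^ Suc i * real (K choose i) * (\<integral>z. S i z * \<phi> z \<partial>leb d)"
          using I i by (simp del: power_Suc)
      qed
      have fI: "I * f x = (\<integral>z. S 0 z * \<phi> z \<partial>leb d)" by (simp add: S0 I_def mult.commute)
      have "I * (f x - Q x) = (\<Sum>i\<le>K. (-1) ^ i * real (K choose i) * (\<integral>z. S i z * \<phi> z \<partial>leb d))"
        unfolding right_diff_distrib QI fI
        by (simp add: sum.atMost_shift sum.atLeast1_atMost_eq sum_negf del: binomial_Suc_Suc)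
      also have "\<dots> = (\<integral>z. (\<Sum>i\<le>K. (-1) ^ i * real (K choose i) * (S i z * \<phi> z)) \<partial>leb d)"
        using int by (subst Bochner_Integration.integral_sum) (auto intro!: integrable_mult_right)
      finally have diff: "I * (f x - Q x) = (\<integral>z. (\<Sum>i\<le>K. (-1) ^ i * real (K choose i) * (S i z * \<phi> z)) \<partial>leb d)" .
      obtain P where P: "P \<in> polys d r" "\<forall>y\<in>sphere_d d. enorm d (\<lambda>i. x i - y i) \<le> \<delta> \<longrightarrow> \<bar>f y - P y\<bar> \<le> V * enorm d (\<lambda>i. x i - y i) powr r"
        using loc x by blast
      obtain G where G: "line_poly m G" "\<And>y. enorm d (\<lambda>i. x i - y i) \<le> 3 * k \<Longrightarrow>
        \<bar>F y - G y\<bar> \<le> C1 * V * (enorm d (\<lambda>i. x i - y i) powr r + enorm d (\<lambda>i. x i - y i) ^ s / \<delta> ^ (2 * \<rho> + s))"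
        using approx[OF d \<delta> \<delta>1 x fV P] unfolding F_def by blast
      define W where "W = 2 ^ K * (C1 * V)"
      have W: "W \<ge> 0" using C1 V by (simp add: W_def)
      define a where "a = k powr r * h powr r"
      define b where "b = k powr r * (h powr r / h ^ s) + k ^ s / \<delta> ^ (2 * \<rho> + s)"
      have a0: "a \<ge> 0" and b0: "b \<ge> 0" using k h0 \<delta> by (auto simp: a_def b_def)
      have pt: "\<bar>\<Sum>i\<le>K. (-1) ^ i * real (K choose i) * (S i z * \<phi> z)\<bar> \<le> W * (a * \<phi> z + b * (\<phi> z * enorm d z ^ s))" for z
      proof (cases "enorm d z \<le> 3")
        case False
        then show ?thesis by (simp add: \<phi>)
      next
        case True
        define t where "t = enorm d z"
        have t: "0 \<le> t" "t \<le> 3" using True by (auto simp: t_def)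
        define Gz where "Gz i = G (\<lambda>l. x l + real i * z l)" for i
        have fd: "(\<Sum>i\<le>K. (-1) ^ i * real (K choose i) * Gz i) = 0"
          unfolding Gz_def by (rule finite_difference_line_poly[OF G(1)]) (simp add: K_def)
        define X where "X = C1 * V * ((k * t) powr r + (k * t) ^ s / \<delta> ^ (2 * \<rho> + s))"
        have SG: "\<bar>S i z - Gz i\<bar> \<le> X" if "i \<le> K" for i
        proof -
          have "enorm d (\<lambda>l. x l - (x l + real i * z l)) = enorm d (\<lambda>l. (- real i) * z l)" by simp
          also have "\<dots> = real i * t" unfolding enorm_scale t_def by simp
          finally have en: "enorm d (\<lambda>l. x l - (x l + real i * z l)) = real i * t" .
          have ik: "real i * t \<le> k * t" using that t by (intro mult_right_mono) (auto simp: k_def)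
          also have "\<dots> \<le> k * 3" using k t by (intro mult_left_mono) auto
          finally have "real i * t \<le> 3 * k" by simp
          then have "\<bar>S i z - Gz i\<bar> \<le> C1 * V * ((real i * t) powr r + (real i * t) ^ s / \<delta> ^ (2 * \<rho> + s))"
            unfolding S_def Gz_def using G(2)[of "\<lambda>l. x l + real i * z l"] unfolding en by blast
          also have "\<dots> \<le> X" unfolding X_def
            using ik t r \<delta> C1 V by (intro mult_left_mono add_mono powr_mono2 divide_right_mono power_mono) auto
          finally show ?thesis .
        qed
        have "\<bar>\<Sum>i\<le>K. (-1) ^ i * real (K choose i) * S i z\<bar> = \<bar>\<Sum>i\<le>K. (-1) ^ i * real (K choose i) * (S i z - Gz i)\<bar>"
          unfolding right_diff_distrib sum_subtractf fd by simp
        also have "\<dots> \<le> (\<Sum>i\<le>K. real (K choose i) * X)"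
        proof (intro order_trans[OF sum_abs] sum_mono)
          fix i assume "i \<in> {..K}"
          then have "real (K choose i) * \<bar>S i z - Gz i\<bar> \<le> real (K choose i) * X" using SG by (intro mult_left_mono) auto
          then show "\<bar>(-1) ^ i * real (K choose i) * (S i z - Gz i)\<bar> \<le> real (K choose i) * X"
            by (simp add: abs_mult power_abs)
        qed
        also have "\<dots> = 2 ^ K * X"
        proof -
          have "(\<Sum>i\<le>K. real (K choose i)) = 2 ^ K"
            using choose_row_sum[of K] by (metis of_nat_sum of_nat_power of_nat_numeral)
          then show ?thesis by (simp flip: sum_distrib_right)
        qed
        also have "\<dots> = W * ((k * t) powr r + (k * t) ^ s / \<delta> ^ (2 * \<rho> + s))" by (simp add: W_def X_def)
        also have "\<dots> \<le> W * (a + b * t ^ s)"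
        proof (rule mult_left_mono[OF _ W])
          \<comment> \<open>Only the moments of orders 0 and s are available. Since r \<le> s, the
            power t^r is at most h^r below the kernel width h and at most its rescaled s-th power
            above it.\<close>
          have tr: "t powr r \<le> h powr r + h powr r / h ^ s * t ^ s"
          proof (cases "t \<le> h")
            case True
            then have "t powr r \<le> h powr r" using t r by (intro powr_mono2) auto
            moreover have "0 \<le> h powr r / h ^ s * t ^ s" using h0 t by simp
            ultimately show ?thesis by linarith
          next
            case False
            then have "1 \<le> t / h" using h0 by simp
            then have "(t / h) powr r \<le> (t / h) powr real s" using \<rho> by (intro powr_mono) (auto simp: s_def)
            also have "\<dots> = (t / h) ^ s" using False h0 t by (intro powr_realpow) auto
            finally have "t powr r / h powr r \<le> t ^ s / h ^ s" using t h0 by (simp add: powr_divide power_divide)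
            then have "t powr r \<le> h powr r / h ^ s * t ^ s" using h0 by (simp add: divide_simps mult_ac)
            moreover have "0 \<le> h powr r" by simp
            ultimately show ?thesis by linarith
          qed
          have "(k * t) powr r \<le> k powr r * (h powr r + h powr r / h ^ s * t ^ s)"
            unfolding powr_mult using tr by (intro mult_left_mono) auto
          then show "(k * t) powr r + (k * t) ^ s / \<delta> ^ (2 * \<rho> + s) \<le> a + b * t ^ s"
            unfolding a_def b_def power_mult_distrib distrib_left distrib_right by simp
        qed
        finally have "\<bar>\<Sum>i\<le>K. (-1) ^ i * real (K choose i) * S i z\<bar> * \<phi> z \<le> W * (a + b * t ^ s) * \<phi> z"
          using \<phi>0 by (intro mult_right_mono)
        also have "\<bar>\<Sum>i\<le>K. (-1) ^ i * real (K choose i) * S i z\<bar> * \<phi> z = \<bar>\<Sum>i\<le>K. (-1) ^ i * real (K choose i) * (S i z * \<phi> z)\<bar>"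
          unfolding mult.assoc[symmetric] sum_distrib_right[symmetric] abs_mult using \<phi>0[of z] by simp
        also have "W * (a + b * t ^ s) * \<phi> z = W * (a * \<phi> z + b * (\<phi> z * t ^ s))" by (simp add: algebra_simps)
        finally show ?thesis by (simp only: t_def)
      qed
      have in1: "integrable (leb d) \<phi>" by (rule cutoff_integrable[OF \<phi>c])
      have in2: "integrable (leb d) (\<lambda>z. \<phi> z * enorm d z ^ s)"
      proof -
        have "cutoff d 3 (\<lambda>z. enorm d z ^ s * \<phi> z)"
          by (rule cutoff_mult[OF \<phi>c, where B = "3 ^ s"]) (auto intro: power_mono)
        then show ?thesis using cutoff_integrable by (fastforce simp: mult.commute)
      qed
      have "I * \<bar>f x - Q x\<bar> = \<bar>I * (f x - Q x)\<bar>" using I by (simp add: abs_mult)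
      also have "\<dots> \<le> (\<integral>z. \<bar>\<Sum>i\<le>K. (-1) ^ i * real (K choose i) * (S i z * \<phi> z)\<bar> \<partial>leb d)"
        unfolding diff by (rule integral_abs_bound)
      also have "\<dots> \<le> (\<integral>z. W * (a * \<phi> z + b * (\<phi> z * enorm d z ^ s)) \<partial>leb d)"
        using pt in1 in2 int
        by (intro integral_mono integrable_abs Bochner_Integration.integrable_sum integrable_mult_right Bochner_Integration.integrable_add) auto
      also have "\<dots> = W * (a * I + b * (\<integral>z. \<phi> z * enorm d z ^ s \<partial>leb d))"
        using in1 in2 by (simp add: I_def)
      also have "\<dots> \<le> W * (a * I + b * (M * h ^ s * I))"
        using mom W b0 unfolding I_def[symmetric] by (intro mult_left_mono add_left_mono) auto
      also have "\<dots> = I * (W * (a + b * (M * h ^ s)))" by (simp add: algebra_simps)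
      finally have "\<bar>f x - Q x\<bar> \<le> W * (a + b * (M * h ^ s))" using I by simp
      also have "a + b * (M * h ^ s) = k powr r * (1 + M) * h powr r + k ^ s * M * (h ^ s / \<delta> ^ (2 * \<rho> + s))"
        using h0 \<delta> by (simp add: a_def b_def field_simps)
      also have "W * (k powr r * (1 + M) * h powr r + k ^ s * M * (h ^ s / \<delta> ^ (2 * \<rho> + s)))
          \<le> W * (k powr r * (1 + M) * (H powr r / n powr r) + k ^ s * M * (H ^ s / c\<^sub>0 ^ (6 * \<rho>) / n powr r))"
      proof (intro mult_left_mono add_mono W)
        have "h powr r \<le> (H / n) powr r" using hn h0 r by (intro powr_mono2) auto
        then show "h powr r \<le> H powr r / n powr r" using H n by (simp add: powr_divide)
        have "c\<^sub>0 ^ (6 * \<rho>) \<le> (\<delta> * sqrt n) ^ (6 * \<rho>)" using c\<^sub>0 \<delta>n by (intro power_mono) auto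
        also have "\<dots> = \<delta> ^ (6 * \<rho>) * n ^ (3 * \<rho>)"
        proof -
          have "sqrt n ^ (6 * \<rho>) = (sqrt n ^ 2) ^ (3 * \<rho>)" by (simp flip: power_mult)
          then show ?thesis using n by (simp add: power_mult_distrib)
        qed
        finally have c6: "c\<^sub>0 ^ (6 * \<rho>) \<le> \<delta> ^ (6 * \<rho>) * n ^ (3 * \<rho>)" .
        have nr: "n powr r \<le> n ^ \<rho>"
          using powr_mono[OF \<rho> n] n by (simp add: powr_realpow)
        have "h ^ s \<le> (H / n) ^ s" using hn h0 by (intro power_mono) auto
        then have "h ^ s * c\<^sub>0 ^ (6 * \<rho>) * n powr r \<le> (H / n) ^ s * (\<delta> ^ (6 * \<rho>) * n ^ (3 * \<rho>)) * n ^ \<rho>"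
          using c6 nr c\<^sub>0 H n \<delta> by (intro mult_mono) auto
        also have "\<dots> = H ^ s * \<delta> ^ (6 * \<rho>) * (n ^ (3 * \<rho>) * n ^ \<rho> / n ^ s)"
          by (simp add: power_divide)
        also have "n ^ (3 * \<rho>) * n ^ \<rho> / n ^ s = 1" using n by (simp add: s_def flip: power_add)
        finally have "h ^ s * c\<^sub>0 ^ (6 * \<rho>) * n powr r \<le> H ^ s * \<delta> ^ (6 * \<rho>)" by simp
        moreover have "2 * \<rho> + s = 6 * \<rho>" by (simp add: s_def)
        ultimately show "h ^ s / \<delta> ^ (2 * \<rho> + s) \<le> H ^ s / c\<^sub>0 ^ (6 * \<rho>) / n powr r"
          using \<delta> c\<^sub>0 n by (simp add: divide_simps mult_ac)
      qed (use k M in auto)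
      also have "\<dots> = C * V / n powr r" 
      proof -
        have "2 ^ K * (C1 * V) * (a * (b / N) + c * (e / N)) = 2 ^ K * C1 * (a * b + c * e) * V / N" for a b c e N
          by (simp add: algebra_simps add_divide_distrib)
        then show ?thesis unfolding W_def C_def by blast
      qed
      finally show ?thesis .
    qed
    ultimately show "\<exists>Q\<in>polys d (2 * (real d + 2) * n). \<forall>x\<in>sphere_d d. \<bar>f x - Q x\<bar> \<le> C * V / n powr r" by blast
  qed
qed

section \<open>From the extended-real smoothness norm to local approximants\<close>

lemma sphere_limit_value:
  assumes d: "d \<ge> 1" and f: "continuous_on (sphere_d d) f" and P: "P \<in> polys d m" and x: "x \<in> sphere_d d"
    and r: "r > 0" and \<delta>: "\<delta> > 0"
    and loc: "\<And>y. y \<in> sphere_d d \<Longrightarrow> enorm d (\<lambda>i. x i - y i) \<le> \<delta> \<Longrightarrow> y \<noteq> x \<Longrightarrow>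
      \<bar>f y - P y\<bar> \<le> V * enorm d (\<lambda>i. x i - y i) powr r"
  shows "f x = P x"
proof -
  \<comment> \<open>The hypothesis says nothing at y = x, so the value there is reached as a limit
    along a great circle through x; d \<ge> 1 guarantees a direction in which to move.\<close>
  obtain v where v: "v \<in> sphere_d d" "ip d x v = 0" using sphere_orthogonal[OF x d] by blast
  define c where "c t = (\<lambda>i. cos t * x i + sin t * v i)" for t
  have c: "c t \<in> sphere_d d" "(enorm d (\<lambda>i. x i - c t i))\<^sup>2 = 2 - 2 * cos t" for t
    using sphere_lincomb[OF x v, of "cos t" "sin t"] by (simp_all add: c_def)
  have c0: "c 0 = x" by (simp add: c_def)
  have cc: "continuous_on UNIV c" unfolding c_def[abs_def]
    by (intro continuous_on_coordinatewise_then_product continuous_intros)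
  have "continuous_on UNIV (\<lambda>t. \<bar>f (c t) - P (c t)\<bar>)"
    using continuous_on_compose2[OF f cc] continuous_on_compose2[OF continuous_on_polys[OF P, of UNIV] cc] c(1)
    by (intro continuous_intros) auto
  then have l1: "((\<lambda>t. \<bar>f (c t) - P (c t)\<bar>) \<longlongrightarrow> \<bar>f x - P x\<bar>) (at_right 0)"
    unfolding continuous_on_def using c0 by (metis UNIV_I tendsto_within_subset subset_UNIV)
  have "continuous_on UNIV (\<lambda>t. enorm d (\<lambda>i. x i - c t i))"
    by (intro continuous_intros continuous_on_coordinatewise_then_product continuous_on_product_then_coordinatewise[OF cc])
  then have "((\<lambda>t. enorm d (\<lambda>i. x i - c t i)) \<longlongrightarrow> enorm d (\<lambda>i. x i - c 0 i)) (at_right 0)"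
    unfolding continuous_on_def by (meson UNIV_I tendsto_within_subset subset_UNIV)
  moreover have "enorm d (\<lambda>i. x i - c 0 i) = 0" by (simp add: c0 enorm_def)
  ultimately have e0: "((\<lambda>t. enorm d (\<lambda>i. x i - c t i)) \<longlongrightarrow> 0) (at_right 0)" by simp
  then have ev1: "\<forall>\<^sub>F t in at_right 0. enorm d (\<lambda>i. x i - c t i) < \<delta>" using \<delta> by (rule order_tendstoD)
  have ev2: "\<forall>\<^sub>F t in at_right (0::real). 0 < t \<and> t < 1"
    using eventually_at_right[of 0 1] by (intro eventually_at_rightI[of 0 1]) auto
  have "((\<lambda>t. V * enorm d (\<lambda>i. x i - c t i) powr r) \<longlongrightarrow> V * 0 powr r) (at_right 0)"
    using e0 r by (intro tendsto_intros tendsto_powr') auto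
  moreover have "\<forall>\<^sub>F t in at_right 0. \<bar>f (c t) - P (c t)\<bar> \<le> V * enorm d (\<lambda>i. x i - c t i) powr r"
    using ev1 ev2
  proof eventually_elim
    case (elim t)
    have "cos t < cos 0" using elim pi_gt3 by (intro cos_monotone_0_pi) auto
    then have "c t \<noteq> x" using c(2)[of t] by (auto simp: enorm_def)
    then show ?case using elim c(1) by (intro loc) auto
  qed
  ultimately have "\<bar>f x - P x\<bar> \<le> V * 0 powr r"
    using l1 by (intro tendsto_le[OF trivial_limit_at_right_real]) auto
  then show ?thesis by simp
qed

text \<open>Were the set empty, \<open>sphere_limit_value\<close> would hold vacuously and force
  every constant to be 0. Nonemptiness matters since a supremum over the empty set is
  \<open>-\<infinity>\<close> in \<open>ereal\<close>, and the inner term of \<open>W_norm\<close>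
  must be nonnegative.\<close>

lemma cap_punctured_nonempty:
  assumes d: "d \<ge> 1" and x: "x \<in> sphere_d d" and \<delta>: "\<delta> > 0"
  shows "cap d x \<delta> - {x} \<noteq> {}"
proof
  assume "cap d x \<delta> - {x} = {}"
  then have none: "y = x" if "y \<in> sphere_d d" "enorm d (\<lambda>i. x i - y i) \<le> \<delta>" for y
    using that by (auto simp: cap_def fun_diff_def)
  have "a = 0" for a :: real
    using sphere_limit_value[OF d continuous_on_const[of _ a] polys_const[of 1 0] x zero_less_one \<delta>, of 0] none by auto
  from this[of 1] show False by simp
qed

text \<open>The slack \<epsilon> yields an actual polynomial from the infimum without knowing that
  it is attained. Both summands of \<open>W_norm\<close> are nonnegative, so a single
  \<open>V\<close> bounds |f| and the local quotient.\<close>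

lemma W_norm_local:
  assumes d: "d \<ge> 1" and r: "r > 0" and \<delta>: "\<delta> > 0" and f: "continuous_on (sphere_d d) f" and fin: "W_norm d r \<delta> f < \<infinity>"
    and \<epsilon>: "\<epsilon> > 0"
  defines "V \<equiv> real_of_ereal (W_norm d r \<delta> f) + \<epsilon>"
  shows "\<forall>y\<in>sphere_d d. \<bar>f y\<bar> \<le> V"
    and "\<forall>x\<in>sphere_d d. \<exists>P\<in>polys d r. \<forall>y\<in>sphere_d d. enorm d (\<lambda>i. x i - y i) \<le> \<delta> \<longrightarrow>
        \<bar>f y - P y\<bar> \<le> V * enorm d (\<lambda>i. x i - y i) powr r"
proof -
  define S where "S x P = (SUP y\<in>cap d x \<delta> - {x}. ereal (\<bar>f y - P y\<bar> / enorm d (x - y) powr r))" for x P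
  define J where "J x = (INF P\<in>polys d r. S x P)" for x
  have J0: "0 \<le> J x" if x: "x \<in> sphere_d d" for x
    unfolding J_def
  proof (rule INF_greatest)
    fix P
    obtain y where y: "y \<in> cap d x \<delta> - {x}" using cap_punctured_nonempty[OF d x \<delta>] by blast
    have "0 \<le> ereal (\<bar>f y - P y\<bar> / enorm d (x - y) powr r)" by simp
    also have "\<dots> \<le> S x P" unfolding S_def using y by (rule SUP_upper)
    finally show "0 \<le> S x P" .
  qed
  have le: "ereal (sup_norm d f) + J x \<le> W_norm d r \<delta> f" if "x \<in> sphere_d d" for x
    unfolding W_norm_def J_def S_def using that by (rule SUP_upper)
  have a0: "0 \<le> ereal (sup_norm d f)" using sup_norm_nonneg[OF f] by simp
  define x0 :: "nat \<Rightarrow> real" where "x0 l = (if l = 0 then 1 else 0)" for l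
  have x0: "x0 \<in> sphere_d d" using unit_vector_sphere[of 0 d] by (simp add: x0_def[abs_def])
  have "ereal (sup_norm d f) + 0 \<le> ereal (sup_norm d f) + J x0" using J0[OF x0] by (intro add_left_mono)
  then have aW: "ereal (sup_norm d f) \<le> W_norm d r \<delta> f" using le[OF x0] by simp
  then have "0 \<le> W_norm d r \<delta> f" using a0 by (rule order_trans[rotated])
  then obtain w where w: "W_norm d r \<delta> f = ereal w" using fin by (cases "W_norm d r \<delta> f") auto
  have V: "V = w + \<epsilon>" by (simp add: V_def w)
  have aw: "sup_norm d f \<le> w" using aW by (simp add: w)
  show "\<forall>y\<in>sphere_d d. \<bar>f y\<bar> \<le> V" using abs_le_sup_norm[OF f] aw \<epsilon> unfolding V by fastforce
  show "\<forall>x\<in>sphere_d d. \<exists>P\<in>polys d r. \<forall>y\<in>sphere_d d. enorm d (\<lambda>i. x i - y i) \<le> \<delta> \<longrightarrow>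
        \<bar>f y - P y\<bar> \<le> V * enorm d (\<lambda>i. x i - y i) powr r"
  proof
    fix x assume x: "x \<in> sphere_d d"
    have "0 + J x \<le> ereal (sup_norm d f) + J x" using a0 by (intro add_right_mono)
    then have "J x \<le> ereal w" using le[OF x] by (simp add: w)
    also have "ereal w < ereal V" using \<epsilon> by (simp add: V)
    finally obtain P where P: "P \<in> polys d r" "S x P < ereal V" unfolding J_def INF_less_iff by blast
    have bd: "\<bar>f y - P y\<bar> \<le> V * enorm d (\<lambda>i. x i - y i) powr r"
      if y: "y \<in> sphere_d d" "enorm d (\<lambda>i. x i - y i) \<le> \<delta>" "y \<noteq> x" for y
    proof -
      have "ereal (\<bar>f y - P y\<bar> / enorm d (x - y) powr r) \<le> S x P"
        unfolding S_def using y by (intro SUP_upper) (simp add: cap_def fun_diff_def)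
      also have "\<dots> \<le> ereal V" using P(2) by simp
      finally have q: "\<bar>f y - P y\<bar> / enorm d (\<lambda>i. x i - y i) powr r \<le> V" by (simp add: fun_diff_def)
      have "enorm d (\<lambda>i. x i - y i) \<noteq> 0"
      proof
        assume z: "enorm d (\<lambda>i. x i - y i) = 0"
        have "x i = y i" for i
          using enorm_eq_0_coord[OF z, of i] x y(1) by (cases "i \<le> d") (auto simp: sphere_d_def)
        with y(3) show False by auto
      qed
      then have "enorm d (\<lambda>i. x i - y i) powr r > 0" by simp
      with q show ?thesis by (simp add: pos_divide_le_eq)
    qed
    \<comment> \<open>At the excluded point the right-hand side is \<open>V * 0 powr r\<close>, that
      is 0, so the bound there amounts to equality.\<close>
    have "f x = P x" by (rule sphere_limit_value[OF d f P(1) x r \<delta> bd])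
    then have "\<bar>f x - P x\<bar> \<le> V * enorm d (\<lambda>i. x i - x i) powr r" by (simp add: enorm_def)
    with bd P(1) show "\<exists>P\<in>polys d r. \<forall>y\<in>sphere_d d. enorm d (\<lambda>i. x i - y i) \<le> \<delta> \<longrightarrow>
        \<bar>f y - P y\<bar> \<le> V * enorm d (\<lambda>i. x i - y i) powr r"
      by (intro bexI[of _ P]) metis+
  qed
qed

lemma best_approx_le:
  assumes f: "continuous_on (sphere_d d) f" and Q: "Q \<in> polys d m" and "\<And>x. x \<in> sphere_d d \<Longrightarrow> \<bar>f x - Q x\<bar> \<le> b"
  shows "best_approx d m f \<le> b"
proof -
  have c: "0 \<le> sup_norm d (\<lambda>x. f x - P x)" if "P \<in> polys d m" for P
    using f continuous_on_polys[OF that] by (intro sup_norm_nonneg continuous_intros)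
  have "best_approx d m f \<le> sup_norm d (\<lambda>x. f x - Q x)"
    unfolding best_approx_def by (rule cINF_lower[OF _ Q]) (use c in \<open>auto intro!: bdd_belowI[of _ 0]\<close>)
  also have "\<dots> \<le> b" unfolding sup_norm_def
    using assms(3) unit_vector_sphere[of 0 d] by (intro cSUP_least) auto
  finally show ?thesis .
qed

theorem theorem5p2:
  fixes r :: real
  assumes "r > 0"
  shows "\<exists>C>0. \<forall>(d::nat) (n::real) (\<delta>::real) f.
     d \<ge> 3 \<longrightarrow> n \<ge> 2 * (real d + 1) \<longrightarrow> real d * n \<in> \<int> \<longrightarrow>
     cont_sphere d f \<longrightarrow> \<delta> > 0 \<longrightarrow> W_norm d r \<delta> f < \<infinity> \<longrightarrow>
     real d * n \<ge> (real d + r + 1)\<^sup>2 \<longrightarrow> sqrt (16 * r * ln n / n) \<le> \<delta> \<longrightarrow>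
     best_approx d (2 * (real d + 2) * n) f
       \<le> C * (real d powr (1/6) / real (dimP d (2 * (real d + 2) * n)) powr (r / real d))
             * real_of_ereal (W_norm d r \<delta> f)"
proof -
  \<comment> \<open>Since ln n \<ge> 1, the hypothesis on \<delta> gives \<delta> sqrt n \<ge> sqrt
    (16 r). The minimum with 1 accounts for cutting \<delta> down to 1, where sqrt n \<ge> 1 is used
    instead.\<close>
  define c\<^sub>0 where "c\<^sub>0 = min 1 (sqrt (16 * r))"
  have c\<^sub>0: "c\<^sub>0 > 0" using assms by (simp add: c\<^sub>0_def)
  obtain C where C: "C > 0" and jackson: "\<And>d n \<delta> f V. d \<ge> 1 \<Longrightarrow> n \<ge> 1 \<Longrightarrow> continuous_on (sphere_d d) f \<Longrightarrow> \<delta> \<le> 1 \<Longrightarrow> c\<^sub>0 \<le> \<delta> * sqrt n \<Longrightarrow>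
     (\<forall>y\<in>sphere_d d. \<bar>f y\<bar> \<le> V) \<Longrightarrow>
     (\<forall>x\<in>sphere_d d. \<exists>P\<in>polys d r. \<forall>y\<in>sphere_d d. enorm d (\<lambda>i. x i - y i) \<le> \<delta> \<longrightarrow>
        \<bar>f y - P y\<bar> \<le> V * enorm d (\<lambda>i. x i - y i) powr r) \<Longrightarrow>
     \<exists>Q\<in>polys d (2 * (real d + 2) * n). \<forall>x\<in>sphere_d d. \<bar>f x - Q x\<bar> \<le> C * V / n powr r"
    using sphere_jackson[OF assms c\<^sub>0] by blast
  define C' where "C' = C * (14 * exp 1) powr r"
  have C': "C' > 0" using C by (simp add: C'_def)
  show ?thesis
  proof (intro exI[of _ C'] conjI C' allI impI)
    fix d :: nat and n \<delta> :: real and f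
    assume d: "d \<ge> 3" and n: "n \<ge> 2 * (real d + 1)" and cont: "cont_sphere d f" and \<delta>: "\<delta> > 0"
      and fin: "W_norm d r \<delta> f < \<infinity>" and \<delta>n: "sqrt (16 * r * ln n / n) \<le> \<delta>"
    define w where "w = real_of_ereal (W_norm d r \<delta> f)"
    define m where "m = 2 * (real d + 2) * n"
    have "8 = 2 * (3 + 1 :: real)" by simp
    also have "\<dots> \<le> 2 * (real d + 1)" using d by simp
    also note n
    finally have n8: "n \<ge> 8" .
    have d1: "d \<ge> 1" using d by simp
    have f: "continuous_on (sphere_d d) f" by (rule cont_sphere_continuous_on[OF cont])
    \<comment> \<open>Local approximants on a cap serve on any smaller cap, and the growth estimate
      behind \<open>jackson\<close> is stated for radii up to 1.\<close>
    define \<delta>' where "\<delta>' = min \<delta> 1"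
    have c\<delta>: "c\<^sub>0 \<le> \<delta>' * sqrt n"
    proof -
      have "exp 1 \<le> n" using exp_le n8 by linarith
      then have "1 \<le> ln n" using n8 by (subst ln_ge_iff) auto
      then have "16 * r / n \<le> 16 * r * ln n / n" using assms n8 by (intro divide_right_mono) auto
      then have "sqrt (16 * r / n) \<le> \<delta>" using \<delta>n real_sqrt_le_mono order_trans by blast
      then have "sqrt (16 * r) \<le> \<delta> * sqrt n" using n8 by (simp add: real_sqrt_divide field_simps)
      moreover have "1 \<le> 1 * sqrt n" using n8 by simp
      ultimately have "c\<^sub>0 \<le> \<delta> * sqrt n" "c\<^sub>0 \<le> 1 * sqrt n" unfolding c\<^sub>0_def by linarith+
      then show ?thesis by (cases "\<delta> \<le> 1") (simp_all add: \<delta>'_def)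
    qed
    have "best_approx d m f \<le> C * w / n powr r"
    proof (rule field_le_epsilon)
      fix \<epsilon> :: real assume \<epsilon>: "\<epsilon> > 0"
      \<comment> \<open>Scaled so that, after multiplication by C / n^r, the slack in the smoothness
        norm contributes exactly \<epsilon>.\<close>
      define \<epsilon>' where "\<epsilon>' = \<epsilon> * n powr r / C"
      have \<epsilon>': "\<epsilon>' > 0" using \<epsilon> C n8 by (simp add: \<epsilon>'_def)
      note bounds = W_norm_local[OF d1 assms \<delta> f fin \<epsilon>', folded w_def]
      have "\<exists>Q\<in>polys d m. \<forall>x\<in>sphere_d d. \<bar>f x - Q x\<bar> \<le> C * (w + \<epsilon>') / n powr r"
        unfolding m_def
      proof (rule jackson[OF d1 _ f _ c\<delta> bounds(1)])
        show "1 \<le> n" "\<delta>' \<le> 1" using n8 by (auto simp: \<delta>'_def)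
        have "\<delta>' \<le> \<delta>" by (simp add: \<delta>'_def)
        then show "\<forall>x\<in>sphere_d d. \<exists>P\<in>polys d r. \<forall>y\<in>sphere_d d. enorm d (\<lambda>i. x i - y i) \<le> \<delta>' \<longrightarrow>
            \<bar>f y - P y\<bar> \<le> (w + \<epsilon>') * enorm d (\<lambda>i. x i - y i) powr r"
          using bounds(2) by (meson order_trans)
      qed
      then obtain Q where "Q \<in> polys d m" "\<forall>x\<in>sphere_d d. \<bar>f x - Q x\<bar> \<le> C * (w + \<epsilon>') / n powr r" by blast
      then have "best_approx d m f \<le> C * (w + \<epsilon>') / n powr r" using best_approx_le[OF f] by blast
      also have "\<dots> = C * w / n powr r + \<epsilon>" using C n8 by (simp add: \<epsilon>'_def field_simps)
      finally show "best_approx d m f \<le> C * w / n powr r + \<epsilon>" .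
    qed
    also have "\<dots> \<le> C * w * ((14 * exp 1) powr r * (real d powr (1/6) / real (dimP d m) powr (r / real d)))"
    proof -
      have "0 \<le> w"
      proof (rule field_le_epsilon)
        fix e :: real assume "e > 0"
        from W_norm_local(1)[OF d1 assms \<delta> f fin this] unit_vector_sphere[of 0 d]
        have "\<bar>f (\<lambda>l. if l = 0 then 1 else 0)\<bar> \<le> w + e" unfolding w_def by blast
        then show "0 \<le> w + e" by linarith
      qed
      have "m > 0" using n8 by (simp add: m_def)
      then have D: "0 < real (dimP d m) powr (r / real d)" using dimP_bounds(1)[of m d] by simp
      have "real (dimP d m) powr (r / real d) \<le> (14 * exp 1 * n) powr r"
        unfolding m_def using n8 assms d1 by (intro dimP_root_le) auto
      then have "1 / n powr r \<le> (14 * exp 1) powr r * (1 / real (dimP d m) powr (r / real d))"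
        using D n8 by (simp add: powr_mult field_simps)
      also have "\<dots> \<le> (14 * exp 1) powr r * (real d powr (1/6) / real (dimP d m) powr (r / real d))"
        using d D ge_one_powr_ge_zero[of "real d" "1/6"] by (intro mult_left_mono divide_right_mono) auto
      finally have "C * w * (1 / n powr r) \<le> C * w * ((14 * exp 1) powr r * (real d powr (1/6) / real (dimP d m) powr (r / real d)))"
        using C \<open>0 \<le> w\<close> by (intro mult_left_mono) auto
      then show ?thesis by simp
    qed
    also have "\<dots> = C' * (real d powr (1/6) / real (dimP d m) powr (r / real d)) * w" by (simp add: C'_def)
    finally show "best_approx d (2 * (real d + 2) * n) f
       \<le> C' * (real d powr (1/6) / real (dimP d (2 * (real d + 2) * n)) powr (r / real d)) * real_of_ereal (W_norm d r \<delta> f)"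
      by (simp only: m_def w_def)
  qed
qed

end
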